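(* Let $\mathbb K$ be a field with $\operatorname{char}\mathbb K\neq 2$, let $V$ be an $n$-dimensional $\mathbb K$-vector space with a non-degenerate symmetric bilinear form, and let $\mathfrak{so}_n=\mathfrak{so}(V)$ be the corresponding orthogonal Lie algebra. Suppose $e\in\mathfrak{so}_n$ is a nilpotent element with $k$ Jordan blocks on $V$, and that $\mathbb K$ contains at least $k$ elements. Let $\mathfrak z(e)$ be the centraliser of $e$ in $\mathfrak{so}_n$. Then $\operatorname{ind}\mathfrak z(e)=\operatorname{rk}\mathfrak{so}_n=[n/2]$.
   Context: For a finite-dimensional Lie algebra $\mathfrak q$ over $\mathbb K$ and $\alpha\in\mathfrak q^*$, the stabiliser is $\mathfrak q_\alpha=\{\xi\in\mathfrak q:\alpha([\xi,\mathfrak q])=0\}$, and the index is $\operatorname{ind}\mathfrak q=\min_{\alpha\in\mathfrak q^*}\dim\mathfrak q_\alpha$. Here $[x]$ denotes the integer part of $x$. *)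

theory Defs
  imports Complex_Main "HOL-Library.Function_Algebras"
begin

subsection \<open>Lie algebras inside an ambient vector space\<close>

text \<open>A Lie algebra is a bracket together with a finite-dimensional subspace \<open>L\<close> of an ambient
  vector space; the Lie algebra axioms are only required on \<open>L\<close>.\<close>

locale fin_dim_lie_algebra = vector_space scale
  for scale :: "'k::field \<Rightarrow> 'a::ab_group_add \<Rightarrow> 'a" +
  fixes br :: "'a \<Rightarrow> 'a \<Rightarrow> 'a" and L :: "'a set"
  assumes subspace: "subspace L"
    and fin_dim: "\<exists>S. finite S \<and> L \<subseteq> span S"
    and closed: "x \<in> L \<Longrightarrow> y \<in> L \<Longrightarrow> br x y \<in> L"
    and add_left: "x \<in> L \<Longrightarrow> y \<in> L \<Longrightarrow> z \<in> L \<Longrightarrow> br (x + y) z = br x z + br y z"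
    and add_right: "x \<in> L \<Longrightarrow> y \<in> L \<Longrightarrow> z \<in> L \<Longrightarrow> br x (y + z) = br x y + br x z"
    and scale_left: "x \<in> L \<Longrightarrow> y \<in> L \<Longrightarrow> br (scale c x) y = scale c (br x y)"
    and scale_right: "x \<in> L \<Longrightarrow> y \<in> L \<Longrightarrow> br x (scale c y) = scale c (br x y)"
    and alternating: "x \<in> L \<Longrightarrow> br x x = 0"
    and jacobi: "x \<in> L \<Longrightarrow> y \<in> L \<Longrightarrow> z \<in> L \<Longrightarrow>
      br x (br y z) + br y (br z x) + br z (br x y) = 0"

text \<open>Elements of the dual space of \<open>L\<close> are represented by functions on the ambient space that are
  linear on \<open>L\<close>; their values outside \<open>L\<close> are arbitrary and never used.\<close>

definition dual_space :: "('k::field \<Rightarrow> 'a::ab_group_add \<Rightarrow> 'a) \<Rightarrow> 'a set \<Rightarrow> ('a \<Rightarrow> 'k) set" where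
  "dual_space scale L = {\<alpha>. (\<forall>x\<in>L. \<forall>y\<in>L. \<alpha> (x + y) = \<alpha> x + \<alpha> y) \<and>
                            (\<forall>c. \<forall>x\<in>L. \<alpha> (scale c x) = c * \<alpha> x)}"

definition stabiliser :: "('a \<Rightarrow> 'a \<Rightarrow> 'a) \<Rightarrow> 'a set \<Rightarrow> ('a \<Rightarrow> 'k::zero) \<Rightarrow> 'a set" where
  "stabiliser br L \<alpha> = {x \<in> L. \<forall>y\<in>L. \<alpha> (br x y) = 0}"

text \<open>The infimum is taken over a nonempty set of natural numbers, so it is a minimum.\<close>

definition lie_index ::
  "('k::field \<Rightarrow> 'a::ab_group_add \<Rightarrow> 'a) \<Rightarrow> ('a \<Rightarrow> 'a \<Rightarrow> 'a) \<Rightarrow> 'a set \<Rightarrow> nat" where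
  "lie_index scale br L =
     (INF \<alpha>\<in>dual_space scale L. vector_space.dim scale (stabiliser br L \<alpha>))"

definition lie_centraliser :: "('a::zero \<Rightarrow> 'a \<Rightarrow> 'a) \<Rightarrow> 'a set \<Rightarrow> 'a \<Rightarrow> 'a set" where
  "lie_centraliser br L e = {x \<in> L. br x e = 0}"

definition lie_normaliser :: "('a \<Rightarrow> 'a \<Rightarrow> 'a) \<Rightarrow> 'a set \<Rightarrow> 'a set \<Rightarrow> 'a set" where
  "lie_normaliser br L H = {x \<in> L. \<forall>y\<in>H. br x y \<in> H}"

primrec lower_central_series ::
  "('k::field \<Rightarrow> 'a::ab_group_add \<Rightarrow> 'a) \<Rightarrow> ('a \<Rightarrow> 'a \<Rightarrow> 'a) \<Rightarrow> 'a set \<Rightarrow> nat \<Rightarrow> 'a set" where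
  "lower_central_series scale br H 0 = H"
| "lower_central_series scale br H (Suc i) =
     module.span scale {br x y | x y. x \<in> H \<and> y \<in> lower_central_series scale br H i}"

definition nilpotent_lie_algebra ::
  "('k::field \<Rightarrow> 'a::ab_group_add \<Rightarrow> 'a) \<Rightarrow> ('a \<Rightarrow> 'a \<Rightarrow> 'a) \<Rightarrow> 'a set \<Rightarrow> bool" where
  "nilpotent_lie_algebra scale br H \<longleftrightarrow> (\<exists>m. lower_central_series scale br H m = {0})"

definition cartan_subalgebra ::
  "('k::field \<Rightarrow> 'a::ab_group_add \<Rightarrow> 'a) \<Rightarrow> ('a \<Rightarrow> 'a \<Rightarrow> 'a) \<Rightarrow> 'a set \<Rightarrow> 'a set \<Rightarrow> bool" where
  "cartan_subalgebra scale br L H \<longleftrightarrow>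
     H \<subseteq> L \<and> module.subspace scale H \<and> (\<forall>x\<in>H. \<forall>y\<in>H. br x y \<in> H) \<and>
     nilpotent_lie_algebra scale br H \<and> lie_normaliser br L H = H"

text \<open>The rank is the dimension of a Cartan subalgebra. The minimum is taken so that the definition
  is meaningful for Lie algebras with Cartan subalgebras of different dimensions, which exist in
  positive characteristic.\<close>

definition lie_rank ::
  "('k::field \<Rightarrow> 'a::ab_group_add \<Rightarrow> 'a) \<Rightarrow> ('a \<Rightarrow> 'a \<Rightarrow> 'a) \<Rightarrow> 'a set \<Rightarrow> nat" where
  "lie_rank scale br L = (INF H\<in>Collect (cartan_subalgebra scale br L). vector_space.dim scale H)"


subsection \<open>Endomorphisms and the orthogonal Lie algebra\<close>

text \<open>Endomorphisms of \<open>V\<close> are linear functions \<open>'v \<Rightarrow> 'v\<close>, inside the vector space of all such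
  functions with pointwise operations.\<close>

definition fun_scale :: "('k \<Rightarrow> 'v \<Rightarrow> 'v) \<Rightarrow> 'k \<Rightarrow> ('v \<Rightarrow> 'v) \<Rightarrow> 'v \<Rightarrow> 'v" where
  "fun_scale scale c f = (\<lambda>v. scale c (f v))"

definition commutator :: "('v \<Rightarrow> 'v) \<Rightarrow> ('v \<Rightarrow> 'v) \<Rightarrow> 'v \<Rightarrow> 'v::ab_group_add" where
  "commutator f g = (\<lambda>v. f (g v) - g (f v))"

locale nondegenerate_symmetric_form = finite_dimensional_vector_space scale Basis
  for scale :: "'k::field \<Rightarrow> 'v::ab_group_add \<Rightarrow> 'v" and Basis :: "'v set" +
  fixes B :: "'v \<Rightarrow> 'v \<Rightarrow> 'k"
  assumes linear_left: "Vector_Spaces.linear scale (*) (\<lambda>u. B u v)"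
    and linear_right: "Vector_Spaces.linear scale (*) (B u)"
    and symmetric: "B u v = B v u"
    and nondegenerate: "(\<And>v. B u v = 0) \<Longrightarrow> u = 0"

definition so :: "('k::field \<Rightarrow> 'v::ab_group_add \<Rightarrow> 'v) \<Rightarrow> ('v \<Rightarrow> 'v \<Rightarrow> 'k) \<Rightarrow> ('v \<Rightarrow> 'v) set" where
  "so scale B = {f. Vector_Spaces.linear scale scale f \<and> (\<forall>u v. B (f u) v + B u (f v) = 0)}"

definition nilpotent_map :: "('v \<Rightarrow> 'v::zero) \<Rightarrow> bool" where
  "nilpotent_map f \<longleftrightarrow> (\<exists>m. \<forall>v. (f ^^ m) v = 0)"

text \<open>A nilpotent \<open>f\<close> has \<open>k\<close> Jordan blocks if there is a basis made up of \<open>k\<close> Jordan chains for the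
  eigenvalue \<open>0\<close>: the \<open>i\<close>-th chain \<open>w i, f (w i), \<dots>, f\<^bsup>d i\<^esup> (w i)\<close> is annihilated after \<open>d i + 1\<close> steps
  and corresponds to a block of size \<open>d i + 1\<close>.\<close>

definition nilpotent_jordan_blocks ::
  "('k::field \<Rightarrow> 'v::ab_group_add \<Rightarrow> 'v) \<Rightarrow> ('v \<Rightarrow> 'v) \<Rightarrow> nat \<Rightarrow> bool" where
  "nilpotent_jordan_blocks scale f k \<longleftrightarrow>
     (\<exists>(w :: nat \<Rightarrow> 'v) (d :: nat \<Rightarrow> nat).
        let I = (SIGMA i:{..<k}. {..d i}); b = (\<lambda>(i, s). (f ^^ s) (w i)) in
        inj_on b I \<and> \<not> module.dependent scale (b ` I) \<and> module.span scale (b ` I) = UNIV \<and>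
        (\<forall>i<k. (f ^^ Suc (d i)) (w i) = 0))"


subsection \<open>The orthogonal Lie algebra and its centralisers are Lie algebras\<close>

lemma vector_space_fun_scale:
  assumes "vector_space scale"
  shows "vector_space (fun_scale scale)"
proof -
  interpret vector_space scale by fact
  show ?thesis
    by unfold_locales
      (auto simp: fun_scale_def fun_eq_iff scale_right_distrib scale_left_distrib)
qed

context nondegenerate_symmetric_form
begin

interpretation F: vector_space "fun_scale scale"
  by (rule vector_space_fun_scale) unfold_locales

lemma linear_comm:
  assumes "Vector_Spaces.linear scale scale f" "Vector_Spaces.linear scale scale g"
  shows "Vector_Spaces.linear scale scale (commutator f g)"
proof -
  interpret f: Vector_Spaces.linear scale scale f by fact
  interpret g: Vector_Spaces.linear scale scale g by fact
  show ?thesis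
    by unfold_locales
      (auto simp: commutator_def f.add g.add f.scale g.scale scale_right_diff_distrib algebra_simps)
qed

lemma B_simps:
  "B (u + v) w = B u w + B v w" "B w (u + v) = B w u + B w v"
  "B (u - v) w = B u w - B v w" "B w (u - v) = B w u - B w v"
  "B (scale c u) w = c * B u w" "B w (scale c u) = c * B w u"
  "B 0 w = 0" "B w 0 = 0"
proof -
  interpret l: Vector_Spaces.linear scale "(*)" "\<lambda>u. B u w" by (rule linear_left)
  interpret r: Vector_Spaces.linear scale "(*)" "B w" by (rule linear_right)
  show "B (u + v) w = B u w + B v w" "B w (u + v) = B w u + B w v"
    "B (u - v) w = B u w - B v w" "B w (u - v) = B w u - B w v"
    "B (scale c u) w = c * B u w" "B w (scale c u) = c * B w u"
    "B 0 w = 0" "B w 0 = 0"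
    by (simp_all add: l.add l.diff l.scale r.add r.diff r.scale)
qed

lemma subspace_so: "F.subspace (so scale B)"
proof (rule F.subspaceI)
  show "0 \<in> so scale B"
    by (auto simp: so_def B_simps Vector_Spaces.linear_iff vector_space_axioms)
next
  fix f g assume f: "f \<in> so scale B" and g: "g \<in> so scale B"
  have "B (f u + g u) v + B u (f v + g v)
      = (B (f u) v + B u (f v)) + (B (g u) v + B u (g v))" for u v
    by (simp add: B_simps)
  with f g show "f + g \<in> so scale B"
    by (auto simp: so_def Vector_Spaces.linear_iff scale_right_distrib algebra_simps)
next
  fix f c assume f: "f \<in> so scale B"
  have "B (scale c (f u)) v + B u (scale c (f v)) = c * (B (f u) v + B u (f v))" for u v
    by (simp add: B_simps algebra_simps)
  with f show "fun_scale scale c f \<in> so scale B"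
    by (auto simp: so_def fun_scale_def Vector_Spaces.linear_iff scale_right_distrib mult.commute)
qed

lemma closed_so:
  assumes f: "f \<in> so scale B" and g: "g \<in> so scale B"
  shows "commutator f g \<in> so scale B"
proof -
  have 1: "B (f x) y = - B x (f y)" "B (g x) y = - B x (g y)" for x y
    using f g by (auto simp: so_def eq_neg_iff_add_eq_0)
  have "B (f (g u) - g (f u)) v + B u (f (g v) - g (f v)) = 0" for u v
    by (simp add: B_simps 1)
  with f g show ?thesis
    by (auto simp: so_def linear_comm) (simp add: commutator_def)
qed

lemma fin_dim_so: "\<exists>S. finite S \<and> so scale B \<subseteq> F.span S"
proof -
  define E where "E = (\<lambda>(b, c) v. scale (representation Basis v b) c)"
  have "f \<in> F.span (E ` (Basis \<times> Basis))" if f: "f \<in> so scale B" for f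
  proof -
    interpret f: Vector_Spaces.linear scale scale f using f by (simp add: so_def)
    have rep: "(\<Sum>b\<in>Basis. scale (representation Basis v b) b) = v" for v
      by (rule sum_representation_eq) (auto simp: independent_Basis span_Basis finite_Basis)
    have "f = (\<Sum>b\<in>Basis. \<Sum>c\<in>Basis. fun_scale scale (representation Basis (f b) c) (E (b, c)))"
    proof
      fix v
      have app: "(\<Sum>b\<in>A. g b) v = (\<Sum>b\<in>A. g b v)" for g :: "'v \<Rightarrow> 'v \<Rightarrow> 'v" and A
        by (induction A rule: infinite_finite_induct) auto
      have "f v = (\<Sum>b\<in>Basis. scale (representation Basis v b) (f b))"
        by (subst (1) rep[of v, symmetric]) (simp add: f.sum f.scale)
      also have "\<dots> = (\<Sum>b\<in>Basis. scale (representation Basis v b)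
          (\<Sum>c\<in>Basis. scale (representation Basis (f b) c) c))"
        by (simp add: rep)
      also have "\<dots> = (\<Sum>b\<in>Basis. \<Sum>c\<in>Basis.
          fun_scale scale (representation Basis (f b) c) (E (b, c))) v"
        by (simp add: app E_def fun_scale_def scale_sum_right mult.commute)
      finally show "f v = \<dots>" .
    qed
    moreover have "\<dots> \<in> F.span (E ` (Basis \<times> Basis))"
      by (intro F.span_sum F.span_scale F.span_base) auto
    ultimately show ?thesis by simp
  qed
  then show ?thesis
    by (intro exI[of _ "E ` (Basis \<times> Basis)"]) (auto simp: finite_Basis)
qed

lemma fin_dim_lie_algebra_subalgebra_so:
  assumes sub: "L \<subseteq> so scale B" and subsp: "F.subspace L"
    and cl: "\<And>f g. f \<in> L \<Longrightarrow> g \<in> L \<Longrightarrow> commutator f g \<in> L"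
  shows "fin_dim_lie_algebra (fun_scale scale) commutator L"
proof
  have lin: "Vector_Spaces.linear scale scale f" if "f \<in> L" for f
    using that sub by (auto simp: so_def)
  have L: "f (u + v) = f u + f v" "f (u - v) = f u - f v" "f (scale c v) = scale c (f v)"
    if "f \<in> L" for f u v c
  proof -
    interpret Vector_Spaces.linear scale scale f using that by (rule lin)
    show "f (u + v) = f u + f v" "f (u - v) = f u - f v" "f (scale c v) = scale c (f v)"
      by (simp_all add: add diff scale)
  qed
  show "F.subspace L" by (rule subsp)
  show "\<exists>S. finite S \<and> L \<subseteq> F.span S" using fin_dim_so sub by blast
  fix x y z c assume x: "x \<in> L" and y: "y \<in> L"
  show "commutator x y \<in> L" using x y by (rule cl)
  show "commutator (fun_scale scale c x) y = fun_scale scale c (commutator x y)"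
    using x y by (simp add: commutator_def fun_scale_def fun_eq_iff L scale_right_diff_distrib)
  show "commutator x (fun_scale scale c y) = fun_scale scale c (commutator x y)"
    using x y by (simp add: commutator_def fun_scale_def fun_eq_iff L scale_right_diff_distrib)
  show "commutator x x = 0" by (simp add: commutator_def fun_eq_iff)
  assume z: "z \<in> L"
  show "commutator (x + y) z = commutator x z + commutator y z"
    using x y z by (simp add: commutator_def fun_eq_iff L)
  show "commutator x (y + z) = commutator x y + commutator x z"
    using x y z by (simp add: commutator_def fun_eq_iff L)
  show "commutator x (commutator y z) + commutator y (commutator z x)
      + commutator z (commutator x y) = 0"
    using x y z by (simp add: commutator_def fun_eq_iff L)
qed

theorem fin_dim_lie_algebra_so: "fin_dim_lie_algebra (fun_scale scale) commutator (so scale B)"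
  by (intro fin_dim_lie_algebra_subalgebra_so subspace_so closed_so) auto

theorem fin_dim_lie_algebra_centraliser:
  assumes e: "e \<in> so scale B"
  shows "fin_dim_lie_algebra (fun_scale scale) commutator
           (lie_centraliser commutator (so scale B) e)"
proof -
  interpret S: fin_dim_lie_algebra "fun_scale scale" commutator "so scale B"
    by (rule fin_dim_lie_algebra_so)
  show ?thesis
  proof (rule fin_dim_lie_algebra_subalgebra_so)
    show "lie_centraliser commutator (so scale B) e \<subseteq> so scale B"
      by (auto simp: lie_centraliser_def)
    show "F.subspace (lie_centraliser commutator (so scale B) e)"
    proof (rule F.subspaceI)
      interpret l: Vector_Spaces.linear scale scale e using e by (simp add: so_def)
      show "0 \<in> lie_centraliser commutator (so scale B) e"
        using F.subspace_0[OF subspace_so]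
        by (auto simp: lie_centraliser_def commutator_def fun_eq_iff l.zero)
    qed (auto simp: lie_centraliser_def S.add_left S.scale_left e
           F.subspace_add[OF subspace_so] F.subspace_scale[OF subspace_so])
    fix f g
    assume f: "f \<in> lie_centraliser commutator (so scale B) e"
      and g: "g \<in> lie_centraliser commutator (so scale B) e"
    have fg: "f \<in> so scale B" "g \<in> so scale B" and "commutator f e = 0" "commutator g e = 0"
      using f g by (auto simp: lie_centraliser_def)
    then have *: "f (e v) = e (f v)" "g (e v) = e (g v)" for v
      by (auto simp: commutator_def fun_eq_iff)
    interpret l: Vector_Spaces.linear scale scale e using e by (simp add: so_def)
    have "commutator (commutator f g) e = 0"
      by (simp add: commutator_def fun_eq_iff l.diff *)
    with closed_so[OF fg] show "commutator f g \<in> lie_centraliser commutator (so scale B) e"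
      by (simp add: lie_centraliser_def)
  qed
qed

end

end

theory Submission
  imports Defs
begin

text \<open>The index. Choose generators \<open>w 0, w 1, \<dots>\<close> of the Jordan chains of \<open>e\<close>, of decreasing length,
  such that a chain of odd length is orthogonal to all others and the chains of even length come in
  adjacent dual pairs. For suitable scalars \<open>y j\<close> consider the functional
  \<open>\<xi> \<mapsto> \<Sum>j. y j * B (\<xi> (w (2 * j))) (w (2 * j + 1))\<close>, corrected by a term \<open>B (\<xi> (w v)) (e (w v))\<close>
  for every dual pair that is linked to itself. An element \<open>\<xi>\<close> of its stabiliser is described by the
  coefficients \<open>B (\<xi> (w u)) (e\<^sup>s (w v))\<close>, and in the resulting linear system a downward induction on \<open>s\<close>
  leaves only \<open>[n/2]\<close> free coefficients. Conversely no stabiliser is smaller than \<open>[n/2]\<close>: a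
  functional is the trace form against some \<open>a\<close>, and its stabiliser contains the lowest coefficients of
  all polynomials in \<open>t\<close> that commute with \<open>e + t a + t\<^sup>2 b\<close>, in particular those of the
  combinations of odd powers of the latter.

  The rank. The rotations in the planes of an orthogonal basis span a Cartan subalgebra of dimension
  \<open>[n/2]\<close>. Any Cartan subalgebra \<open>H\<close> consists of all skew elements of the algebra of endomorphisms on
  which \<open>H\<close> acts nilpotently. Take \<open>h \<in> H\<close> with the smallest generalised null space; \<open>H\<close> contains
  every skew map supported there. On the complement \<open>h\<close> is invertible and \<open>x \<mapsto> h x + x h\<close> injects
  symmetric elements into skew ones, which gives at least half of the dimension.\<close>

subsection \<open>Subspaces and linear systems\<close>

text \<open>The field may be small, so generic elements are replaced by explicit ones throughout.
  For the index, two matchings act on the generators: \<open>star\<close>, the duality under the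
  form, and \<open>mate\<close>, the pairs \<open>2 * j\<close>, \<open>2 * j + 1\<close> of the
  functional. A stabiliser equation either kills a coefficient or moves its index pair along both
  matchings, and long paths end in a known zero. Only between two short patterns of the same kind
  (dual pairs that are also mated, or mated pairs of self-dual chains) does the path return to its
  start; there the scalars \<open>y j\<close> have to make a linear, respectively quadratic,
  quantity distinct. Each new scalar avoids \<open>0\<close> and at most two values per predecessor,
  hence \<open>k\<close> field elements suffice. Inside a dual pair that is mated, the uncorrected
  equations hold identically by skewness; the corrective term makes them informative at the next
  exponent. In the lower bound \<open>b\<close> does not enter the two lowest coefficients of the
  commutation relation, so it can be chosen freely to keep the odd powers independent. For the rank,
  a generic combination of two elements of \<open>H\<close> is replaced by gluing them along a
  Fitting decomposition.\<close>

lemma homogeneous_system_nontrivial_solution: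
  fixes M :: "'f \<Rightarrow> 'i \<Rightarrow> 'k::field"
  assumes "finite F" "finite I" "card F < card I"
  shows "\<exists>c. (\<exists>i\<in>I. c i \<noteq> 0) \<and> (\<forall>f\<in>F. (\<Sum>i\<in>I. M f i * c i) = 0)"
  using assms
proof (induction F arbitrary: I M rule: finite_induct)
  case empty
  then have "I \<noteq> {}" by auto
  then show ?case by (intro exI[of _ "\<lambda>_. 1"]) auto
next
  case (insert f F)
  show ?case
  proof (cases "\<forall>i\<in>I. M f i = 0")
    case True
    have "card F < card I" using insert.prems insert.hyps by simp
    from insert.IH[OF insert.prems(1) this, of M] obtain c where
      "\<exists>i\<in>I. c i \<noteq> 0" "\<forall>g\<in>F. (\<Sum>i\<in>I. M g i * c i) = 0" by blast
    with True show ?thesis by (intro exI[of _ c]) auto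
  next
    case False
    then obtain j where j: "j \<in> I" "M f j \<noteq> 0" by blast
    define I' where "I' = I - {j}"
    have fin: "finite I'" and I: "I = insert j I'" "j \<notin> I'"
      using insert.prems(1) j by (auto simp: I'_def)
    have "card F < card I'" using insert.prems insert.hyps I fin by simp
    \<comment> \<open>Equation \<open>f\<close> is the pivot and is solved for the unknown
      \<open>j\<close>; the matrix passed to the induction hypothesis is the one obtained after
      substituting that value.\<close>
    from insert.IH[OF fin this, of "\<lambda>g i. M g i - M g j * M f i / M f j"] obtain c where
      c: "\<exists>i\<in>I'. c i \<noteq> 0"
        "\<forall>g\<in>F. (\<Sum>i\<in>I'. (M g i - M g j * M f i / M f j) * c i) = 0" by blast
    define c' where "c' = c(j := - (\<Sum>i\<in>I'. M f i * c i) / M f j)"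
    have c': "(\<Sum>i\<in>I. M g i * c' i)
        = (\<Sum>i\<in>I'. M g i * c i) - M g j / M f j * (\<Sum>i\<in>I'. M f i * c i)" for g
    proof -
      have "(\<Sum>i\<in>I'. M g i * c' i) = (\<Sum>i\<in>I'. M g i * c i)"
        by (rule sum.cong) (use I in \<open>auto simp: c'_def\<close>)
      then show ?thesis using I fin by (simp add: c'_def)
    qed
    have "(\<Sum>i\<in>I. M g i * c' i) = 0" if "g \<in> F" for g
      using c(2)[rule_format, OF that] unfolding c'
      by (simp add: left_diff_distrib sum_subtractf sum_distrib_left mult.assoc)
    moreover have "(\<Sum>i\<in>I. M f i * c' i) = 0" unfolding c' using j by simp
    moreover have "\<exists>i\<in>I. c' i \<noteq> 0" using c(1) I by (auto simp: c'_def)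
    ultimately show ?thesis by (intro exI[of _ c']) auto
  qed
qed

locale subspace_dimension = vector_space scale
  for scale :: "'k::field \<Rightarrow> 'a::ab_group_add \<Rightarrow> 'a"
begin

text \<open>Endomorphisms live in the space of all functions on \<open>V\<close>, which need not be
  finite-dimensional; finiteness is therefore attached to the subspace.\<close>

definition fin_dim_subspace :: "'a set \<Rightarrow> bool" where
  "fin_dim_subspace R \<longleftrightarrow> subspace R \<and> (\<exists>S. finite S \<and> R \<subseteq> span S)"

lemma fin_dim_subspace_mono:
  "fin_dim_subspace R \<Longrightarrow> subspace K \<Longrightarrow> K \<subseteq> R \<Longrightarrow> fin_dim_subspace K"
  unfolding fin_dim_subspace_def by blast

lemma fin_dim_subspace_basis:
  assumes "fin_dim_subspace R"
  obtains b where "finite b" "b \<subseteq> R" "independent b" "span b = R" "card b = dim R"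
proof -
  obtain S where S: "finite S" "R \<subseteq> span S" and R: "subspace R"
    using assms by (auto simp: fin_dim_subspace_def)
  obtain b where b: "b \<subseteq> R" "independent b" "R \<subseteq> span b" "card b = dim R"
    using basis_exists by blast
  moreover have "finite b" using independent_span_bound[OF S(1) b(2)] b(1) S(2) by auto
  moreover have "span b = R" using b R by (simp add: span_subspace)
  ultimately show ?thesis using that by blast
qed

lemma sum_scale_eq_zero_independent:
  assumes "independent b" "finite b" "(\<Sum>v\<in>b. scale (c v) v) = 0" "v \<in> b"
  shows "c v = 0"
  using independentD[OF assms(1,2) subset_refl assms(3,4)] .

lemma dim_plus_card_le:
  assumes R: "fin_dim_subspace R" and K: "subspace K" "K \<subseteq> R"
    and J: "finite J" "\<And>j. j \<in> J \<Longrightarrow> x j \<in> R"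
    and ind: "\<And>c j. (\<Sum>j\<in>J. scale (c j) (x j)) \<in> K \<Longrightarrow> j \<in> J \<Longrightarrow> c j = 0"
  shows "dim K + card J \<le> dim R"
proof -
  obtain b where b: "finite b" "b \<subseteq> K" "independent b" "span b = K" "card b = dim K"
    using fin_dim_subspace_basis[OF fin_dim_subspace_mono[OF R K]] by blast
  have inj: "inj_on x J"
  proof (rule inj_onI, rule ccontr)
    fix i j assume ij: "i \<in> J" "j \<in> J" "x i = x j" "i \<noteq> j"
    define c where "c l = (if l = i then 1 else if l = j then - 1 else 0 :: 'k)" for l
    have "(\<Sum>l\<in>J. scale (c l) (x l)) = (\<Sum>l\<in>{i,j}. scale (c l) (x l))"
      by (rule sum.mono_neutral_right) (use J ij in \<open>auto simp: c_def\<close>)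
    also have "\<dots> = 0" using ij by (simp add: c_def)
    finally have "(\<Sum>l\<in>J. scale (c l) (x l)) \<in> K" using subspace_0[OF K(1)] by simp
    from ind[OF this ij(1)] show False by (simp add: c_def)
  qed
  have disj: "x j \<notin> K" if "j \<in> J" for j
  proof
    assume xj: "x j \<in> K"
    have "(\<Sum>l\<in>J. scale (if l = j then 1 else 0) (x l)) = (\<Sum>l\<in>{j}. scale 1 (x l))"
      by (rule sum.mono_neutral_cong_right) (use J that in auto)
    then have "(\<Sum>l\<in>J. scale (if l = j then 1 else 0) (x l)) \<in> K" using xj by simp
    from ind[OF this that] show False by simp
  qed
  have indep: "independent (b \<union> x ` J)"
  proof (rule independent_if_scalars_zero)
    show "finite (b \<union> x ` J)" using b J by simp
    fix f v assume s: "(\<Sum>v\<in>b \<union> x ` J. scale (f v) v) = 0" and v: "v \<in> b \<union> x ` J"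
    have int: "b \<inter> x ` J = {}" using disj b(2) by auto
    have split: "(\<Sum>v\<in>b. scale (f v) v) + (\<Sum>j\<in>J. scale (f (x j)) (x j)) = 0"
      using s b(1) J(1) int by (simp add: sum.union_disjoint sum.reindex[OF inj])
    have "(\<Sum>v\<in>b. scale (f v) v) \<in> K"
      using b(2) by (intro subspace_sum[OF K(1)] subspace_scale[OF K(1)]) auto
    then have "- (\<Sum>v\<in>b. scale (f v) v) \<in> K" by (rule subspace_neg[OF K(1)])
    then have "(\<Sum>j\<in>J. scale (f (x j)) (x j)) \<in> K"
      using split by (metis add_eq_0_iff)
    from ind[OF this] have fx: "\<And>j. j \<in> J \<Longrightarrow> f (x j) = 0" .
    then have "(\<Sum>v\<in>b. scale (f v) v) = 0" using split by simp
    from sum_scale_eq_zero_independent[OF b(3,1) this] fx v show "f v = 0" by auto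
  qed
  obtain S where S: "finite S" "card S = dim R" "R \<subseteq> span S"
    using fin_dim_subspace_basis[OF R] by (metis subset_refl)
  have "b \<union> x ` J \<subseteq> R" using b(2) K(2) J(2) by auto
  then have "card (b \<union> x ` J) \<le> card S" using independent_span_bound[OF S(1) indep] S(3) by auto
  moreover have "card (b \<union> x ` J) = card b + card J"
    using b(1,2) J(1) disj by (subst card_Un_disjoint) (auto simp: card_image[OF inj])
  ultimately show ?thesis using b(5) S(2) by simp
qed

lemma card_le_dim_independent_family:
  assumes R: "fin_dim_subspace R"
    and J: "finite J" "\<And>j. j \<in> J \<Longrightarrow> x j \<in> R"
    and ind: "\<And>c j. (\<Sum>j\<in>J. scale (c j) (x j)) = 0 \<Longrightarrow> j \<in> J \<Longrightarrow> c j = 0"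
  shows "card J \<le> dim R"
proof -
  have "dim {0} + card J \<le> dim R"
    by (rule dim_plus_card_le[OF R _ _ J]) (use R ind in \<open>auto simp: fin_dim_subspace_def subspace_0\<close>)
  then show ?thesis by simp
qed

text \<open>An independent set with more than \<open>card \<Phi>\<close> elements would carry a
  nontrivial combination annihilated by all the functionals. Finite dimension of \<open>R\<close>
  comes out of the same count.\<close>

lemma dim_le_separating_functionals:
  assumes R: "subspace R" and "finite \<Phi>"
    and add: "\<And>f x y. f \<in> \<Phi> \<Longrightarrow> x \<in> R \<Longrightarrow> y \<in> R \<Longrightarrow> \<phi> f (x + y) = \<phi> f x + \<phi> f y"
    and sc: "\<And>f c x. f \<in> \<Phi> \<Longrightarrow> x \<in> R \<Longrightarrow> \<phi> f (scale c x) = c * \<phi> f x"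
    and sep: "\<And>x. x \<in> R \<Longrightarrow> (\<And>f. f \<in> \<Phi> \<Longrightarrow> \<phi> f x = 0) \<Longrightarrow> x = 0"
  shows "dim R \<le> card \<Phi>" and "fin_dim_subspace R"
proof -
  have zero: "\<phi> f 0 = 0" if "f \<in> \<Phi>" for f using sc[OF that subspace_0[OF R], of 0] by simp
  have bound: "card b \<le> card \<Phi>" if b: "independent b" "finite b" "b \<subseteq> R" for b
  proof (rule ccontr)
    assume "\<not> ?thesis"
    then have "card \<Phi> < card b" by simp
    from homogeneous_system_nontrivial_solution[OF \<open>finite \<Phi>\<close> b(2) this, of \<phi>] obtain c where
      c: "\<exists>v\<in>b. c v \<noteq> 0" "\<forall>f\<in>\<Phi>. (\<Sum>v\<in>b. \<phi> f v * c v) = 0" by blast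
    have sumR: "(\<Sum>v\<in>b'. scale (c v) v) \<in> R" if "b' \<subseteq> b" for b'
      using that b(3) by (intro subspace_sum[OF R] subspace_scale[OF R]) auto
    have "\<phi> f (\<Sum>v\<in>b. scale (c v) v) = 0" if f: "f \<in> \<Phi>" for f
    proof -
      have "\<phi> f (\<Sum>v\<in>b'. scale (c v) v) = (\<Sum>v\<in>b'. \<phi> f v * c v)" if "b' \<subseteq> b" for b'
        using finite_subset[OF that b(2)] that
      proof (induction b' rule: finite_induct)
        case empty then show ?case using zero[OF f] by simp
      next
        case (insert v b')
        then have "v \<in> R" "scale (c v) v \<in> R" using b(3) subspace_scale[OF R] by auto
        then show ?case using insert sumR[of b'] f by (simp add: add sc mult.commute)
      qed
      then show ?thesis using c(2) f by simp
    qed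
    then have "(\<Sum>v\<in>b. scale (c v) v) = 0" using sep sumR by blast
    with c(1) sum_scale_eq_zero_independent[OF b(1,2)] show False by blast
  qed
  obtain b where b: "b \<subseteq> R" "independent b" "R \<subseteq> span b" "card b = dim R"
    using basis_exists by blast
  have "finite b"
  proof (rule ccontr)
    assume "infinite b"
    then obtain b' where b': "b' \<subseteq> b" "finite b'" "card b' = Suc (card \<Phi>)"
      using infinite_arbitrarily_large by blast
    have "card b' \<le> card \<Phi>"
      using bound[OF independent_mono[OF b(2) b'(1)] b'(2)] b'(1) b(1) by blast
    with b'(3) show False by simp
  qed
  show "dim R \<le> card \<Phi>"
    using bound[OF b(2) \<open>finite b\<close> b(1)] b(4) by simp
  show "fin_dim_subspace R"
    unfolding fin_dim_subspace_def using R \<open>finite b\<close> b(3) by blast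
qed

text \<open>Coordinates in a basis of \<open>R\<close>, extended to a basis of the whole space.
  Linearity everywhere matters in the lower bound for stabilisers, where the functionals are also
  applied to maps outside \<open>R\<close>.\<close>

lemma fin_dim_subspace_functionals:
  assumes R: "fin_dim_subspace R"
  obtains \<phi> :: "nat \<Rightarrow> 'a \<Rightarrow> 'k" where
    "\<And>i. Vector_Spaces.linear scale (*) (\<phi> i)"
    "\<And>x. x \<in> R \<Longrightarrow> (\<And>i. i < dim R \<Longrightarrow> \<phi> i x = 0) \<Longrightarrow> x = 0"
proof -
  obtain b where b: "finite b" "b \<subseteq> R" "independent b" "span b = R" "card b = dim R"
    using fin_dim_subspace_basis[OF R] by blast
  from b(1) obtain h where h: "bij_betw h {..<dim R} b"
    using b(5) ex_bij_betw_nat_finite[OF b(1)] by (metis atLeast0LessThan)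
  define C where "C = extend_basis b"
  have C: "b \<subseteq> C" "independent C" "span C = UNIV"
    using extend_basis_superset[OF b(3)] independent_extend_basis[OF b(3)] span_extend_basis[OF b(3)]
    by (auto simp: C_def)
  define \<phi> where "\<phi> i x = representation C x (h i)" for i x
  show ?thesis
  proof
    show "Vector_Spaces.linear scale (*) (\<phi> i)" for i
      unfolding \<phi>_def
    proof (intro Vector_Spaces.linear_iff[THEN iffD2] conjI allI)
      show "vector_space scale" by unfold_locales
      show "vector_space ((*) :: 'k \<Rightarrow> _)" by unfold_locales (auto simp: algebra_simps)
    qed (use C in \<open>auto simp: representation_add representation_scale\<close>)
    fix x assume x: "x \<in> R" and z: "\<And>i. i < dim R \<Longrightarrow> \<phi> i x = 0"
    have "representation C x = representation b x"
      by (rule representation_extend[OF C(2) _ C(1)]) (use x b in simp)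
    moreover have "representation C x v = 0" if "v \<in> b" for v
      using z h that unfolding \<phi>_def bij_betw_def by auto
    ultimately have "(\<Sum>v\<in>b. scale (representation b x v) v) = 0" by simp
    then show "x = 0" using sum_representation_eq[OF b(3), of x b] x b by simp
  qed
qed

end

subsection \<open>Endomorphisms of a quadratic space\<close>

locale orthogonal_space = nondegenerate_symmetric_form scale Basis B
  for scale :: "'k::field \<Rightarrow> 'v::ab_group_add \<Rightarrow> 'v" and Basis :: "'v set"
    and B :: "'v \<Rightarrow> 'v \<Rightarrow> 'k" +
  assumes two_neq_zero: "(2::'k) \<noteq> 0"
begin

sublocale subspace_dimension scale by unfold_locales

sublocale F: subspace_dimension "fun_scale scale"
  by (rule subspace_dimension.intro, rule vector_space_fun_scale) unfold_locales

abbreviation lin :: "('v \<Rightarrow> 'v) \<Rightarrow> bool" where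
  "lin f \<equiv> Vector_Spaces.linear scale scale f"

lemma lin_iff: "lin f \<longleftrightarrow> (\<forall>x y. f (x + y) = f x + f y) \<and> (\<forall>c x. f (scale c x) = scale c (f x))"
  by (simp add: Vector_Spaces.linear_iff vector_space_axioms)

lemma linD:
  assumes "lin f"
  shows "f (x + y) = f x + f y" "f (x - y) = f x - f y" "f (scale c x) = scale c (f x)"
    "f 0 = 0" "f (- x) = - f x" "f (\<Sum>i\<in>I. g i) = (\<Sum>i\<in>I. f (g i))"
proof -
  interpret Vector_Spaces.linear scale scale f by fact
  show "f (x + y) = f x + f y" "f (x - y) = f x - f y" "f (scale c x) = scale c (f x)"
    "f 0 = 0" "f (- x) = - f x" "f (\<Sum>i\<in>I. g i) = (\<Sum>i\<in>I. f (g i))"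
    by (simp_all add: add diff scale zero neg sum)
qed

lemma lin_compose: "lin f \<Longrightarrow> lin g \<Longrightarrow> lin (\<lambda>v. f (g v))"
  by (simp add: lin_iff)

lemma lin_funpow: "lin f \<Longrightarrow> lin (f ^^ m)"
  by (induction m) (auto simp: lin_iff)

lemma lin_sum: "(\<And>i. i \<in> I \<Longrightarrow> lin (f i)) \<Longrightarrow> lin (\<lambda>v. \<Sum>i\<in>I. f i v)"
  by (simp add: lin_iff sum.distrib scale_sum_right)

lemma lin_scale_fun: "lin f \<Longrightarrow> lin (\<lambda>v. scale c (f v))"
  by (simp add: lin_iff scale_right_distrib mult.commute)

lemma lin_add_fun: "lin f \<Longrightarrow> lin g \<Longrightarrow> lin (\<lambda>v. f v + g v)"
  by (simp add: lin_iff scale_right_distrib algebra_simps)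

lemma lin_diff_fun: "lin f \<Longrightarrow> lin g \<Longrightarrow> lin (\<lambda>v. f v - g v)"
  by (simp add: lin_iff scale_right_diff_distrib algebra_simps)

lemma lin_B_scale: "lin (\<lambda>v. scale (B v u) x)"
  by (simp add: lin_iff B_simps scale_left_distrib)

lemma B_sum: "B (\<Sum>i\<in>I. f i) v = (\<Sum>i\<in>I. B (f i) v)" "B v (\<Sum>i\<in>I. f i) = (\<Sum>i\<in>I. B v (f i))"
  by (induction I rule: infinite_finite_induct) (simp_all add: B_simps)

lemma B_uminus: "B (- u) v = - B u v" "B v (- u) = - B v u"
  using B_simps(3)[of 0 u v] B_simps(4)[of v 0 u] by (simp_all add: B_simps)

lemma sum_fun_apply: "(\<Sum>i\<in>I. f i) v = (\<Sum>i\<in>I. f i v)"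
  for f :: "'i \<Rightarrow> 'v \<Rightarrow> 'v"
  by (induction I rule: infinite_finite_induct) simp_all

lemma so_iff: "f \<in> so scale B \<longleftrightarrow> lin f \<and> (\<forall>u v. B (f u) v = - B u (f v))"
  by (auto simp: so_def eq_neg_iff_add_eq_0)

lemma so_lin: "f \<in> so scale B \<Longrightarrow> lin f"
  by (simp add: so_iff)

lemma so_skew: "f \<in> so scale B \<Longrightarrow> B (f u) v = - B u (f v)"
  by (simp add: so_iff)

lemma so_skew_funpow:
  assumes "f \<in> so scale B"
  shows "B ((f ^^ m) u) v = (- 1) ^ m * B u ((f ^^ m) v)"
proof (induction m arbitrary: v)
  case (Suc m)
  have "B ((f ^^ Suc m) u) v = - B ((f ^^ m) u) (f v)" using so_skew[OF assms] by simp
  then show ?case by (simp add: Suc funpow_swap1)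
qed simp

lemma eq_uminus_self_iff: "(x::'k) = - x \<longleftrightarrow> x = 0"
proof
  assume "x = - x"
  then have "2 * x = 0" unfolding mult_2 by (metis add.right_inverse)
  then show "x = 0" using two_neq_zero by simp
qed simp

lemma fin_dim_lin: "F.fin_dim_subspace {f. lin f}"
proof (rule F.dim_le_separating_functionals(2)[where \<Phi> = "Basis \<times> Basis"
      and \<phi> = "\<lambda>(b, c) f. representation Basis (f b) c"])
  show "F.subspace {f. lin f}"
    by (rule F.subspaceI) (auto simp: fun_scale_def lin_iff scale_right_distrib algebra_simps)
  fix x assume x: "x \<in> {f. lin f}"
    and z: "\<And>f. f \<in> Basis \<times> Basis \<Longrightarrow> (case f of (b, c) \<Rightarrow> \<lambda>f. representation Basis (f b) c) x = 0"
  have "x b = 0" if b: "b \<in> Basis" for b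
  proof -
    have "(\<Sum>c\<in>Basis. scale (representation Basis (x b) c) c) = x b"
      by (rule sum_representation_eq) (auto simp: independent_Basis span_Basis finite_Basis)
    moreover have "representation Basis (x b) c = 0" if "c \<in> Basis" for c
      using z[of "(b, c)"] b that by simp
    ultimately show ?thesis by simp
  qed
  then have "x (\<Sum>b\<in>Basis. scale (representation Basis v b) b) = 0" for v
    using x by (simp add: linD)
  moreover have "(\<Sum>b\<in>Basis. scale (representation Basis v b) b) = v" for v
    by (rule sum_representation_eq) (auto simp: independent_Basis span_Basis finite_Basis)
  ultimately show "x = 0" by (simp add: fun_eq_iff)
qed (use finite_Basis in \<open>auto simp: fun_scale_def representation_add representation_scale
      independent_Basis span_Basis\<close>)

lemma fin_dim_UNIV: "fin_dim_subspace UNIV"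
  by (auto simp: fin_dim_subspace_def span_Basis intro!: exI[of _ Basis] finite_Basis)

lemma fin_dim_fun_subspace:
  assumes "F.subspace R" "\<And>f. f \<in> R \<Longrightarrow> lin f"
  shows "F.fin_dim_subspace R"
  by (rule F.fin_dim_subspace_mono[OF fin_dim_lin]) (use assms in auto)

end

subsection \<open>Jordan bases adapted to the form\<close>

context orthogonal_space
begin

text \<open>Chain \<open>i\<close> belongs to a Jordan block of size \<open>d i + 1\<close>, and
  \<open>star i\<close> is its dual chain: the last clause lets a generator pair with exactly one
  power of one chain. Self-dual chains are those with \<open>d i\<close> even, because
  \<open>e ^^ s\<close> is symmetric or skew according to the parity of \<open>s\<close>. The two
  inequalities between \<open>i\<close> and \<open>star i\<close> make dual chains
  neighbours.\<close>

definition adapted_family ::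
    "('v \<Rightarrow> 'v) \<Rightarrow> nat \<Rightarrow> (nat \<Rightarrow> 'v) \<Rightarrow> (nat \<Rightarrow> nat) \<Rightarrow> (nat \<Rightarrow> nat) \<Rightarrow> bool" where
  "adapted_family e k w d star \<longleftrightarrow>
     (\<forall>i<k. star i < k \<and> star (star i) = i \<and> star i \<le> Suc i \<and> i \<le> Suc (star i) \<and>
        d (star i) = d i \<and> (star i = i \<longleftrightarrow> even (d i)) \<and> (e ^^ Suc (d i)) (w i) = 0) \<and>
     (\<forall>i j. i \<le> j \<longrightarrow> j < k \<longrightarrow> d j \<le> d i) \<and>
     (\<forall>i<k. \<forall>j<k. \<forall>s. B ((e ^^ s) (w i)) (w j) \<noteq> 0 \<longleftrightarrow> j = star i \<and> s = d i)"

definition family_perp :: "('v \<Rightarrow> 'v) \<Rightarrow> nat \<Rightarrow> (nat \<Rightarrow> 'v) \<Rightarrow> 'v set" where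
  "family_perp e k w = {v. \<forall>i<k. \<forall>s. B v ((e ^^ s) (w i)) = 0}"

lemma family_perp_mono:
  assumes "k \<le> k'" "\<And>i. i < k \<Longrightarrow> w' i = w i"
  shows "family_perp e k' w' \<subseteq> family_perp e k w"
proof
  fix v assume "v \<in> family_perp e k' w'"
  then have "B v ((e ^^ s) (w' i)) = 0" if "i < k'" for i s using that by (simp add: family_perp_def)
  then have "B v ((e ^^ s) (w i)) = 0" if "i < k" for i s
    using that assms by (metis order_less_le_trans)
  then show "v \<in> family_perp e k w" by (simp add: family_perp_def)
qed

lemma adapted_familyD:
  assumes "adapted_family e k w d star" "i < k"
  shows "star i < k" "star (star i) = i" "star i \<le> Suc i" "i \<le> Suc (star i)" "d (star i) = d i"
    "star i = i \<longleftrightarrow> even (d i)" "(e ^^ Suc (d i)) (w i) = 0"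
  using assms unfolding adapted_family_def by blast+

lemma adapted_family_antimono:
  "adapted_family e k w d star \<Longrightarrow> i \<le> j \<Longrightarrow> j < k \<Longrightarrow> d j \<le> d i"
  unfolding adapted_family_def by blast

lemma adapted_family_gram0:
  "adapted_family e k w d star \<Longrightarrow> i < k \<Longrightarrow> j < k \<Longrightarrow>
    B ((e ^^ s) (w i)) (w j) \<noteq> 0 \<longleftrightarrow> j = star i \<and> s = d i"
  unfolding adapted_family_def by blast

lemma funpow_funpow: "(f ^^ m) ((f ^^ n) x) = (f ^^ (m + n)) x"
  by (simp add: funpow_add)

lemma funpow_zero_above:
  assumes "lin e" "(e ^^ m) v = 0" "m \<le> n"
  shows "(e ^^ n) v = 0"
proof -
  have "(e ^^ n) v = (e ^^ (n - m)) ((e ^^ m) v)"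
    using assms(3) funpow_add[of "n - m" m e] by simp
  then show ?thesis using assms(2) linD(4)[OF lin_funpow[OF assms(1)]] by simp
qed

lemma B_funpow_funpow:
  assumes "e \<in> so scale B"
  shows "B ((e ^^ s) u) ((e ^^ t) v) = (- 1) ^ t * B ((e ^^ (s + t)) u) v"
proof -
  have "B ((e ^^ (s + t)) u) v = B ((e ^^ t) ((e ^^ s) u)) v"
    by (simp add: funpow_add add.commute[of s t])
  also have "\<dots> = (- 1) ^ t * B ((e ^^ s) u) ((e ^^ t) v)" by (rule so_skew_funpow[OF assms])
  finally show ?thesis by (simp flip: power_add mult_2 mult.assoc)
qed

lemma adapted_family_gram:
  assumes e: "e \<in> so scale B" and a: "adapted_family e k w d star" and ij: "i < k" "j < k"
  shows "B ((e ^^ s) (w i)) ((e ^^ t) (w j)) \<noteq> 0 \<longleftrightarrow> j = star i \<and> s + t = d i"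
  using adapted_family_gram0[OF a ij] by (simp add: B_funpow_funpow[OF e])

lemma adapted_family_zero:
  assumes e: "e \<in> so scale B" and a: "adapted_family e k w d star" and "i < k" "d i < s"
  shows "(e ^^ s) (w i) = 0"
  by (rule funpow_zero_above[OF so_lin[OF e] adapted_familyD(7)[OF a]]) (use assms in auto)

lemma subspace_family_perp: "subspace (family_perp e k w)"
  by (rule subspaceI) (auto simp: family_perp_def B_simps)

lemma family_perp_funpow:
  assumes e: "e \<in> so scale B" and v: "v \<in> family_perp e k w"
  shows "(e ^^ m) v \<in> family_perp e k w"
proof -
  have "B ((e ^^ m) v) ((e ^^ s) (w i)) = 0" if "i < k" for i s
    using v that by (simp add: so_skew_funpow[OF e] funpow_funpow family_perp_def)
  then show ?thesis by (simp add: family_perp_def)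
qed

text \<open>The vectors \<open>(e ^^ s) (w i)\<close> and
  \<open>(e ^^ (d i - s)) (w (star i))\<close> are dual to each other up to nonzero scalars, so the
  orthogonal projection onto the span of the chains has the explicit coefficients
  \<open>c i s\<close>.\<close>

lemma family_projection:
  assumes e: "e \<in> so scale B" and a: "adapted_family e k w d star"
  obtains p where "v - p \<in> family_perp e k w" "\<And>y. y \<in> family_perp e k w \<Longrightarrow> B y p = 0"
proof
  define c where "c i s = B v ((e ^^ (d i - s)) (w (star i)))
      / B ((e ^^ s) (w i)) ((e ^^ (d i - s)) (w (star i)))" for i s
  define p where "p = (\<Sum>i<k. \<Sum>s\<le>d i. scale (c i s) ((e ^^ s) (w i)))"
  show "B y p = 0" if "y \<in> family_perp e k w" for y
    using that by (simp add: p_def B_sum B_simps family_perp_def)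
  have "B p ((e ^^ t) (w j)) = B v ((e ^^ t) (w j))" if j: "j < k" for j t
  proof (cases "t \<le> d j")
    case False
    then show ?thesis using adapted_family_zero[OF e a j, of t] by (simp add: B_simps)
  next
    case True
    note D = adapted_familyD[OF a j]
    have "B p ((e ^^ t) (w j))
        = (\<Sum>i<k. \<Sum>s\<le>d i. c i s * B ((e ^^ s) (w i)) ((e ^^ t) (w j)))"
      by (simp add: p_def B_sum B_simps)
    also have "\<dots> = (\<Sum>i<k. if i = star j then
        c (star j) (d j - t) * B ((e ^^ (d j - t)) (w (star j))) ((e ^^ t) (w j)) else 0)"
    proof (rule sum.cong[OF refl])
      fix i assume i: "i \<in> {..<k}"
      have z: "B ((e ^^ s) (w i)) ((e ^^ t) (w j)) = 0" if "i \<noteq> star j \<or> s + t \<noteq> d i" for s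
        using adapted_family_gram[OF e a, of i j s t] i j that adapted_familyD(2)[OF a, of i] by auto
      show "(\<Sum>s\<le>d i. c i s * B ((e ^^ s) (w i)) ((e ^^ t) (w j))) =
        (if i = star j then
          c (star j) (d j - t) * B ((e ^^ (d j - t)) (w (star j))) ((e ^^ t) (w j)) else 0)"
      proof (cases "i = star j")
        case True
        have "(\<Sum>s\<le>d i. c i s * B ((e ^^ s) (w i)) ((e ^^ t) (w j)))
            = (\<Sum>s\<in>{d j - t}. c i s * B ((e ^^ s) (w i)) ((e ^^ t) (w j)))"
          by (rule sum.mono_neutral_right) (use True D \<open>t \<le> d j\<close> z in auto)
        then show ?thesis using True by simp
      qed (use z in simp)
    qed
    also have "\<dots> = c (star j) (d j - t) * B ((e ^^ (d j - t)) (w (star j))) ((e ^^ t) (w j))"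
      using D by simp
    also have "\<dots> = B v ((e ^^ t) (w j))"
    proof -
      have "B ((e ^^ (d j - t)) (w (star j))) ((e ^^ t) (w j)) \<noteq> 0"
        using adapted_family_gram[OF e a D(1) j] D True by simp
      then show ?thesis using D True by (simp add: c_def)
    qed
    finally show ?thesis .
  qed
  then show "v - p \<in> family_perp e k w" by (simp add: family_perp_def B_simps)
qed

lemma family_perp_nondegenerate:
  assumes e: "e \<in> so scale B" and a: "adapted_family e k w d star"
    and y: "y \<in> family_perp e k w" "y \<noteq> 0"
  obtains v where "v \<in> family_perp e k w" "B y v \<noteq> 0"
proof -
  obtain v where v: "B y v \<noteq> 0" using nondegenerate y(2) by blast
  obtain p where "v - p \<in> family_perp e k w" "B y p = 0"
    using family_projection[OF e a] y(1) by metis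
  with v that[of "v - p"] show thesis by (simp add: B_simps)
qed

text \<open>Pairing a linear relation with a dual vector isolates one coefficient, so all chain
  vectors are independent. The bound serves twice: it stops the extension of families, and it turns
  the count of free coefficients into half of \<open>dim UNIV\<close>.\<close>

lemma adapted_family_dim:
  assumes e: "e \<in> so scale B" and a: "adapted_family e k w d star"
  shows "(\<Sum>i<k. Suc (d i)) \<le> dim UNIV"
proof -
  let ?J = "SIGMA i:{..<k}. {..d i}"
  have "card ?J \<le> dim UNIV"
  proof (rule card_le_dim_independent_family[OF fin_dim_UNIV, where x = "\<lambda>(i, s). (e ^^ s) (w i)"])
    fix c and j :: "nat \<times> nat"
    assume s: "(\<Sum>j\<in>?J. scale (c j) (case j of (i, s) \<Rightarrow> (e ^^ s) (w i))) = 0" and "j \<in> ?J"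
    then obtain i s where j: "j = (i, s)" "i < k" "s \<le> d i" by auto
    note D = adapted_familyD[OF a j(2)]
    let ?u = "(e ^^ (d i - s)) (w (star i))"
    have "(\<Sum>l\<in>?J. c l * B (case l of (i, s) \<Rightarrow> (e ^^ s) (w i)) ?u) = B 0 ?u"
      unfolding s[symmetric] by (simp add: B_sum B_simps)
    moreover have "(\<Sum>l\<in>?J. c l * B (case l of (i, s) \<Rightarrow> (e ^^ s) (w i)) ?u)
        = (\<Sum>l\<in>{j}. c l * B (case l of (i, s) \<Rightarrow> (e ^^ s) (w i)) ?u)"
    proof (rule sum.mono_neutral_right)
      show "\<forall>l\<in>?J - {j}. c l * B (case l of (i, s) \<Rightarrow> (e ^^ s) (w i)) ?u = 0"
      proof
        fix l assume l: "l \<in> ?J - {j}"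
        obtain i' t where it: "l = (i', t)" by (cases l)
        with l have i': "i' < k" "t \<le> d i'" "i' \<noteq> i \<or> t \<noteq> s" using j by auto
        have "B ((e ^^ t) (w i')) ?u = 0"
        proof (rule ccontr)
          assume "\<not> ?thesis"
          then have g: "star i = star i'" "t + (d i - s) = d i'"
            using adapted_family_gram[OF e a i'(1) D(1), of t "d i - s"] by metis+
          have "i = i'" using D(2) adapted_familyD(2)[OF a i'(1)] g(1) by metis
          with g(2) i'(3) j(3) show False by simp
        qed
        then show "c l * B (case l of (i, s) \<Rightarrow> (e ^^ s) (w i)) ?u = 0" using it by simp
      qed
    qed (use j in auto)
    moreover have "B ((e ^^ s) (w i)) ?u \<noteq> 0"
      using adapted_family_gram[OF e a j(2) D(1)] j by simp
    ultimately show "c j = 0" using j by (simp add: B_simps)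
  qed auto
  then show ?thesis by simp
qed

text \<open>The unwanted values \<open>B ((e ^^ s) w) w\<close> are removed from
  \<open>s = m - 1\<close> downwards. For odd \<open>s\<close> they vanish, as \<open>e ^^ s\<close>
  is then skew; for even \<open>s\<close> a multiple of \<open>(e ^^ (m - s)) w\<close> is added to
  \<open>w\<close>, which is felt only at exponents up to \<open>s\<close>.\<close>

lemma normalise_fixed_chain:
  assumes e: "e \<in> so scale B" and U: "subspace U" "\<And>v m. v \<in> U \<Longrightarrow> (e ^^ m) v \<in> U"
    and top: "\<And>v s. v \<in> U \<Longrightarrow> m < s \<Longrightarrow> (e ^^ s) v = 0" and m: "even m"
    and w: "w \<in> U" "B ((e ^^ m) w) w \<noteq> 0"
  shows "\<exists>w\<in>U. B ((e ^^ m) w) w \<noteq> 0 \<and> (\<forall>s. s \<noteq> m \<longrightarrow> B ((e ^^ s) w) w = 0)"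
proof -
  note le = linD[OF lin_funpow[OF so_lin[OF e]]]
  have "\<exists>w\<in>U. B ((e ^^ m) w) w \<noteq> 0 \<and> (\<forall>s. m \<le> s + t \<longrightarrow> s \<noteq> m \<longrightarrow> B ((e ^^ s) w) w = 0)" for t
  proof (induction t)
    case 0
    then show ?case using w top by (auto simp: B_simps intro!: bexI[of _ w])
  next
    case (Suc t)
    then obtain w where w: "w \<in> U" "B ((e ^^ m) w) w \<noteq> 0"
      and z: "\<And>s. m \<le> s + t \<Longrightarrow> s \<noteq> m \<Longrightarrow> B ((e ^^ s) w) w = 0" by blast
    show ?case
    proof (cases "Suc t \<le> m \<and> even (Suc t)")
      case False
      have "B ((e ^^ s) w) w = 0" if "m \<le> s + Suc t" "s \<noteq> m" for s
      proof (cases "m \<le> s + t")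
        case False
        then have "m = s + Suc t" using that by simp
        then have "odd s" using \<open>\<not> (Suc t \<le> m \<and> even (Suc t))\<close> m by (cases "even s") auto
        then have "B ((e ^^ s) w) w = - B ((e ^^ s) w) w"
          using so_skew_funpow[OF e, of s w w] symmetric[of w] by simp
        then show ?thesis using eq_uminus_self_iff by blast
      qed (use z that in blast)
      then show ?thesis using w by blast
    next
      case True
      define j where "j = Suc t"
      have j: "even j" "0 < j" "j \<le> m" using True by (auto simp: j_def)
      \<comment> \<open>As \<open>j\<close> is even, the two mixed terms of the expansion agree,
        which puts the \<open>2\<close> in the denominator.\<close>
      define c where "c = - B ((e ^^ (m - j)) w) w / (2 * B ((e ^^ m) w) w)"
      define w' where "w' = w + scale c ((e ^^ j) w)"
      have expand: "B ((e ^^ s) w') w' = B ((e ^^ s) w) w + 2 * c * B ((e ^^ (s + j)) w) w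
          + c * c * B ((e ^^ (s + j + j)) w) w" for s
      proof -
        have "B ((e ^^ s) w') w' = B ((e ^^ s) w) w + c * B ((e ^^ s) w) ((e ^^ j) w)
          + (c * B ((e ^^ (s + j)) w) w + c * c * B ((e ^^ (s + j)) w) ((e ^^ j) w))"
          by (simp add: w'_def le B_simps funpow_funpow distrib_left)
        then show ?thesis using j by (simp add: B_funpow_funpow[OF e] algebra_simps)
      qed
      have t0: "(e ^^ s) w = 0" if "m < s" for s using top[OF w(1) that] .
      have "w' \<in> U" using w(1) U(2)[OF w(1)] by (simp add: w'_def subspace_add[OF U(1)] subspace_scale[OF U(1)])
      moreover have "B ((e ^^ m) w') w' \<noteq> 0" using w(2) j by (simp add: expand t0 B_simps)
      moreover have "B ((e ^^ s) w') w' = 0" if s: "m \<le> s + Suc t" "s \<noteq> m" for s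
      proof (cases "s = m - j")
        case True
        then have "s + j = m" "m < s + j + j" using j by auto
        then show ?thesis using w(2) two_neq_zero True
          by (simp add: expand t0 B_simps c_def field_simps)
      next
        case False
        then have "m < s + j" "m \<le> s + t" using s by (auto simp: j_def)
        then show ?thesis using z s by (simp add: expand t0 B_simps)
      qed
      ultimately show ?thesis by blast
    qed
  qed
  from this[of m] show ?thesis by auto
qed

text \<open>Again downwards in the exponent, now with three values to clear each time:
  \<open>u\<close> against itself by adding a power of \<open>e\<close> applied to \<open>v\<close>,
  \<open>v\<close> against itself symmetrically, and finally \<open>u\<close> against
  \<open>v\<close> by changing \<open>v\<close> along its own chain. \<open>P t u v\<close> records
  that the exponents from \<open>m - t\<close> on are settled.\<close>

lemma normalise_paired_chains:
  assumes e: "e \<in> so scale B" and U: "subspace U" "\<And>v m. v \<in> U \<Longrightarrow> (e ^^ m) v \<in> U"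
    and top: "\<And>v s. v \<in> U \<Longrightarrow> m < s \<Longrightarrow> (e ^^ s) v = 0" and m: "odd m"
    and w: "w \<in> U" "w' \<in> U" "B ((e ^^ m) w) w' \<noteq> 0"
  shows "\<exists>w\<in>U. \<exists>w'\<in>U. B ((e ^^ m) w) w' \<noteq> 0 \<and> (\<forall>s. s \<noteq> m \<longrightarrow> B ((e ^^ s) w) w' = 0) \<and>
    (\<forall>s. B ((e ^^ s) w) w = 0) \<and> (\<forall>s. B ((e ^^ s) w') w' = 0)"
proof -
  note le = linD[OF lin_funpow[OF so_lin[OF e]]]
  have oddz: "B ((e ^^ s) u) u = 0" if "odd s" for s u
  proof -
    have "B ((e ^^ s) u) u = - B ((e ^^ s) u) u"
      using so_skew_funpow[OF e, of s u u] symmetric[of u] that by simp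
    then show ?thesis using eq_uminus_self_iff by blast
  qed
  define P where "P t u v \<longleftrightarrow> u \<in> U \<and> v \<in> U \<and> B ((e ^^ m) u) v \<noteq> 0 \<and>
    (\<forall>s. m \<le> s + t \<longrightarrow> s \<noteq> m \<longrightarrow> B ((e ^^ s) u) v = 0) \<and>
    (\<forall>s. m \<le> s + t \<longrightarrow> B ((e ^^ s) u) u = 0) \<and> (\<forall>s. m \<le> s + t \<longrightarrow> B ((e ^^ s) v) v = 0)" for t u v
  have swap: "B ((e ^^ s) v) u = (- 1) ^ s * B ((e ^^ s) u) v" for s u v
    using so_skew_funpow[OF e, of s v u] symmetric[of v] by simp
  have Psym: "P t v u" if "P t u v" for t u v
    using that unfolding P_def by (auto simp: swap[of _ v u])
  \<comment> \<open>Kills \<open>B (e\<^sup>s u) u\<close> at the exponent \<open>m - t - 1\<close>, at the cost of \<open>B (e\<^sup>s u) v\<close> there.\<close>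
  have diag: "\<exists>c. \<forall>s. m \<le> s + Suc t \<longrightarrow> B ((e ^^ s) (u + scale c ((e ^^ Suc t) v))) (u + scale c ((e ^^ Suc t) v)) = 0"
    if P: "P t u v" for t u v
  proof (cases "Suc t \<le> m \<and> odd (Suc t)")
    case False
    have "B ((e ^^ s) u) u = 0" if "m \<le> s + Suc t" for s
    proof (cases "m \<le> s + t")
      case True
      then show ?thesis using P by (simp add: P_def)
    next
      case nle: False
      then have "odd s" using that False m by (cases "even s") (auto simp: le_Suc_eq)
      then show ?thesis by (rule oddz)
    qed
    then show ?thesis by (intro exI[of _ 0]) simp
  next
    case True
    define j where "j = Suc t"
    have j: "odd j" "0 < j" "j \<le> m" using True by (auto simp: j_def)
    define c where "c = B ((e ^^ (m - j)) u) u / (2 * B ((e ^^ m) u) v)"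
    have uv: "u \<in> U" "v \<in> U" "B ((e ^^ m) u) v \<noteq> 0" using P by (auto simp: P_def)
    have t0: "(e ^^ s) x = 0" if "m < s" "x \<in> U" for s x using top that by blast
    have expand: "B ((e ^^ s) (u + scale c ((e ^^ j) v))) (u + scale c ((e ^^ j) v))
        = B ((e ^^ s) u) u - c * (1 + (- 1) ^ s) * B ((e ^^ (s + j)) u) v
          - c * c * B ((e ^^ (s + j + j)) v) v" for s
    proof -
      have "B ((e ^^ s) (u + scale c ((e ^^ j) v))) (u + scale c ((e ^^ j) v))
        = B ((e ^^ s) u) u + c * B ((e ^^ s) u) ((e ^^ j) v)
          + (c * B ((e ^^ (s + j)) v) u + c * c * B ((e ^^ (s + j)) v) ((e ^^ j) v))"
        by (simp add: le B_simps funpow_funpow distrib_left)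
      then show ?thesis using j
        by (simp add: B_funpow_funpow[OF e] swap[of _ v u] power_add algebra_simps)
    qed
    have "B ((e ^^ s) (u + scale c ((e ^^ j) v))) (u + scale c ((e ^^ j) v)) = 0"
      if s: "m \<le> s + Suc t" for s
    proof (cases "s = m - j")
      case True
      then have "s + j = m" "m < s + j + j" "even s" using j m by auto
      then show ?thesis unfolding expand using uv two_neq_zero True
        by (simp add: t0 B_simps c_def)
    next
      case False
      then have "m < s + j" "m \<le> s + t" using s by (auto simp: j_def)
      then show ?thesis unfolding expand using P uv by (simp add: t0 B_simps P_def)
    qed
    then show ?thesis by (auto simp: j_def)
  qed
  \<comment> \<open>A shift by a multiple of \<open>(e ^^ Suc t) v\<close> is invisible at the
    exponents already settled, where it is pushed beyond the nilpotency order.\<close>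
  have keep: "P t (u + scale c ((e ^^ Suc t) v)) v" if P: "P t u v" for t u v c
  proof -
    define j where "j = Suc t"
    have uv: "u \<in> U" "v \<in> U" "B ((e ^^ m) u) v \<noteq> 0" using P by (auto simp: P_def)
    have t0: "(e ^^ s) x = 0" if "m < s" "x \<in> U" for s x using top that by blast
    define u' where "u' = u + scale c ((e ^^ j) v)"
    have "u' \<in> U" using uv U(2) by (simp add: u'_def subspace_add[OF U(1)] subspace_scale[OF U(1)])
    moreover have 1: "(e ^^ s) u' = (e ^^ s) u" if "m \<le> s + t" for s
    proof -
      have "m < s + j" using that by (simp add: j_def)
      then show ?thesis using t0[of "s + j" v] uv by (simp add: u'_def le funpow_funpow)
    qed
    moreover have "B ((e ^^ s) u') u' = 0" if "m \<le> s + t" for s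
    proof -
      have "B ((e ^^ s) u') u' = B ((e ^^ s) u) u'" using 1[OF that] by simp
      also have "\<dots> = (- 1) ^ s * B ((e ^^ s) u') u" by (rule swap)
      also have "\<dots> = 0" using 1[OF that] P that by (simp add: P_def)
      finally show ?thesis .
    qed
    ultimately show ?thesis using P unfolding P_def u'_def[symmetric] j_def[symmetric] by simp
  qed
  have "\<exists>u v. P t u v" for t
  proof (induction t)
    case 0
    have "P 0 w w'"
      using w top oddz[OF m] unfolding P_def by (auto simp: B_simps le_less)
    then show ?case by blast
  next
    case (Suc t)
    then obtain u v where P0: "P t u v" by blast
    define j where "j = Suc t"
    obtain c where c: "\<forall>s. m \<le> s + Suc t \<longrightarrow>
        B ((e ^^ s) (u + scale c ((e ^^ j) v))) (u + scale c ((e ^^ j) v)) = 0"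
      using diag[OF P0] unfolding j_def by blast
    define u1 where "u1 = u + scale c ((e ^^ j) v)"
    have P1: "P t u1 v" using keep[OF P0] by (simp add: u1_def j_def)
    obtain c' where c': "\<forall>s. m \<le> s + Suc t \<longrightarrow>
        B ((e ^^ s) (v + scale c' ((e ^^ j) u1))) (v + scale c' ((e ^^ j) u1)) = 0"
      using diag[OF Psym[OF P1]] unfolding j_def by blast
    define v1 where "v1 = v + scale c' ((e ^^ j) u1)"
    have P2: "P t u1 v1" using Psym[OF keep[OF Psym[OF P1]]] by (simp add: v1_def j_def)
    have uv: "u1 \<in> U" "v1 \<in> U" "B ((e ^^ m) u1) v1 \<noteq> 0" using P2 by (auto simp: P_def)
    have t0: "(e ^^ s) x = 0" if "m < s" "x \<in> U" for s x using top that by blast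
    \<comment> \<open>This clears the mixed value at \<open>m - j\<close>. It does not spoil
      \<open>v1\<close> against itself: the additional terms have exponent at least
      \<open>m\<close>, where skewness of \<open>e ^^ m\<close> or nilpotency kills them.\<close>
    define a where "a = - ((- 1) ^ j * B ((e ^^ (m - j)) u1) v1 / B ((e ^^ m) u1) v1)"
    define v2 where "v2 = v1 + scale a ((e ^^ j) v1)"
    have j0: "0 < j" by (simp add: j_def)
    have pr: "B ((e ^^ s) u1) v2 = B ((e ^^ s) u1) v1 + a * (- 1) ^ j * B ((e ^^ (s + j)) u1) v1" for s
      by (simp add: v2_def B_simps B_funpow_funpow[OF e])
    have v2U: "v2 \<in> U" using uv U(2) by (simp add: v2_def subspace_add[OF U(1)] subspace_scale[OF U(1)])
    have 1: "B ((e ^^ m) u1) v2 \<noteq> 0" using uv j0 by (simp add: pr t0 B_simps)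
    have 2: "B ((e ^^ s) u1) v2 = 0" if s: "m \<le> s + Suc t" "s \<noteq> m" for s
    proof (cases "s + j = m")
      case True
      then have "m - j = s" by simp
      then show ?thesis using True uv by (simp add: pr a_def)
    next
      case False
      then have "m < s + j" "m \<le> s + t" using s by (auto simp: j_def)
      then show ?thesis using P2 s uv by (simp add: pr t0 B_simps P_def)
    qed
    have 3: "B ((e ^^ s) v2) v2 = 0" if s: "m \<le> s + Suc t" for s
    proof -
      have vz: "B ((e ^^ s) v1) v1 = 0" using c' s by (simp add: v1_def)
      have mj: "B ((e ^^ (s + j)) v1) v1 = 0"
      proof (cases "s + j = m")
        case True
        then show ?thesis using oddz m by simp
      next
        case False
        then have "m < s + j" using s by (simp add: j_def)
        then show ?thesis using t0 uv by (simp add: B_simps)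
      qed
      have "m < s + j + j" using s by (simp add: j_def)
      have "B ((e ^^ s) v2) v2 = B ((e ^^ s) v1) v1 + a * B ((e ^^ s) v1) ((e ^^ j) v1)
          + (a * B ((e ^^ (s + j)) v1) v1 + a * a * B ((e ^^ (s + j)) v1) ((e ^^ j) v1))"
        by (simp add: v2_def le B_simps funpow_funpow distrib_left)
      then show ?thesis using vz mj t0[OF \<open>m < s + j + j\<close> uv(2)]
        by (simp add: B_funpow_funpow[OF e] B_simps)
    qed
    have "P (Suc t) u1 v2"
      unfolding P_def using uv v2U 1 2 3 c by (simp add: u1_def)
    then show ?case by blast
  qed
  then obtain u v where "P m u v" by blast
  then show ?thesis unfolding P_def by auto
qed

lemma adapted_family_extend_fixed:
  assumes e: "e \<in> so scale B" and a: "adapted_family e k w d star"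
    and bound: "\<And>i. i < k \<Longrightarrow> m \<le> d i" and m: "even m" and top: "(e ^^ Suc m) u = 0"
    and u: "u \<in> family_perp e k w" "B ((e ^^ m) u) u \<noteq> 0" "\<And>s. s \<noteq> m \<Longrightarrow> B ((e ^^ s) u) u = 0"
  shows "adapted_family e (Suc k) (w(k := u)) (d(k := m)) (star(k := k))"
proof -
  note D = adapted_familyD[OF a]
  have orth: "B ((e ^^ s) u) (w i) = 0" "B ((e ^^ s) (w i)) u = 0" if "i < k" for i s
  proof -
    have "B u ((e ^^ s) (w i)) = 0" using u(1) that by (auto simp: family_perp_def)
    then show "B ((e ^^ s) u) (w i) = 0" "B ((e ^^ s) (w i)) u = 0"
      using so_skew_funpow[OF e] symmetric[of u] by simp_all
  qed
  show ?thesis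
    unfolding adapted_family_def
  proof (intro conjI allI impI)
    fix i assume i: "i < Suc k"
    show "(star(k := k)) i < Suc k" "(star(k := k)) ((star(k := k)) i) = i"
      "(star(k := k)) i \<le> Suc i" "i \<le> Suc ((star(k := k)) i)"
      "(d(k := m)) ((star(k := k)) i) = (d(k := m)) i"
      "((star(k := k)) i = i) = even ((d(k := m)) i)"
      "(e ^^ Suc ((d(k := m)) i)) ((w(k := u)) i) = 0"
      using i D[of i] m top by (auto simp: less_Suc_eq)
    show "(d(k := m)) j \<le> (d(k := m)) i'" if "i' \<le> j" "j < Suc k" for i' j
      using that adapted_family_antimono[OF a] bound by (auto simp: less_Suc_eq)
    fix j s assume j: "j < Suc k"
    show "(B ((e ^^ s) ((w(k := u)) i)) ((w(k := u)) j) \<noteq> 0)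
      = (j = (star(k := k)) i \<and> s = (d(k := m)) i)"
    proof (cases "i < k")
      case True
      then show ?thesis
        using j orth D(1)[of i] adapted_family_gram0[OF a] by (cases "j = k") auto
    next
      case False
      then show ?thesis
        using i j orth u(2) u(3)[of s] by (cases "j = k"; cases "s = m") (auto simp: less_Suc_eq)
    qed
  qed
qed

lemma adapted_family_extend_pair:
  assumes e: "e \<in> so scale B" and a: "adapted_family e k w d star"
    and bound: "\<And>i. i < k \<Longrightarrow> m \<le> d i" and m: "odd m"
    and top: "(e ^^ Suc m) u = 0" "(e ^^ Suc m) v = 0"
    and perp: "u \<in> family_perp e k w" "v \<in> family_perp e k w"
    and uv: "B ((e ^^ m) u) v \<noteq> 0" "\<And>s. s \<noteq> m \<Longrightarrow> B ((e ^^ s) u) v = 0"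
      "\<And>s. B ((e ^^ s) u) u = 0" "\<And>s. B ((e ^^ s) v) v = 0"
  shows "adapted_family e (Suc (Suc k)) (w(k := u, Suc k := v)) (d(k := m, Suc k := m))
    (star(k := Suc k, Suc k := k))"
proof -
  note D = adapted_familyD[OF a]
  have orth: "B ((e ^^ s) x) (w i) = 0" "B ((e ^^ s) (w i)) x = 0"
    if "i < k" "x \<in> family_perp e k w" for i s x
  proof -
    have "B x ((e ^^ s) (w i)) = 0" using that by (auto simp: family_perp_def)
    then show "B ((e ^^ s) x) (w i) = 0" "B ((e ^^ s) (w i)) x = 0"
      using so_skew_funpow[OF e] symmetric[of x] by simp_all
  qed
  have vu: "B ((e ^^ s) v) u \<noteq> 0 \<longleftrightarrow> s = m" for s
    using so_skew_funpow[OF e, of s v u] symmetric[of v] uv by auto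
  let ?w = "w(k := u, Suc k := v)" and ?d = "d(k := m, Suc k := m)"
    and ?s = "star(k := Suc k, Suc k := k)"
  show ?thesis
    unfolding adapted_family_def
  proof (intro conjI allI impI)
    fix i assume i: "i < Suc (Suc k)"
    then consider "i < k" | "i = k" | "i = Suc k" by linarith
    then show "?s i < Suc (Suc k)" "?s (?s i) = i" "?s i \<le> Suc i" "i \<le> Suc (?s i)"
      "?d (?s i) = ?d i" "(?s i = i) = even (?d i)" "(e ^^ Suc (?d i)) (?w i) = 0"
      using D[of i] m top by (cases; force)+
    show "?d j \<le> ?d i'" if "i' \<le> j" "j < Suc (Suc k)" for i' j
      using that adapted_family_antimono[OF a] bound by (auto simp: less_Suc_eq)
    fix j s assume j: "j < Suc (Suc k)"
    then have j3: "j < k \<or> j = k \<or> j = Suc k" by linarith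
    have i3: "i < k \<or> i = k \<or> i = Suc k" using i by linarith
    show "(B ((e ^^ s) (?w i)) (?w j) \<noteq> 0) = (j = ?s i \<and> s = ?d i)"
    proof (cases "i < k")
      case True
      show ?thesis
      proof (cases "j < k")
        case jk: True
        then show ?thesis using True adapted_family_gram0[OF a True jk, of s] by simp
      next
        case False
        then have "?w j \<in> family_perp e k w" "j \<noteq> star i" using j3 perp D(1)[OF True] by auto
        then show ?thesis using True orth(2)[OF True] by simp
      qed
    next
      case False
      then consider "i = k" | "i = Suc k" using i3 by blast
      then show ?thesis
      proof cases
        case 1
        then show ?thesis using j3 orth(1)[OF _ perp(1)] uv(1,3) uv(2)[of s] by (cases "s = m") auto
      next
        case 2
        then show ?thesis using j3 orth(1)[OF _ perp(2)] uv(4) vu by auto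
      qed
    qed
  qed
qed

text \<open>Let \<open>m\<close> be the last exponent for which \<open>e ^^ m\<close> is nonzero on
  the complement. The form \<open>B ((e ^^ m) x) y\<close> is nonzero there; for even
  \<open>m\<close> it is symmetric and polarisation yields a single generator, for odd
  \<open>m\<close> it is skew and a pair is needed. The invariant \<open>bound\<close> keeps the
  lengths decreasing.\<close>

lemma adapted_family_extend:
  assumes e: "e \<in> so scale B" and nil: "nilpotent_map e" and a: "adapted_family e k w d star"
    and bound: "\<And>v i. v \<in> family_perp e k w \<Longrightarrow> i < k \<Longrightarrow> (e ^^ Suc (d i)) v = 0"
    and ne: "family_perp e k w \<noteq> {0}"
  shows "\<exists>k' w' d' star'. k < k' \<and> adapted_family e k' w' d' star' \<and>
    (\<forall>v\<in>family_perp e k' w'. \<forall>i<k'. (e ^^ Suc (d' i)) v = 0)"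
proof -
  note le = linD[OF lin_funpow[OF so_lin[OF e]]]
  let ?U = "family_perp e k w"
  define m where "m = (LEAST m. \<forall>v\<in>?U. (e ^^ Suc m) v = 0)"
  obtain m0 where "\<forall>v. (e ^^ m0) v = 0" using nil by (auto simp: nilpotent_map_def)
  then have "\<forall>v\<in>?U. (e ^^ Suc m0) v = 0" using linD(4)[OF so_lin[OF e]] by simp
  then have top': "\<forall>v\<in>?U. (e ^^ Suc m) v = 0" unfolding m_def by (rule LeastI)
  have top: "(e ^^ s) v = 0" if "v \<in> ?U" "m < s" for v s
    by (rule funpow_zero_above[OF so_lin[OF e], of "Suc m"]) (use top' that in auto)
  have zU: "0 \<in> ?U" using subspace_family_perp subspace_0 by blast
  obtain u0 where u0: "u0 \<in> ?U" "(e ^^ m) u0 \<noteq> 0"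
  proof (cases m)
    case 0
    obtain x where "x \<in> ?U" "x \<noteq> 0" using ne zU by blast
    then show ?thesis using that[of x] 0 by simp
  next
    case (Suc m')
    have "\<not> (\<forall>v\<in>?U. (e ^^ Suc m') v = 0)"
      by (rule not_less_Least) (use Suc in \<open>simp add: m_def\<close>)
    then show ?thesis using that unfolding Suc by blast
  qed
  have md: "m \<le> d i" if "i < k" for i
  proof (rule ccontr)
    assume "\<not> m \<le> d i"
    then have "(e ^^ m) u0 = 0"
      by (intro funpow_zero_above[OF so_lin[OF e] bound[OF u0(1) that]]) simp
    then show False using u0 by simp
  qed
  obtain v0 where v0: "v0 \<in> ?U" "B ((e ^^ m) u0) v0 \<noteq> 0"
    using family_perp_nondegenerate[OF e a family_perp_funpow[OF e u0(1)] u0(2)] by blast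
  note UU = subspace_family_perp[of e k w] family_perp_funpow[OF e]
  show ?thesis
  proof (cases "even m")
    case True
    have sym: "B ((e ^^ m) v0) u0 = B ((e ^^ m) u0) v0"
      using so_skew_funpow[OF e, of m v0 u0] symmetric[of v0] True by simp
    have "\<exists>x\<in>?U. B ((e ^^ m) x) x \<noteq> 0"
    proof (rule ccontr)
      assume "\<not> ?thesis"
      then have z: "B ((e ^^ m) x) x = 0" if "x \<in> ?U" for x using that by blast
      have "u0 + v0 \<in> ?U" using UU(1) u0 v0 by (simp add: subspace_add)
      \<comment> \<open>Polarisation: a symmetric form vanishing on all diagonals vanishes when
        \<open>2\<close> is invertible.\<close>
      from z[OF this] have "2 * B ((e ^^ m) u0) v0 = 0"
        using z[OF u0(1)] z[OF v0(1)] sym by (simp add: le B_simps)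
      then show False using v0 two_neq_zero by simp
    qed
    then obtain x where "x \<in> ?U" "B ((e ^^ m) x) x \<noteq> 0" by blast
    from normalise_fixed_chain[OF e UU(1) UU(2) top True this]
    obtain u where u: "u \<in> ?U" "B ((e ^^ m) u) u \<noteq> 0" "\<And>s. s \<noteq> m \<Longrightarrow> B ((e ^^ s) u) u = 0"
      by blast
    have "adapted_family e (Suc k) (w(k := u)) (d(k := m)) (star(k := k))"
      by (rule adapted_family_extend_fixed[OF e a md True _ u]) (use top' u in auto)
    moreover have "(e ^^ Suc ((d(k := m)) i)) v = 0"
      if v: "v \<in> family_perp e (Suc k) (w(k := u))" and i: "i < Suc k" for v i
    proof -
      have "v \<in> ?U" using v family_perp_mono[of k "Suc k" "w(k := u)" w] by fastforce
      then show ?thesis using bound top' i by (cases "i = k") auto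
    qed
    ultimately show ?thesis by (metis lessI)
  next
    case False
    from normalise_paired_chains[OF e UU(1) UU(2) top False u0(1) v0]
    obtain u v where uv: "u \<in> ?U" "v \<in> ?U" "B ((e ^^ m) u) v \<noteq> 0"
      "\<And>s. s \<noteq> m \<Longrightarrow> B ((e ^^ s) u) v = 0" "\<And>s. B ((e ^^ s) u) u = 0" "\<And>s. B ((e ^^ s) v) v = 0"
      by blast
    have "adapted_family e (Suc (Suc k)) (w(k := u, Suc k := v)) (d(k := m, Suc k := m))
        (star(k := Suc k, Suc k := k))"
      by (rule adapted_family_extend_pair[OF e a md False _ _ uv]) (use top' uv in auto)
    moreover have "(e ^^ Suc ((d(k := m, Suc k := m)) i)) x = 0"
      if x: "x \<in> family_perp e (Suc (Suc k)) (w(k := u, Suc k := v))" and i: "i < Suc (Suc k)" for x i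
    proof -
      have "x \<in> ?U"
        using x family_perp_mono[of k "Suc (Suc k)" "w(k := u, Suc k := v)" w] by fastforce
      then show ?thesis using bound[of x i] top' i by (cases "i < k") auto
    qed
    ultimately show ?thesis by (metis lessI less_SucI)
  qed
qed

text \<open>The dimension bounds the number of chains, and a family with the largest number of
  chains leaves no complement, since it could otherwise be extended.\<close>

theorem adapted_family_exists:
  assumes e: "e \<in> so scale B" and nil: "nilpotent_map e"
  obtains k w d star where "adapted_family e k w d star" "family_perp e k w = {0}"
proof -
  define Q where "Q k \<longleftrightarrow> (\<exists>w d star. adapted_family e k w d star \<and>
    (\<forall>v\<in>family_perp e k w. \<forall>i<k. (e ^^ Suc (d i)) v = 0))" for k
  have bound: "k \<le> dim UNIV" if Qk: "Q k" for k
  proof -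
    obtain w d star where "adapted_family e k w d star" using Qk unfolding Q_def by blast
    from adapted_family_dim[OF e this] have "(\<Sum>i<k. Suc (d i)) \<le> dim UNIV" .
    moreover have "(\<Sum>i<k. 1) \<le> (\<Sum>i<k. Suc (d i))" by (rule sum_mono) simp
    ultimately show ?thesis by simp
  qed
  have "Q 0" by (auto simp: Q_def adapted_family_def)
  then obtain k where k: "Q k" "\<And>k'. Q k' \<Longrightarrow> k' \<le> k"
    using Nat.ex_has_greatest_nat[of Q 0 "dim UNIV"] bound by metis
  then obtain w d star where a: "adapted_family e k w d star"
    and b: "\<And>v i. v \<in> family_perp e k w \<Longrightarrow> i < k \<Longrightarrow> (e ^^ Suc (d i)) v = 0"
    unfolding Q_def by blast
  have "family_perp e k w = {0}"
  proof (rule ccontr)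
    assume "family_perp e k w \<noteq> {0}"
    from adapted_family_extend[OF e nil a b this] obtain k' where "k < k'" "Q k'"
      unfolding Q_def by blast
    then show False using k(2) by (meson not_le)
  qed
  with a that show thesis by blast
qed

end

subsection \<open>The linear system of the stabiliser\<close>

text \<open>The matching of generators used by the functional. For odd \<open>k\<close> the last
  index is sent to \<open>k\<close>, just outside the range; coefficients at index \<open>k\<close>
  are taken to be zero, so that paths may end there.\<close>

definition mate :: "nat \<Rightarrow> nat" where
  "mate i = (if even i then Suc i else i - 1)"

lemma mate_simps:
  "even i \<Longrightarrow> mate i = Suc i" "odd i \<Longrightarrow> mate i = i - 1" "mate (mate i) = i"
  by (auto simp: mate_def elim!: oddE)

lemma mate_Suc: "even i \<Longrightarrow> mate (Suc i) = i"
  by (simp add: mate_def)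

lemma pair_index_shift:
  fixes x q :: nat
  assumes "x div 2 < q div 2" "2 \<le> x"
  shows "(x - 2) div 2 < (q - 2) div 2" "(x - 2) div 2 < Suc (Suc q) div 2"
  using assms by presburger+

text \<open>An abstract form of the stabiliser conditions. \<open>f u v s\<close> stands for
  \<open>B (x (w u)) ((e ^^ s) (w v))\<close>, and \<open>stabiliser_eq\<close> expresses that the
  functional vanishes on the commutator of \<open>x\<close> with the centralising map built from the
  chains \<open>p\<close> and \<open>q\<close> in total degree \<open>N\<close>. \<open>C\<close>
  carries the corrective term. The \<open>source\<close> assumptions switch off one family of
  coefficients for each index; they are the free parameters of the system.\<close>

locale stabiliser_equations =
  fixes k :: nat and d star :: "nat \<Rightarrow> nat" and A C :: "nat \<Rightarrow> 'k::field"
    and f :: "nat \<Rightarrow> nat \<Rightarrow> nat \<Rightarrow> 'k"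
  assumes two: "(2::'k) \<noteq> 0"
    and star_less: "i < k \<Longrightarrow> star i < k"
    and star_star: "i < k \<Longrightarrow> star (star i) = i"
    and star_adjacent: "i < k \<Longrightarrow> star i \<le> Suc i \<and> i \<le> Suc (star i)"
    and d_star: "i < k \<Longrightarrow> d (star i) = d i"
    and star_fixed: "i < k \<Longrightarrow> star i = i \<longleftrightarrow> even (d i)"
    and d_antimono: "i \<le> j \<Longrightarrow> j < k \<Longrightarrow> d j \<le> d i"
    and A_nonzero: "i < k \<Longrightarrow> A i \<noteq> 0"
    and C_nonzero: "i < k \<Longrightarrow> even i \<Longrightarrow> star i = Suc i \<Longrightarrow> C i \<noteq> 0"
    and C_zero: "i < k \<Longrightarrow> \<not> (even i \<and> star i = Suc i) \<Longrightarrow> C i = 0"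
    and A_pair: "i < k \<Longrightarrow> even i \<Longrightarrow> star i = Suc i \<Longrightarrow> A (Suc i) = A i"
    and A_distinct: "i < k \<Longrightarrow> j < k \<Longrightarrow> even i \<Longrightarrow> even j \<Longrightarrow> i \<noteq> j \<Longrightarrow>
      star i = Suc i \<Longrightarrow> star j = Suc j \<Longrightarrow> A i \<noteq> A j"
    and A_distinct_fixed: "Suc i < k \<Longrightarrow> Suc j < k \<Longrightarrow> even i \<Longrightarrow> even j \<Longrightarrow> i \<noteq> j \<Longrightarrow>
      star i = i \<Longrightarrow> star (Suc i) = Suc i \<Longrightarrow> star j = j \<Longrightarrow> star (Suc j) = Suc j \<Longrightarrow>
      A i * A (Suc i) \<noteq> A j * A (Suc j)"
    and f_skew: "f u v s = (- 1) ^ Suc s * f v u s"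
    and f_null: "f k v s = 0"
    and f_high: "u < k \<Longrightarrow> d u < s \<Longrightarrow> f u v s = 0"
    and stabiliser_eq: "p < k \<Longrightarrow> q < k \<Longrightarrow> d p \<le> N \<Longrightarrow> d q \<le> N \<Longrightarrow>
      (- 1) ^ d q * (A q * f (mate (star q)) p (N - d q) + C q * f (star q) p (Suc (N - d q)))
      = (- 1) ^ (N - d p) *
        (A p * f (mate (star p)) q (N - d p) + C p * f (star p) q (Suc (N - d p)))"
    and source_diag: "u < k \<Longrightarrow> even u \<Longrightarrow> odd s \<Longrightarrow> s \<le> d u \<Longrightarrow> f u u s = 0"
    and source_chain: "even u \<Longrightarrow> Suc u < k \<Longrightarrow> star (Suc u) = Suc (Suc u) \<Longrightarrow> odd s \<Longrightarrow>
      s \<le> d (Suc u) \<Longrightarrow> f (Suc (Suc u)) u s = 0"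
    and source_pair: "even u \<Longrightarrow> Suc u < k \<Longrightarrow> star (Suc u) \<noteq> Suc (Suc u) \<Longrightarrow> even s \<Longrightarrow>
      s \<le> d (Suc u) \<Longrightarrow> f u (Suc u) s = 0"
begin

lemma self_neg_zero: "(x::'k) = - x \<Longrightarrow> x = 0"
proof -
  assume "x = - x"
  then have "2 * x = 0" unfolding mult_2 by (metis add.right_inverse)
  then show ?thesis using two by simp
qed

lemma swap_zero: "f u v s = 0 \<longleftrightarrow> f v u s = 0"
  by (subst f_skew) simp

lemma f_even_diag: "even s \<Longrightarrow> f u u s = 0"
  using f_skew[of u u s] by (intro self_neg_zero) simp

lemma mate_star_le:
  assumes "p < k" shows "mate (star p) \<le> k"
  using star_less[OF assms] by (auto simp: mate_def)

lemma mate_le: "x < k \<Longrightarrow> mate x \<le> k"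
  by (auto simp: mate_def)

lemma star_cases:
  assumes "i < k"
  obtains "star i = i" "even (d i)" | "star i = Suc i" "odd (d i)" "star (Suc i) = i" "Suc i < k"
  | "0 < i" "star i = i - 1" "odd (d i)" "star (i - 1) = i"
proof -
  have "star i = i \<or> star i = Suc i \<or> (0 < i \<and> star i = i - 1)"
    using star_adjacent[OF assms] by auto
  then show thesis
    using that star_fixed[OF assms] star_star[OF assms] star_less[OF assms] by force
qed

text \<open>Among chains of one length with odd \<open>d\<close> the dual pairs are consecutive, so
  all of them begin at the same parity as the first.\<close>

lemma star_pair_aligned:
  assumes "even i" "star i = Suc i" "even j" "i \<le> j" "j < k" "d j = d i"
  shows "star j = Suc j"
proof -
  have "\<forall>j. j = i + 2 * t \<longrightarrow> j < k \<longrightarrow> d j = d i \<longrightarrow> star j = Suc j" for t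
  proof (induction t)
    case 0
    then show ?case using assms by simp
  next
    case (Suc t)
    show ?case
    proof (intro allI impI)
      fix j assume j: "j = i + 2 * Suc t" "j < k" "d j = d i"
      define j' where "j' = i + 2 * t"
      have dj': "d j' = d i"
        using d_antimono[of j' j] d_antimono[of i j'] j by (simp add: j'_def)
      have "star j' = Suc j'" using Suc dj' j by (simp add: j'_def)
      then have sj: "star (Suc j') = j'" using star_star[of j'] j by (simp add: j'_def)
      have jj: "j = Suc (Suc j')" using j by (simp add: j'_def)
      have odd: "odd (d j)"
        using star_fixed[of i] assms j by simp
      from j(2) show "star j = Suc j"
      proof (cases rule: star_cases[of j])
        case 3
        then have "star (Suc j') = j" using jj by simp
        then show ?thesis using sj jj by simp
      qed (use j odd in auto)
    qed
  qed
  moreover have "j = i + 2 * ((j - i) div 2)" using assms by auto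
  ultimately show ?thesis using assms by blast
qed

lemma star_chain_aligned:
  assumes "even i" "0 < i" "star i = i - 1" "even j" "i \<le> j" "j < k" "d j = d i"
  shows "star j = j - 1"
proof (rule ccontr)
  assume neg: "star j \<noteq> j - 1"
  define P where "P l \<longleftrightarrow> even l \<and> i \<le> l \<and> l \<le> j \<and> star l \<noteq> l - 1" for l
  define l where "l = (LEAST l. P l)"
  have Pl: "P l" unfolding l_def by (rule LeastI[of P j]) (use neg assms in \<open>simp add: P_def\<close>)
  then have "l \<noteq> i" using assms by (auto simp: P_def)
  then have l2: "even (l - 2)" "i \<le> l - 2" "l - 2 < l" "2 \<le> l"
    using Pl assms by (auto simp: P_def elim!: evenE)
  then have "\<not> P (l - 2)" using not_less_Least[of "l - 2" P] by (simp add: l_def)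
  then have s2: "star (l - 2) = l - 3" using l2 Pl by (auto simp: P_def)
  have lk: "l < k" using Pl assms by (simp add: P_def)
  have dd: "d (l - 1) = d i" "d l = d i"
  proof -
    have le: "i \<le> l - 1" "l - 1 \<le> j" "l - 1 < k" "i \<le> l" "l \<le> j" using Pl l2 lk by (auto simp: P_def)
    show "d (l - 1) = d i" "d l = d i"
      using d_antimono[OF le(1,3)] d_antimono[OF le(2) assms(6)] d_antimono[OF le(4) lk]
        d_antimono[OF le(5) assms(6)] assms(7) by auto
  qed
  have "odd (d i)" using star_fixed[of i] assms by auto
  have "star (l - 1) = l"
  proof (rule star_cases[of "l - 1"])
    show "l - 1 < k" using lk by simp
  next
    assume "even (d (l - 1))" then show ?thesis using dd \<open>odd (d i)\<close> by simp
  next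
    assume "star (l - 1) = Suc (l - 1)" then show ?thesis using l2 by simp
  next
    assume 4: "star (l - 1 - 1) = l - 1"
    then have "star (l - 2) = l - 1" using l2 by (simp add: numeral_2_eq_2)
    then show ?thesis using s2 l2 by simp
  qed
  then have "star l = l - 1" using star_star[of "l - 1"] lk by simp
  then show False using Pl by (simp add: P_def)
qed

end

section \<open>The stabiliser equations at one exponent, with all higher exponents settled\<close>

locale stabiliser_equations_level = stabiliser_equations +
  fixes s :: nat
  assumes higher: "s < s' \<Longrightarrow> u < k \<Longrightarrow> v < k \<Longrightarrow> f u v s' = 0"
begin

lemma higher': "s < s' \<Longrightarrow> u \<le> k \<Longrightarrow> v < k \<Longrightarrow> f u v s' = 0"
  using higher f_null by (cases "u = k") auto

text \<open>For \<open>N = s + d p\<close> the terms coming from the shorter chain \<open>q\<close>,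
  and both \<open>C\<close> terms, have exponents above \<open>s\<close>; a single coefficient
  remains.\<close>

lemma rel_less:
  assumes "p < k" "q < k" "d q < d p"
  shows "f (mate (star p)) q s = 0"
proof -
  have "f (star p) q (Suc s) = 0" using assms star_less by (intro higher) auto
  moreover have "f (mate (star q)) p (s + d p - d q) = 0" "f (star q) p (Suc (s + d p - d q)) = 0"
    using assms star_less[of q] mate_star_le[of q] by (auto intro!: higher')
  ultimately show ?thesis
    using stabiliser_eq[of p q "s + d p"] assms A_nonzero[of p] by simp
qed

lemma rel_eq:
  assumes "p < k" "q < k" "d p = d q"
  shows "(- 1) ^ d p * (A q * f (mate (star q)) p s) = (- 1) ^ s * (A p * f (mate (star p)) q s)"
proof -
  have "f (star p) q (Suc s) = 0" "f (star q) p (Suc s) = 0"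
    using assms star_less by (auto intro!: higher)
  then show ?thesis using stabiliser_eq[of p q "s + d p"] assms by simp
qed

lemma less_zero:
  assumes "mate x < k" "q < k" "d q < d (mate x)"
  shows "f x q s = 0"
  using rel_less[of "star (mate x)" q] assms star_less star_star d_star mate_simps(3) by simp

text \<open>The transport rule: up to nonzero factors the coefficient at \<open>(x, q)\<close> is
  the one at \<open>(mate (star q), star (mate x))\<close>. What follows traces this map on index
  pairs until it reaches a coefficient already known to vanish.\<close>

lemma eq_rel:
  assumes "mate x < k" "q < k" "d (mate x) = d q"
  shows "(- 1) ^ d q * (A q * f (mate (star q)) (star (mate x)) s)
    = (- 1) ^ s * (A (star (mate x)) * f x q s)"
  using rel_eq[of "star (mate x)" q] assms star_less star_star d_star mate_simps(3) by simp

lemma eq_zero: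
  assumes "mate x < k" "q < k" "d (mate x) = d q" "f (mate (star q)) (star (mate x)) s = 0"
  shows "f x q s = 0"
  using eq_rel[OF assms(1-3)] assms(4) A_nonzero[of "star (mate x)"] star_less[OF assms(1)] by simp

lemma diag_even: "u < k \<Longrightarrow> even u \<Longrightarrow> f u u s = 0"
  using f_even_diag source_diag f_high by (cases "even s"; cases "s \<le> d u") auto

text \<open>Here transport leads back to the same coefficient. For even \<open>s\<close> the signs
  differ and the coefficient vanishes; for odd \<open>s\<close> the relation is void, which is why
  this coefficient is a source.\<close>

lemma chain_zero:
  assumes "even u" "Suc u < k" "star (Suc u) = Suc (Suc u)"
  shows "f (Suc (Suc u)) u s = 0"
proof (cases "even s")
  case True
  have k: "Suc (Suc u) < k" using star_less[OF assms(2)] assms(3) by simp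
  have st: "star (Suc (Suc u)) = Suc u" using star_star[OF assms(2)] assms(3) by simp
  have "odd (d (Suc u))" using star_fixed[OF assms(2)] assms(3) by simp
  then have "odd (d (Suc (Suc u)))" using d_star[OF assms(2)] assms(3) by simp
  with rel_eq[OF k k refl] True st assms(1)
  have "- (A (Suc (Suc u)) * f u (Suc (Suc u)) s) = A (Suc (Suc u)) * f u (Suc (Suc u)) s"
    by (simp add: mate_Suc)
  then have "A (Suc (Suc u)) * f u (Suc (Suc u)) s = 0" by (intro self_neg_zero) simp
  then show ?thesis using A_nonzero[OF k] swap_zero by simp
next
  case False
  have "f u (Suc (Suc u)) s = 0 \<longleftrightarrow> f (Suc (Suc u)) u s = 0" by (rule swap_zero)
  moreover have "f (Suc (Suc u)) u s = 0" if "d (Suc u) < s"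
    using that f_high[of "Suc (Suc u)"] star_less[OF assms(2)] d_star[OF assms(2)] assms(3) by simp
  ultimately show ?thesis using source_chain[OF assms False] by (cases "s \<le> d (Suc u)") auto
qed

lemma cross_between:
  assumes "x div 2 < q div 2"
  shows "mate x < q" "x < q"
  using assms by (auto simp: mate_def elim!: evenE oddE)

text \<open>Transport goes from \<open>(x, q)\<close> to \<open>(mate q, mate x)\<close> and, if all
  four chains have equal length, back to \<open>(q, x)\<close>. The round trip compares the products
  of \<open>A\<close> over the two mated pairs, which differ by \<open>A_distinct_fixed\<close>.
  Otherwise the path stops at index \<open>k\<close> or at a drop of length.\<close>

lemma cross_fixed:
  assumes x: "x div 2 < q div 2" "q < k" "d (mate x) = d q" "star (mate x) = mate x"
  shows "f x q s = 0"
proof -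
  define m where "m = mate x"
  have m: "m < q" "x < q" "m < k" "x < k" using cross_between[OF x(1)] x(2) by (auto simp: m_def)
  have mm: "mate m = x" by (simp add: m_def mate_simps)
  have evd: "even (d q)" using star_fixed[OF m(3)] x by (simp add: m_def)
  have sq: "star q = q" using star_fixed[OF x(2)] evd by simp
  have r1: "A q * f (mate q) m s = (- 1) ^ s * (A m * f x q s)"
    using eq_rel[of x q] x m sq evd by (simp add: m_def)
  show ?thesis
  proof (cases "mate q < k")
    case False
    then have "mate q = k" using mate_le[OF x(2)] by simp
    then show ?thesis using r1 f_null A_nonzero[OF m(3)] by simp
  next
    case True
    have mq: "m < mate q" using x(1) unfolding m_def by (auto simp: mate_def elim!: evenE oddE)
    have le: "d (mate q) \<le> d q" using d_antimono[of m "mate q"] mq True x(3) by (simp add: m_def)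
    have dx: "d q \<le> d x" using d_antimono[of x q] m x by simp
    show ?thesis
    proof (cases "d (mate q) < d x")
      case True
      have "f m (mate q) s = 0"
        by (rule less_zero) (use \<open>mate q < k\<close> True m mm in auto)
      then have "f (mate q) m s = 0" using swap_zero by blast
      then show ?thesis using r1 A_nonzero[OF m(3)] by simp
    next
      case False
      then have dd: "d x = d q" "d (mate q) = d q" using le dx by auto
      have sx: "star x = x" "star (mate q) = mate q"
        using star_fixed[OF m(4)] star_fixed[OF True] dd evd by auto
      have r2: "A (mate q) * f q x s = (- 1) ^ s * (A x * f m (mate q) s)"
        using eq_rel[of m "mate q"] mm m True dd sx evd mate_simps(3) by simp
      have "(- 1) ^ s * (A q * A (mate q)) * f q x s = (- 1) ^ s * (A q * ((- 1) ^ s * (A x * f m (mate q) s)))"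
        using r2 by (simp add: mult.assoc)
      also have "\<dots> = A x * (A q * f m (mate q) s)"
        by (simp add: algebra_simps flip: power_add mult_2)
      also have "\<dots> = A x * (A q * ((- 1) ^ Suc s * f (mate q) m s))"
        using f_skew[of m "mate q" s] by simp
      also have "\<dots> = A x * ((- 1) ^ Suc s * (A q * f (mate q) m s))" by (simp add: algebra_simps)
      also have "\<dots> = A x * ((- 1) ^ Suc s * ((- 1) ^ s * (A m * f x q s)))" by (simp only: r1)
      also have "\<dots> = A x * ((- 1) ^ Suc s * ((- 1) ^ s * (A m * ((- 1) ^ Suc s * f q x s))))"
        using f_skew[of x q s] by simp
      also have "\<dots> = (- 1) ^ s * (A x * A m) * f q x s"
        by (simp add: algebra_simps flip: power_add mult_2)
      finally have eq: "(A q * A (mate q) - A x * A m) * f q x s = 0"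
        by (simp add: left_diff_distrib)
      have ne: "A q * A (mate q) \<noteq> A x * A m"
      proof -
        define i where "i = 2 * (q div 2)"
        define j where "j = 2 * (x div 2)"
        have i: "even i" "{q, mate q} = {i, Suc i}" "A q * A (mate q) = A i * A (Suc i)"
          by (auto simp: i_def mate_def mult.commute elim!: evenE oddE)
        have j: "even j" "{x, m} = {j, Suc j}" "A x * A m = A j * A (Suc j)"
          by (auto simp: j_def m_def mate_def mult.commute elim!: evenE oddE)
        have "i \<noteq> j" using x(1) by (auto simp: i_def j_def)
        moreover have "Suc i < k" "star i = i" "star (Suc i) = Suc i"
          using i(2) x(2) True sq sx by (metis insertI1 insertI2 insertE singletonD)+
        moreover have "Suc j < k" "star j = j" "star (Suc j) = Suc j"
          using j(2) m sx x(4) m_def by (metis insertI1 insertI2 insertE singletonD)+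
        ultimately show ?thesis using A_distinct_fixed[of i j] i j by metis
      qed
      then have "f q x s = 0" using eq by simp
      then show ?thesis using swap_zero by blast
    qed
  qed
qed

text \<open>Alignment puts \<open>q\<close> in a self-linked pair as well. Transport then only
  exchanges \<open>x\<close> and \<open>q\<close>, and by skewness the relation becomes
  \<open>(A q - A x) * f q x s = 0\<close>.\<close>

lemma cross_pair:
  assumes x: "x div 2 < q div 2" "q < k" "d (mate x) = d q" "star (mate x) = x"
  shows "f x q s = 0"
proof -
  define i where "i = 2 * (x div 2)"
  define j where "j = 2 * (q div 2)"
  have m: "mate x < q" "x < q" "mate x < k" "x < k" using cross_between[OF x(1)] x(2) by auto
  have sx: "star x = mate x" using star_star[OF m(3)] x(4) by simp
  have i: "even i" "(x = i \<and> mate x = Suc i) \<or> (x = Suc i \<and> mate x = i)"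
    by (auto simp: i_def mate_def elim!: evenE oddE)
  have j: "even j" "(q = j \<and> mate q = Suc j) \<or> (q = Suc j \<and> mate q = j)"
    by (auto simp: j_def mate_def elim!: evenE oddE)
  have si: "star i = Suc i" using i(2) sx x(4) by auto
  have ij: "Suc i < j" using x(1) by (simp add: i_def j_def)
  have jq: "j \<le> q" "j < k" using j(2) x(2) by auto
  have ik: "i < k" "Suc i < k" using ij jq by auto
  have dxi: "d x = d (mate x)" using d_star[OF m(4)] sx by simp
  have di: "d i = d q" using i(2) dxi x(3) by auto
  have dj: "d j = d i" using d_antimono[of i j] d_antimono[of j q] jq ij x(2) di by simp
  have sj: "star j = Suc j" using star_pair_aligned[OF i(1) si j(1) _ jq(2) dj] ij by simp
  have sq: "star q = mate q" using j(2) sj star_star[OF jq(2)] by auto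
  have odd: "odd (d q)" using star_fixed[OF ik(1)] si di by simp
  have "- (A q * f q x s) = (- 1) ^ s * (A x * f x q s)"
    using eq_rel[of x q] x m sq odd by (simp add: mate_simps)
  also have "\<dots> = - (A x * f q x s)"
    using f_skew[of x q s] by (simp add: algebra_simps flip: power_add mult_2)
  finally have "(A q - A x) * f q x s = 0" by (simp add: left_diff_distrib)
  moreover have "A q = A j" using j(2) A_pair[OF jq(2) j(1) sj] by auto
  moreover have "A x = A i" using i(2) A_pair[OF ik(1) i(1) si] by auto
  moreover have "A i \<noteq> A j" using A_distinct[OF ik(1) jq(2) i(1) j(1) _ si sj] ij by simp
  ultimately have "f q x s = 0" by simp
  then show ?thesis using swap_zero by blast
qed

text \<open>In the chained case transport moves \<open>x\<close> two places to the left and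
  \<open>q\<close> two places to the left or right, depending on its parity. The induction ends
  because index \<open>0\<close> cannot be dual to an index on its left.\<close>

lemma cross_odd:
  assumes "odd x" "x div 2 < q div 2" "q < k"
  shows "f x q s = 0"
  using assms
proof (induction x arbitrary: q rule: less_induct)
  case (less x)
  have m: "mate x < q" "x < q" "mate x < k" "x < k"
    using cross_between[OF less.prems(2)] less.prems(3) by auto
  have mx: "mate x = x - 1" "even (x - 1)" "0 < x" using less.prems(1) by (auto simp: mate_def elim: oddE)
  have "d q \<le> d (mate x)" using d_antimono[of "mate x" q] m less.prems by simp
  then consider "d q < d (mate x)" | "d (mate x) = d q" by linarith
  then show ?case
  proof cases
    case 1
    then show ?thesis using less_zero m less.prems by blast
  next
    case eq: 2
    from m(3) show ?thesis
    proof (cases rule: star_cases[of "mate x"])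
      case 1
      then show ?thesis using cross_fixed less.prems eq by blast
    next
      case 2
      then have "star (mate x) = x" using mx by simp
      then show ?thesis using cross_pair less.prems eq by blast
    next
      case 3
      have x2: "star (mate x) = x - 2" "2 < x"
        using 3 mx less.prems(1) by (auto elim!: oddE)
      have chain: "star j = j - 1" if "even j" "mate x \<le> j" "j \<le> q" for j
      proof (rule star_chain_aligned[of "mate x" j])
        show "d j = d (mate x)" using d_antimono[of "mate x" j] d_antimono[of j q] that eq less.prems by simp
      qed (use 3 mx that less.prems in auto)
      have "f (mate (star q)) (x - 2) s = 0"
      proof (cases "even q")
        case True
        then have "star q = q - 1" using chain m by simp
        moreover have "odd (q - 1)" using True m by auto
        ultimately have "mate (star q) = q - 2" using mate_simps(2)[of "q - 1"] by simp
        moreover have "f (x - 2) (q - 2) s = 0"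
          using less.prems x2 pair_index_shift(1)[of x q] by (intro less.IH) auto
        ultimately show ?thesis using swap_zero by simp
      next
        case False
        then have q1: "even (q - 1)" "mate x \<le> q - 1" "q - 1 < k" "2 \<le> q"
          using m less.prems by (auto elim!: oddE)
        then have s1: "star (q - 1) = q - 2" using chain[of "q - 1"] by (simp add: numeral_2_eq_2)
        have "odd (d q)" using 3(3) eq by simp
        with less.prems(3) have sq: "star q = Suc q" "Suc q < k"
          using s1 q1 by (cases rule: star_cases[of q]; force)+
        then have ms: "mate (star q) = Suc (Suc q)" using False by (simp add: mate_def)
        show ?thesis
        proof (cases "Suc (Suc q) = k")
          case True
          then show ?thesis using ms f_null by simp
        next
          case False
          then have "f (x - 2) (Suc (Suc q)) s = 0"
            using less.prems x2 sq pair_index_shift(2)[of x q] by (intro less.IH) auto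
          then show ?thesis using ms swap_zero by simp
        qed
      qed
      then show ?thesis using eq_zero[of x q] m less.prems eq x2 by simp
    qed
  qed
qed

lemma star_chain_right:
  assumes "odd i" "star i = Suc i" "i < k" "i \<le> q" "q < k" "d q = d i"
  shows "even q \<Longrightarrow> star q = q - 1" "odd q \<Longrightarrow> star q = Suc q \<and> Suc q < k"
proof -
  have si: "star (Suc i) = i" "Suc i < k" "d (Suc i) = d i"
    using star_star[OF assms(3)] star_less[OF assms(3)] d_star[OF assms(3)] assms(2) by auto
  have chain: "star j = j - 1" if "even j" "i \<le> j" "j \<le> q" for j
  proof (rule star_chain_aligned[of "Suc i" j])
    show "Suc i \<le> j" using that assms(1) by (metis le_neq_implies_less Suc_leI)
    show "d j = d (Suc i)" using d_antimono[of i j] d_antimono[of j q] that assms si by simp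
  qed (use si that assms in auto)
  show "even q \<Longrightarrow> star q = q - 1" using chain assms by simp
  assume oq: "odd q"
  have "odd (d q)" using star_fixed[OF assms(3)] assms(2,6) by simp
  with assms(5) show "star q = Suc q \<and> Suc q < k"
  proof (cases rule: star_cases[of q])
    case 3
    show ?thesis
    proof (cases "i = q")
      case False
      then have "i \<le> q - 1" using assms by simp
      then have "star (q - 1) = q - 2" using chain[of "q - 1"] oq by auto
      then show ?thesis using 3 by simp
    qed (use assms si in auto)
  qed auto
qed

text \<open>In the chained case both indices move two places to the right; at the latest, the path
  ends when \<open>q\<close> reaches \<open>k\<close>.\<close>

lemma cross_even_odd:
  assumes "even x" "odd q" "x div 2 < q div 2" "q < k"
  shows "f x q s = 0"
  using assms
proof (induction "k - q" arbitrary: x q rule: less_induct)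
  case (less q x)
  note prems = less.prems
  have m: "mate x < q" "x < q" "mate x < k" "x < k"
    using cross_between[OF prems(3)] prems(4) by auto
  have mx: "mate x = Suc x" using prems(1) by (simp add: mate_def)
  have "d q \<le> d (mate x)" using d_antimono[of "mate x" q] m prems by simp
  then consider "d q < d (mate x)" | "d (mate x) = d q" by linarith
  then show ?case
  proof cases
    case 1
    then show ?thesis using less_zero m prems by blast
  next
    case eq: 2
    from m(3) show ?thesis
    proof (cases rule: star_cases[of "mate x"])
      case 1
      then show ?thesis using cross_fixed prems eq by blast
    next
      case 3
      then have "star (mate x) = x" using mx by simp
      then show ?thesis using cross_pair prems eq by blast
    next
      case 2
      have q: "star q = Suc q" "Suc q < k"
        using star_chain_right(2)[of "Suc x" q] 2 mx m prems eq by auto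
      then have ms: "mate (star q) = Suc (Suc q)" using prems(2) by (simp add: mate_def)
      have "f (Suc (Suc q)) (Suc (Suc x)) s = 0"
      proof (cases "Suc (Suc q) = k")
        case True
        then show ?thesis using f_null by simp
      next
        case False
        then have "f (Suc (Suc x)) (Suc (Suc q)) s = 0"
          using prems q by (intro less.hyps) auto
        then show ?thesis using swap_zero by blast
      qed
      then show ?thesis using eq_zero[of x q] m prems eq 2 mx ms by simp
    qed
  qed
qed

text \<open>In the chained case \<open>x\<close> moves right and \<open>q\<close> moves left. The
  indices meet on the diagonal or come to a distance of two, and these two situations are exactly
  what the sources at even indices and \<open>chain_zero\<close> settle.\<close>

lemma cross_even_even:
  assumes "even x" "even q" "x div 2 < q div 2" "q < k"
  shows "f x q s = 0"
  using assms
proof (induction "q - x" arbitrary: x q rule: less_induct)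
  case (less x q)
  note prems = less.prems
  have m: "mate x < q" "x < q" "mate x < k" "x < k"
    using cross_between[OF prems(3)] prems(4) by auto
  have mx: "mate x = Suc x" using prems(1) by (simp add: mate_def)
  have "d q \<le> d (mate x)" using d_antimono[of "mate x" q] m prems by simp
  then consider "d q < d (mate x)" | "d (mate x) = d q" by linarith
  then show ?case
  proof cases
    case 1
    then show ?thesis using less_zero m prems by blast
  next
    case eq: 2
    from m(3) show ?thesis
    proof (cases rule: star_cases[of "mate x"])
      case 1
      then show ?thesis using cross_fixed prems eq by blast
    next
      case 3
      then have "star (mate x) = x" using mx by simp
      then show ?thesis using cross_pair prems eq by blast
    next
      case 2
      have q: "star q = q - 1"
        using star_chain_right(1)[of "Suc x" q] 2 mx m prems eq by auto
      have "odd (q - 1)" using prems(2) m by auto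
      then have ms: "mate (star q) = q - 2" using q mate_simps(2)[of "q - 1"] by simp
      have "f (q - 2) (Suc (Suc x)) s = 0"
      proof -
        consider "q = Suc (Suc x)" | "q = Suc (Suc (Suc (Suc x)))" | "Suc (Suc (Suc (Suc x))) < q"
          using m prems mx by (metis Suc_lessI even_Suc)
        then show ?thesis
        proof cases
          case 1
          then show ?thesis using chain_zero[of x] swap_zero prems \<open>star (mate x) = Suc (mate x)\<close> mx by simp
        next
          case 2
          then show ?thesis using diag_even[of "Suc (Suc x)"] prems by simp
        next
          case 3
          then have "Suc (Suc x) div 2 < (q - 2) div 2" using prems(1,2) by presburger
          with 3 have "f (Suc (Suc x)) (q - 2) s = 0"
            using prems by (intro less.hyps) auto
          then show ?thesis using swap_zero by blast
        qed
      qed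
      then show ?thesis using eq_zero[of x q] m prems eq 2 mx ms by simp
    qed
  qed
qed

lemma cross_zero:
  assumes "x div 2 < q div 2" "q < k"
  shows "f x q s = 0"
  using assms cross_odd cross_even_odd cross_even_even by blast

text \<open>Inside a self-linked pair the \<open>A\<close> terms disappear by skewness. The equation
  is therefore taken one exponent lower, where it exposes its \<open>C\<close> terms at exponent
  \<open>s\<close>; this is what the corrective term of the functional is for.\<close>

lemma lossy_relations:
  assumes "even x" "x < k" "star x = Suc x"
  shows "odd s \<Longrightarrow> f x (Suc x) s = 0" "odd s \<Longrightarrow> f (Suc x) (Suc x) s = 0"
proof -
  assume s: "odd s"
  then obtain s' where s': "s = Suc s'" "even s'" by (auto elim!: oddE)
  have k: "Suc x < k" "star (Suc x) = x" "d (Suc x) = d x"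
    using star_less[OF assms(2)] star_star[OF assms(2)] d_star[OF assms(2)] assms(3) by auto
  have odd: "odd (d x)" using star_fixed[OF assms(2)] assms(3) by simp
  have m: "mate (Suc x) = x" "mate x = Suc x" using assms(1) by (auto simp: mate_def)
  note C0 = C_zero[OF k(1)]
  show "f x (Suc x) s = 0"
  proof -
    \<comment> \<open>With \<open>p = q = x\<close> both sides are the same expression, but with
      opposite signs because \<open>d x\<close> is odd and \<open>s'\<close> is even.\<close>
    have "- (A x * f x x s' + C x * f (Suc x) x s) = A x * f x x s' + C x * f (Suc x) x s"
      using stabiliser_eq[of x x "s' + d x"] assms m odd s' by simp
    then have "A x * f x x s' + C x * f (Suc x) x s = 0" by (intro self_neg_zero) simp
    then have "C x * f (Suc x) x s = 0" using f_even_diag s' by simp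
    then show ?thesis using C_nonzero[OF assms(2,1,3)] swap_zero by auto
  qed
  show "f (Suc x) (Suc x) s = 0"
  proof -
    have "- (A x * f (Suc x) x s') = A x * f x (Suc x) s' + C x * f (Suc x) (Suc x) s"
      using stabiliser_eq[of x "Suc x" "s' + d x"] assms m odd s' k C0 A_pair[OF assms(2,1,3)] by simp
    moreover have "f x (Suc x) s' = - f (Suc x) x s'" using f_skew[of x "Suc x" s'] s' by simp
    ultimately have "C x * f (Suc x) (Suc x) s = 0" by simp
    then show ?thesis using C_nonzero[OF assms(2,1,3)] by simp
  qed
qed

text \<open>If \<open>Suc x\<close> is dual to the next index, transport leads to the next mated
  pair on the right. If \<open>Suc x\<close> is self-dual or dual to \<open>x\<close>, even
  exponents are sources, and odd ones die by a sign or by the corrective term respectively.\<close>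

lemma pair_zero:
  assumes "even x" "Suc x < k"
  shows "f x (Suc x) s = 0"
  using assms
proof (induction "k - x" arbitrary: x rule: less_induct)
  case less
  have m: "mate x = Suc x" "x < k" using less.prems by (auto simp: mate_def)
  have high: "f x (Suc x) s = 0" if "d (Suc x) < s"
    using f_high[OF less.prems(2) that] swap_zero by blast
  from less.prems(2) show ?case
  proof (cases rule: star_cases[of "Suc x"])
    case 1
    show ?thesis
    proof (cases "even s")
      case True
      then show ?thesis using high source_pair[of x s] less.prems 1 by (cases "s \<le> d (Suc x)") auto
    next
      case False
      have "A (Suc x) * f x (Suc x) s = - (A (Suc x) * f x (Suc x) s)"
        using eq_rel[of x "Suc x"] m 1 less.prems False by (simp add: mate_Suc)
      then have "A (Suc x) * f x (Suc x) s = 0" by (rule self_neg_zero)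
      then show ?thesis using A_nonzero less.prems by simp
    qed
  next
    case 2
    then have ms: "mate (Suc (Suc x)) = Suc (Suc (Suc x))" using less.prems by (simp add: mate_def)
    have "f (Suc (Suc (Suc x))) (Suc (Suc x)) s = 0"
    proof (cases "Suc (Suc (Suc x)) = k")
      case True
      then show ?thesis using f_null by simp
    next
      case False
      then have "f (Suc (Suc x)) (Suc (Suc (Suc x))) s = 0"
        using less.prems 2 by (intro less.hyps) auto
      then show ?thesis using swap_zero by blast
    qed
    then show ?thesis using eq_zero[of x "Suc x"] m less.prems 2 ms by simp
  next
    case 3
    then have st: "star (Suc x) = x" "star x = Suc x" by auto
    show ?thesis
    proof (cases "even s")
      case True
      then show ?thesis using high source_pair[of x s] less.prems st by (cases "s \<le> d (Suc x)") auto
    next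
      case False
      then show ?thesis using lossy_relations(1)[of x] less.prems m st by simp
    qed
  qed
qed

text \<open>Unless a length drop or the corrective term settles it directly, transport sends this
  diagonal coefficient to the diagonal at \<open>x - 1\<close> or to a pair of indices on either
  side of \<open>x\<close>.\<close>

lemma diag_odd:
  assumes "odd x" "x < k"
  shows "f x x s = 0"
proof -
  have m: "mate x = x - 1" "even (x - 1)" "0 < x" "x - 1 < k" "mate (x - 1) = x"
    using assms by (auto simp: mate_def elim: oddE)
  have "d x \<le> d (x - 1)" using d_antimono[of "x - 1" x] assms by simp
  then consider "d x < d (x - 1)" | "d (x - 1) = d x" by linarith
  then show ?thesis
  proof cases
    case 1
    then show ?thesis using less_zero[of x x] m assms by simp
  next
    case eq: 2
    from m(4) show ?thesis
    proof (cases rule: star_cases[of "x - 1"])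
      case 1
      then have "star x = x" using star_fixed[OF assms(2)] eq by simp
      then show ?thesis using eq_zero[of x x] m assms eq 1 diag_even[of "x - 1"] by simp
    next
      case 2
      then have "star (x - 1) = Suc (x - 1)" by simp
      from lossy_relations(2)[OF m(2,4) this] f_even_diag m show ?thesis by (cases "even s") auto
    next
      case 3
      have x2: "star (x - 1) = x - 2" "2 < x" using 3 assms(1) by (auto elim!: oddE)
      have odd: "odd (d x)" using 3(3) eq by simp
      have sx: "star x = Suc x \<and> Suc x < k"
      proof (rule star_cases[OF assms(2)])
        assume "star (x - 1) = x"
        then show ?thesis using x2 by simp
      qed (use odd in auto)
      then have ms: "mate (star x) = Suc (Suc x)" using assms by (simp add: mate_def)
      have "f (Suc (Suc x)) (x - 2) s = 0"
      proof (cases "Suc (Suc x) = k")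
        case True
        then show ?thesis using f_null by simp
      next
        case False
        then have "f (x - 2) (Suc (Suc x)) s = 0"
          using sx x2 assms by (intro cross_zero) auto
        then show ?thesis using swap_zero by blast
      qed
      then show ?thesis using eq_zero[of x x] m assms eq ms x2 by simp
    qed
  qed
qed

lemma level_zero:
  assumes "u < k" "v < k"
  shows "f u v s = 0"
proof -
  have wlog: "f u v s = 0" if "u \<le> v" "v < k" for u v
  proof (cases "u div 2 < v div 2")
    case True
    then show ?thesis using cross_zero that by simp
  next
    case False
    then have "u div 2 = v div 2" using div_le_mono[OF that(1), of 2] by linarith
    then have "u = v \<or> (even u \<and> v = Suc u)"
      using that(1) by presburger
    then show ?thesis using diag_even diag_odd pair_zero that by blast
  qed
  show ?thesis using wlog[of u v] wlog[of v u] assms swap_zero by (cases "u \<le> v") auto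
qed

end

context stabiliser_equations
begin

theorem all_zero:
  assumes "u < k" "v < k"
  shows "f u v s = 0"
proof -
  have "\<forall>s u v. d 0 < s + t \<longrightarrow> u < k \<longrightarrow> v < k \<longrightarrow> f u v s = 0" for t
  proof (induction t)
    case 0
    then show ?case using f_high d_antimono[of 0] by (metis add_0_right le_less_trans zero_le)
  next
    case (Suc t)
    show ?case
    proof (intro allI impI)
      fix s u v assume s: "d 0 < s + Suc t" and uv: "u < k" "v < k"
      interpret stabiliser_equations_level k d star A C f s
        by unfold_locales (use Suc s in auto)
      show "f u v s = 0" by (rule level_zero[OF uv])
    qed
  qed
  from this[of "Suc (d 0)"] show ?thesis using assms by simp
qed

end

subsection \<open>A functional with small stabiliser\<close>

lemma finite_power_fibre:
  fixes c v :: "'k::field"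
  assumes "c \<noteq> 0" "m = 1 \<or> m = 2"
  shows "finite {t. c * t ^ m = v}" "card {t. c * t ^ m = v} \<le> 2"
proof -
  have "\<exists>a b. {t. c * t ^ m = v} \<subseteq> {a, b}"
  proof (cases "\<exists>a. c * a ^ m = v")
    case True
    then obtain a where a: "c * a ^ m = v" by blast
    have "t = a \<or> t = - a" if "c * t ^ m = v" for t
    proof -
      have "t ^ m = a ^ m" using a that assms(1) by (metis mult_left_cancel)
      then show ?thesis using assms(2) by (auto simp: power2_eq_iff)
    qed
    then show ?thesis by blast
  qed blast
  then obtain a b where ab: "{t. c * t ^ m = v} \<subseteq> {a, b}" by blast
  show "finite {t. c * t ^ m = v}" using ab finite_subset by blast
  have "card {t. c * t ^ m = v} \<le> card {a, b}" using ab by (intro card_mono) auto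
  also have "\<dots> \<le> 2" by (simp add: card_insert_if)
  finally show "card {t. c * t ^ m = v} \<le> 2" .
qed

text \<open>Greedy choice: the next scalar has to avoid \<open>0\<close> and at most two roots for
  each of the \<open>h\<close> earlier ones, hence at most \<open>2 * h + 1\<close> elements, fewer
  than \<open>2 * Suc h\<close>. Exponent \<open>2\<close> is needed because a mated pair of
  self-dual chains yields a quantity quadratic in the scalar.\<close>

lemma exists_distinct_scaled_powers:
  fixes c :: "nat \<Rightarrow> 'k::field" and m :: "nat \<Rightarrow> nat"
  assumes "\<And>j. c j \<noteq> 0" "\<And>j. m j = 1 \<or> m j = 2"
    and "finite (UNIV :: 'k set) \<longrightarrow> 2 * h \<le> card (UNIV :: 'k set)"
  shows "\<exists>y :: nat \<Rightarrow> 'k. \<forall>j<h. y j \<noteq> 0 \<and> (\<forall>i<j. c i * y i ^ m i \<noteq> c j * y j ^ m j)"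
  using assms(3)
proof (induction h)
  case (Suc h)
  then obtain y where y: "\<forall>j<h. y j \<noteq> 0 \<and> (\<forall>i<j. c i * y i ^ m i \<noteq> c j * y j ^ m j)" by auto
  define X where "X = insert 0 (\<Union>i<h. {t. c h * t ^ m h = c i * y i ^ m i})"
  have finX: "finite X" using finite_power_fibre[OF assms(1,2)] by (simp add: X_def)
  have "card X \<le> Suc (card (\<Union>i<h. {t. c h * t ^ m h = c i * y i ^ m i}))"
    unfolding X_def by (rule card_insert_le_m1) auto
  also have "card (\<Union>i<h. {t. c h * t ^ m h = c i * y i ^ m i}) \<le> (\<Sum>i<h. card {t. c h * t ^ m h = c i * y i ^ m i})"
    by (rule card_UN_le) simp
  also have "\<dots> \<le> (\<Sum>i<h. 2)" by (intro sum_mono finite_power_fibre(2) assms)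
  finally have "card X \<le> Suc (2 * h)" by simp
  then have "X \<noteq> UNIV" using finX Suc.prems by auto
  then obtain t where t: "t \<notin> X" by blast
  have "(y(h := t)) j \<noteq> 0 \<and> (\<forall>i<j. c i * (y(h := t)) i ^ m i \<noteq> c j * (y(h := t)) j ^ m j)"
    if "j < Suc h" for j
  proof (cases "j = h")
    case True
    have "t \<noteq> 0" "\<And>i. i < h \<Longrightarrow> c h * t ^ m h \<noteq> c i * y i ^ m i" using t by (auto simp: X_def)
    then show ?thesis using True by force
  next
    case False
    then show ?thesis using that y by simp
  qed
  then show ?case by blast
qed simp

lemma sum_even_odd_pairs: "(\<Sum>v<2 * h. G v) = (\<Sum>j<h. G (2 * j) + G (Suc (2 * j)))"
  for G :: "nat \<Rightarrow> 'k::comm_monoid_add"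
  by (induction h) (simp_all add: add.assoc)

lemma sum_mates: "(\<Sum>v<k. if mate v < k then G v else 0) = (\<Sum>j<k div 2. G (2 * j) + G (Suc (2 * j)))"
  for G :: "nat \<Rightarrow> 'k::comm_monoid_add"
proof -
  have "(\<Sum>v<k. if mate v < k then G v else 0) = (\<Sum>v<2 * (k div 2). G v)"
  proof (rule sum.mono_neutral_cong_right)
    show "\<forall>i\<in>{..<k} - {..<2 * (k div 2)}. (if mate i < k then G i else 0) = 0"
    proof
      fix i assume "i \<in> {..<k} - {..<2 * (k div 2)}"
      then have "i < k" "2 * (k div 2) \<le> i" by auto
      then have "even i" "k = Suc i" by presburger+
      then show "(if mate i < k then G i else 0) = 0" by (simp add: mate_def)
    qed
    fix v assume v: "v \<in> {..<2 * (k div 2)}"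
    then have "mate v < k" by (auto simp: mate_def elim!: evenE)
    then show "(if mate v < k then G v else 0) = G v" by simp
  qed auto
  then show ?thesis by (simp add: sum_even_odd_pairs)
qed

lemma card_even_le: "card {s. s \<le> n \<and> even s} = Suc (n div 2)"
proof -
  have "{s. s \<le> n \<and> even s} = (\<lambda>i. 2 * i) ` {..n div 2}" by (auto elim!: evenE)
  then show ?thesis by (simp add: card_image inj_on_def)
qed

lemma card_odd_le: "card {s. s \<le> n \<and> odd s} = Suc n div 2"
proof -
  have "{s. s \<le> n \<and> odd s} = (\<lambda>i. Suc (2 * i)) ` {..<Suc n div 2}" by (auto elim!: oddE)
  then show ?thesis by (simp add: card_image inj_on_def)
qed

text \<open>\<open>\<delta> v\<close> is twice the number of sources at \<open>v\<close> minus
  \<open>Suc (d v)\<close>. It vanishes on dual pairs, which occupy two adjacent positions, so its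
  nonzero values, at the self-dual chains, alternate between \<open>- 1\<close> and \<open>1\<close>
  starting with \<open>- 1\<close>; the total is \<open>0\<close> or \<open>- 1\<close>.\<close>

lemma source_count_le:
  fixes d star :: "nat \<Rightarrow> nat"
  assumes less: "\<And>i. i < k \<Longrightarrow> star i < k"
    and inv: "\<And>i. i < k \<Longrightarrow> star (star i) = i"
    and adj: "\<And>i. i < k \<Longrightarrow> star i \<le> Suc i \<and> i \<le> Suc (star i)"
    and ds: "\<And>i. i < k \<Longrightarrow> d (star i) = d i"
    and fixed: "\<And>i. i < k \<Longrightarrow> star i = i \<longleftrightarrow> even (d i)"
  shows "2 * (\<Sum>v<k. card {s. s \<le> d v \<and> (odd s \<longleftrightarrow> even v \<or> star v = Suc v)}) \<le> (\<Sum>v<k. Suc (d v))"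
proof -
  define \<delta> :: "nat \<Rightarrow> int" where "\<delta> v = (if odd (d v) then 0 else if even v then - 1 else 1)" for v
  have card: "2 * int (card {s. s \<le> d v \<and> (odd s \<longleftrightarrow> even v \<or> star v = Suc v)}) = int (Suc (d v)) + \<delta> v"
    if "v < k" for v
  proof (cases "even v \<or> star v = Suc v")
    case True
    then have c: "card {s. s \<le> d v \<and> (odd s \<longleftrightarrow> even v \<or> star v = Suc v)} = Suc (d v) div 2"
      by (simp add: card_odd_le)
    show ?thesis
    proof (cases "even (d v)")
      case True
      then obtain m where m: "d v = 2 * m" by (rule evenE)
      have "even v" using True \<open>even v \<or> star v = Suc v\<close> fixed[OF that] by auto
      then show ?thesis unfolding c by (simp add: \<delta>_def m)
    next
      case False
      then obtain m where m: "d v = 2 * m + 1" by (rule oddE)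
      show ?thesis unfolding c by (simp add: \<delta>_def m)
    qed
  next
    case False
    then have c: "card {s. s \<le> d v \<and> (odd s \<longleftrightarrow> even v \<or> star v = Suc v)} = Suc (d v div 2)"
      by (simp add: card_even_le)
    show ?thesis
    proof (cases "even (d v)")
      case True
      then obtain m where m: "d v = 2 * m" by (rule evenE)
      show ?thesis unfolding c using False by (simp add: \<delta>_def m)
    next
      case odd: False
      then obtain m where m: "d v = 2 * m + 1" by (rule oddE)
      show ?thesis unfolding c by (simp add: \<delta>_def m)
    qed
  qed
  have sum: "(\<Sum>v<i. \<delta> v) = (if even i then 0 else - 1)"
    if "i \<le> k" "i = 0 \<or> star (i - 1) \<noteq> i" for i
    using that
  proof (induction i rule: less_induct)
    case (less i)
    show ?case
    proof (cases "i = 0")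
      case False
      define v where "v = i - 1"
      have v: "i = Suc v" "v < k" "star v \<noteq> Suc v" using less.prems False by (auto simp: v_def)
      show ?thesis
      proof (cases "star v = v")
        case True
        have "v = 0 \<or> star (v - 1) \<noteq> v" using inv[of "v - 1"] True v(2) by (cases v) auto
        then have "(\<Sum>v<v. \<delta> v) = (if even v then 0 else - 1)"
          using v less.prems by (intro less.IH) auto
        moreover have "even (d v)" using fixed[OF v(2)] True by simp
        ultimately show ?thesis by (auto simp: v(1) \<delta>_def)
      next
        case False
        then have sv: "0 < v" "star v = v - 1" using adj[OF v(2)] v(3) by auto
        then obtain u where u: "v = Suc u" by (cases v) auto
        have uk: "u < k" "star v = u" "star u = v" using u v(2) sv inv[OF v(2)] by auto
        have od: "odd (d v)" "odd (d u)" using fixed[OF v(2)] False ds[OF v(2)] uk by auto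
        have "u = 0 \<or> star (u - 1) \<noteq> u" using inv[of "u - 1"] uk by (cases u) (auto simp: u)
        then have "(\<Sum>v<u. \<delta> v) = (if even u then 0 else - 1)"
          using v u less.prems by (intro less.IH) auto
        then show ?thesis using od by (simp add: v(1) u \<delta>_def)
      qed
    qed simp
  qed
  have "(\<Sum>v<k. \<delta> v) \<le> 0"
    using sum[of k] less[of "k - 1"] by (cases "k = 0") auto
  moreover have "2 * int (\<Sum>v<k. card {s. s \<le> d v \<and> (odd s \<longleftrightarrow> even v \<or> star v = Suc v)})
      = (\<Sum>v<k. int (Suc (d v)) + \<delta> v)"
    by (simp add: sum_distrib_left card del: of_nat_Suc)
  ultimately have "2 * int (\<Sum>v<k. card {s. s \<le> d v \<and> (odd s \<longleftrightarrow> even v \<or> star v = Suc v)})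
      \<le> int (\<Sum>v<k. Suc (d v))"
    by (simp add: sum.distrib)
  then show ?thesis by linarith
qed

section \<open>Comparison with the Jordan blocks, and elements of the centraliser built from two
  chains\<close>

context orthogonal_space
begin

lemma centraliser_iff:
  "x \<in> lie_centraliser commutator (so scale B) e \<longleftrightarrow> x \<in> so scale B \<and> (\<forall>v. x (e v) = e (x v))"
  by (auto simp: lie_centraliser_def commutator_def fun_eq_iff)

text \<open>Both numbers are compared with the dimension of the kernel of \<open>e\<close>. The
  generators of the given Jordan basis separate its points, since the kernel is orthogonal to the
  image of \<open>e\<close>; the last vectors of the adapted chains are independent elements of
  it.\<close>

lemma adapted_family_card_le_jordan_blocks:
  assumes e: "e \<in> so scale B" and a: "adapted_family e k w d star"
    and J: "nilpotent_jordan_blocks scale e k0"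
  shows "k \<le> k0"
proof -
  note le = linD[OF so_lin[OF e]]
  define R where "R = {v. e v = 0}"
  have R: "subspace R" by (rule subspaceI) (auto simp: R_def le)
  obtain u and d0 :: "nat \<Rightarrow> nat" where
    sp: "span ((\<lambda>(i, s). (e ^^ s) (u i)) ` (SIGMA i:{..<k0}. {..d0 i})) = UNIV"
    using J by (auto simp: nilpotent_jordan_blocks_def Let_def)
  have sep: "x = 0" if x: "x \<in> R" and z: "\<And>i. i \<in> {..<k0} \<Longrightarrow> B x (u i) = 0" for x
  proof (rule nondegenerate)
    fix v
    have "v \<in> span ((\<lambda>(i, s). (e ^^ s) (u i)) ` (SIGMA i:{..<k0}. {..d0 i}))" using sp by simp
    then show "B x v = 0"
    proof (induction rule: span_induct_alt)
      case (step c b v)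
      then obtain i s where b: "b = (e ^^ s) (u i)" "i < k0" by auto
      have "B x b = 0"
      proof (cases s)
        case 0
        then show ?thesis using b z by simp
      next
        case (Suc s')
        have "B x (e ((e ^^ s') (u i))) = - B (e x) ((e ^^ s') (u i))" by (simp add: so_skew[OF e])
        then show ?thesis using b x Suc by (simp add: R_def B_simps)
      qed
      then show ?case using step by (simp add: B_simps)
    qed (simp add: B_simps)
  qed
  have "dim R \<le> card {..<k0}"
    by (rule dim_le_separating_functionals(1)[where \<phi> = "\<lambda>i x. B x (u i)"])
      (use R sep in \<open>auto simp: B_simps\<close>)
  moreover have "card {..<k} \<le> dim R"
  proof (rule card_le_dim_independent_family[where x = "\<lambda>i. (e ^^ d i) (w i)"])
    show "fin_dim_subspace R" by (rule fin_dim_subspace_mono[OF fin_dim_UNIV R]) simp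
    show "(e ^^ d j) (w j) \<in> R" if "j \<in> {..<k}" for j
      using adapted_familyD(7)[OF a] that by (simp add: R_def)
    fix c j assume s: "(\<Sum>j<k. scale (c j) ((e ^^ d j) (w j))) = 0" and j: "j \<in> {..<k}"
    then have jk: "j < k" by simp
    note D = adapted_familyD[OF a]
    have "(\<Sum>i<k. c i * B ((e ^^ d i) (w i)) (w (star j))) = B 0 (w (star j))"
      unfolding s[symmetric] by (simp add: B_sum B_simps)
    moreover have "(\<Sum>i<k. c i * B ((e ^^ d i) (w i)) (w (star j)))
        = (\<Sum>i\<in>{j}. c i * B ((e ^^ d i) (w i)) (w (star j)))"
    proof (rule sum.mono_neutral_right)
      show "\<forall>i\<in>{..<k} - {j}. c i * B ((e ^^ d i) (w i)) (w (star j)) = 0"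
      proof
        fix i assume i: "i \<in> {..<k} - {j}"
        then have "star j \<noteq> star i" using D(2)[of i] D(2)[OF jk] by force
        then show "c i * B ((e ^^ d i) (w i)) (w (star j)) = 0"
          using adapted_family_gram0[OF a, of i "star j" "d i"] i D(1)[OF jk] by auto
      qed
    qed (use jk in auto)
    ultimately have "c j * B ((e ^^ d j) (w j)) (w (star j)) = 0" by (simp add: B_simps)
    then show "c j = 0" using adapted_family_gram0[OF a jk D(1)[OF jk], of "d j"] by simp
  qed simp
  ultimately show ?thesis by simp
qed

text \<open>An alternating sum of the elementary skew maps of \<open>(e ^^ (N - i)) u\<close> and
  \<open>(e ^^ i) u'\<close>. The signs make the commutator with \<open>e\<close> telescope, and the
  end terms vanish if \<open>e ^^ Suc N\<close> kills both vectors. These maps are the test elements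
  for the stabiliser.\<close>

definition chain_map ::
  "('v \<Rightarrow> 'v) \<Rightarrow> 'v \<Rightarrow> 'v \<Rightarrow> nat \<Rightarrow> 'v \<Rightarrow> 'v" where
  "chain_map e u u' N x = (\<Sum>i\<le>N. scale ((- 1) ^ i)
     (scale (B x ((e ^^ i) u')) ((e ^^ (N - i)) u) - scale (B x ((e ^^ (N - i)) u)) ((e ^^ i) u')))"

lemma chain_map_centraliser:
  assumes e: "e \<in> so scale B" and z: "(e ^^ Suc N) u = 0" "(e ^^ Suc N) u' = 0"
  shows "chain_map e u u' N \<in> lie_centraliser commutator (so scale B) e"
proof -
  note le = linD[OF so_lin[OF e]]
  have lin: "lin (chain_map e u u' N)"
    unfolding chain_map_def
    by (intro lin_sum lin_scale_fun lin_diff_fun lin_B_scale)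
  have skew: "B (chain_map e u u' N x) y = - B x (chain_map e u u' N y)" for x y
    unfolding chain_map_def B_sum sum_negf[symmetric]
    by (rule sum.cong[OF refl]) (simp add: B_simps algebra_simps symmetric[of _ y])
  have comm: "chain_map e u u' N (e x) = e (chain_map e u u' N x)" for x
  proof -
    have tel: "(\<Sum>i\<le>N. g (Suc i) (N - i)) + g 0 (Suc N) = (\<Sum>i\<le>N. g i (Suc N - i)) + g (Suc N) 0"
      for g :: "nat \<Rightarrow> nat \<Rightarrow> 'v"
    proof -
      have "(\<Sum>i\<le>Suc N. g i (Suc N - i)) = g 0 (Suc N) + (\<Sum>i\<le>N. g (Suc i) (N - i))"
        by (subst sum.atMost_Suc_shift) simp
      then show ?thesis by (simp add: add.commute)
    qed
    define a where "a i j = scale ((- 1) ^ i * B x ((e ^^ i) u')) ((e ^^ j) u)" for i j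
    define b where "b i j = scale ((- 1) ^ i * B x ((e ^^ j) u)) ((e ^^ i) u')" for i j
    have "e (chain_map e u u' N x) = (\<Sum>i\<le>N. a i (Suc N - i)) + (\<Sum>i\<le>N. b (Suc i) (N - i))"
      unfolding chain_map_def le(6) sum.distrib[symmetric]
      by (rule sum.cong[OF refl])
        (simp add: le a_def b_def Suc_diff_le scale_right_diff_distrib)
    moreover have "chain_map e u u' N (e x) = (\<Sum>i\<le>N. a (Suc i) (N - i)) + (\<Sum>i\<le>N. b i (Suc N - i))"
      unfolding chain_map_def sum.distrib[symmetric]
      by (rule sum.cong[OF refl])
        (simp add: so_skew[OF e] a_def b_def Suc_diff_le scale_right_diff_distrib)
    moreover have "a 0 (Suc N) = 0" "a (Suc N) 0 = 0" "b 0 (Suc N) = 0" "b (Suc N) 0 = 0"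
      using z by (simp_all add: a_def b_def B_simps)
    ultimately show ?thesis using tel[of a] tel[of b] by simp
  qed
  show ?thesis unfolding centraliser_iff so_iff using lin skew comm by blast
qed

end

text \<open>For odd \<open>k\<close> the value \<open>y (k div 2)\<close> is a placeholder: it keeps
  \<open>\<kappa>\<close> nonzero at the unmated last index, where the accompanying coefficient has
  index \<open>k\<close> and is zero.\<close>

locale adapted_space = orthogonal_space scale Basis B
  for scale :: "'k::field \<Rightarrow> 'v::ab_group_add \<Rightarrow> 'v" and Basis :: "'v set"
    and B :: "'v \<Rightarrow> 'v \<Rightarrow> 'k" +
  fixes e :: "'v \<Rightarrow> 'v" and k :: nat and w :: "nat \<Rightarrow> 'v" and d star :: "nat \<Rightarrow> nat"
    and y :: "nat \<Rightarrow> 'k"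
  assumes e_so: "e \<in> so scale B"
    and adapted: "adapted_family e k w d star"
    and perp: "family_perp e k w = {0}"
    and y_nonzero: "j < k div 2 \<Longrightarrow> y j \<noteq> 0" "odd k \<Longrightarrow> y (k div 2) \<noteq> 0"
begin

lemmas node = adapted_familyD[OF adapted]
lemmas node_antimono = adapted_family_antimono[OF adapted]
lemmas gram = adapted_family_gram[OF e_so adapted]
lemmas le = linD[OF so_lin[OF e_so]]

definition \<gamma> :: "nat \<Rightarrow> 'k" where
  "\<gamma> q = B (w (star q)) ((e ^^ d q) (w q))"

text \<open>The weight of \<open>B (x (w (mate v))) (z (w v))\<close> in the functional on
  \<open>commutator x z\<close>; skewness gives the two members of a mated pair opposite
  signs.\<close>

definition \<kappa> :: "nat \<Rightarrow> 'k" where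
  "\<kappa> v = (if even v then - y (v div 2) else y (v div 2))"

text \<open>The second member of a dual pair that is also a mated pair, so that each such pair
  receives one corrective term.\<close>

definition swapped_end :: "nat \<Rightarrow> bool" where
  "swapped_end v \<longleftrightarrow> odd v \<and> Suc (star v) = v"

definition \<alpha> :: "('v \<Rightarrow> 'v) \<Rightarrow> 'k" where
  "\<alpha> x = (\<Sum>j<k div 2. y j * B (x (w (2 * j))) (w (Suc (2 * j)))) +
     (\<Sum>v<k. if swapped_end v then B (x (w v)) (e (w v)) else 0)"

abbreviation centraliser :: "('v \<Rightarrow> 'v) set" where
  "centraliser \<equiv> lie_centraliser commutator (so scale B) e"

lemma \<gamma>_nonzero: "q < k \<Longrightarrow> \<gamma> q \<noteq> 0"
  using gram[of "star q" q 0 "d q"] node[of q] by (simp add: \<gamma>_def)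

lemma \<kappa>_nonzero: "v < k \<Longrightarrow> \<kappa> v \<noteq> 0"
proof -
  assume v: "v < k"
  have "v div 2 < k div 2 \<or> (odd k \<and> v div 2 = k div 2)" using v by presburger
  then show ?thesis using y_nonzero by (auto simp: \<kappa>_def)
qed

lemma \<gamma>_star: "q < k \<Longrightarrow> odd (d q) \<Longrightarrow> \<gamma> (star q) = - \<gamma> q"
proof -
  assume q: "q < k" "odd (d q)"
  have "\<gamma> (star q) = B (w q) ((e ^^ d q) (w (star q)))" using node[OF q(1)] by (simp add: \<gamma>_def)
  also have "\<dots> = B ((e ^^ d q) (w (star q))) (w q)" by (rule symmetric)
  also have "\<dots> = (- 1) ^ d q * B (w (star q)) ((e ^^ d q) (w q))" by (rule so_skew_funpow[OF e_so])
  finally show ?thesis using q(2) by (simp add: \<gamma>_def)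
qed

lemma centraliserD:
  assumes "x \<in> centraliser"
  shows "lin x" "B (x u) v = - B u (x v)" "x (e v) = e (x v)" "x ((e ^^ s) v) = (e ^^ s) (x v)"
proof -
  have x: "x \<in> so scale B" "\<And>v. x (e v) = e (x v)" using assms by (auto simp: centraliser_iff)
  show "lin x" "B (x u) v = - B u (x v)" "x (e v) = e (x v)"
    using so_lin[OF x(1)] so_skew[OF x(1)] x(2) by auto
  show "x ((e ^^ s) v) = (e ^^ s) (x v)" by (induction s arbitrary: v) (auto simp: x(2))
qed

lemma centraliser_eq_zero:
  assumes x: "x \<in> centraliser" and z: "\<And>u v s. u < k \<Longrightarrow> v < k \<Longrightarrow> B (x (w u)) ((e ^^ s) (w v)) = 0"
  shows "x = 0"
proof -
  have w0: "x (w u) = 0" if "u < k" for u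
  proof -
    have "x (w u) \<in> family_perp e k w" using z that by (simp add: family_perp_def)
    then show ?thesis using perp by simp
  qed
  have "x v = 0" for v
  proof -
    have "B (x v) ((e ^^ s) (w u)) = 0" if "u < k" for u s
      using w0[OF that] centraliserD[OF x] linD(4)[OF lin_funpow[OF so_lin[OF e_so]]]
      by (simp add: B_simps)
    then have "x v \<in> family_perp e k w" by (simp add: family_perp_def)
    then show ?thesis using perp by simp
  qed
  then show ?thesis by (simp add: fun_eq_iff)
qed

text \<open>A generator pairs with one power of one chain only, so at most one summand survives in
  each half of the alternating sum.\<close>

lemma chain_map_node:
  assumes "p < k" "q < k" "v < k" "d p \<le> N" "d q \<le> N"
  shows "chain_map e (w p) (w q) N (w v)
    = (if v = star q then scale ((- 1) ^ d q * \<gamma> q) ((e ^^ (N - d q)) (w p)) else 0)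
      - (if v = star p then scale ((- 1) ^ (N - d p) * \<gamma> p) ((e ^^ (N - d p)) (w q)) else 0)"
proof -
  have z: "B (w v) ((e ^^ i) (w r)) = 0" if "r < k" "\<not> (v = star r \<and> i = d r)" for i r
    using gram[of v r 0 i] assms(3) that node[of v] node[of r] by force
  have 1: "(\<Sum>i\<le>N. scale ((- 1) ^ i * B (w v) ((e ^^ i) (w q))) ((e ^^ (N - i)) (w p)))
    = (if v = star q then scale ((- 1) ^ d q * \<gamma> q) ((e ^^ (N - d q)) (w p)) else 0)"
  proof -
    have "(\<Sum>i\<le>N. scale ((- 1) ^ i * B (w v) ((e ^^ i) (w q))) ((e ^^ (N - i)) (w p)))
      = (\<Sum>i\<in>{d q}. scale ((- 1) ^ i * B (w v) ((e ^^ i) (w q))) ((e ^^ (N - i)) (w p)))"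
      by (rule sum.mono_neutral_right) (use assms z in auto)
    then show ?thesis using z[OF assms(2), of "d q"] by (simp add: \<gamma>_def)
  qed
  have 2: "(\<Sum>i\<le>N. scale ((- 1) ^ i * B (w v) ((e ^^ (N - i)) (w p))) ((e ^^ i) (w q)))
    = (if v = star p then scale ((- 1) ^ (N - d p) * \<gamma> p) ((e ^^ (N - d p)) (w q)) else 0)"
  proof -
    have "(\<Sum>i\<le>N. scale ((- 1) ^ i * B (w v) ((e ^^ (N - i)) (w p))) ((e ^^ i) (w q)))
      = (\<Sum>i\<in>{N - d p}. scale ((- 1) ^ i * B (w v) ((e ^^ (N - i)) (w p))) ((e ^^ i) (w q)))"
    proof (rule sum.mono_neutral_right)
      show "\<forall>i\<in>{..N} - {N - d p}. scale ((- 1) ^ i * B (w v) ((e ^^ (N - i)) (w p))) ((e ^^ i) (w q)) = 0"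
      proof
        fix i assume "i \<in> {..N} - {N - d p}"
        then have "N - i \<noteq> d p" by auto
        then show "scale ((- 1) ^ i * B (w v) ((e ^^ (N - i)) (w p))) ((e ^^ i) (w q)) = 0"
          using z[OF assms(1), of "N - i"] by simp
      qed
    qed auto
    then show ?thesis using z[OF assms(1), of "d p"] assms(4) by (simp add: \<gamma>_def)
  qed
  show ?thesis
    unfolding chain_map_def scale_right_diff_distrib scale_scale sum_subtractf 1 2 ..
qed

text \<open>The bracket is unfolded so that \<open>z\<close> enters only through the vectors
  \<open>z (w v)\<close>, which are explicit for the test elements.\<close>

lemma \<alpha>_commutator:
  assumes x: "x \<in> centraliser" and z: "z \<in> centraliser"
  shows "\<alpha> (commutator x z) = (\<Sum>v<k. \<kappa> v * (if mate v < k then B (x (w (mate v))) (z (w v)) else 0)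
    + (if swapped_end v then - 2 * B (e (x (w v))) (z (w v)) else 0))"
proof -
  note X = centraliserD[OF x] and Z = centraliserD[OF z]
  have br: "B (commutator x z u) v = B (x u) (z v) - B (z u) (x v)" for u v
  proof -
    have "B (commutator x z u) v = B (x (z u)) v - B (z (x u)) v" by (simp add: commutator_def B_simps)
    also have "\<dots> = - B (z u) (x v) + B (x u) (z v)" by (simp add: X(2)[of "z u"] Z(2)[of "x u"])
    finally show ?thesis by simp
  qed
  have "(\<Sum>v<k. \<kappa> v * (if mate v < k then B (x (w (mate v))) (z (w v)) else 0))
      = (\<Sum>v<k. if mate v < k then \<kappa> v * B (x (w (mate v))) (z (w v)) else 0)"
    by (rule sum.cong) auto
  also have "\<dots> = (\<Sum>j<k div 2. - y j * B (x (w (Suc (2 * j)))) (z (w (2 * j)))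
      + y j * B (x (w (2 * j))) (z (w (Suc (2 * j)))))"
    unfolding sum_mates by (simp add: \<kappa>_def mate_def)
  also have "\<dots> = (\<Sum>j<k div 2. y j * B (commutator x z (w (2 * j))) (w (Suc (2 * j))))"
    by (rule sum.cong) (simp_all add: br algebra_simps symmetric[of "z _"])
  finally have 1: "(\<Sum>j<k div 2. y j * B (commutator x z (w (2 * j))) (w (Suc (2 * j))))
    = (\<Sum>v<k. \<kappa> v * (if mate v < k then B (x (w (mate v))) (z (w v)) else 0))" ..
  \<comment> \<open>The two halves of the commutator differ only by a sign, since \<open>e\<close>
    is skew and commutes with \<open>x\<close> and \<open>z\<close>; their difference gives the
    factor \<open>2\<close> that reappears in \<open>C\<close>.\<close>
  have 2: "B (commutator x z (w v)) (e (w v)) = - 2 * B (e (x (w v))) (z (w v))" for v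
  proof -
    have "B (x (w v)) (z (e (w v))) = - B (e (x (w v))) (z (w v))"
      using so_skew[OF e_so, of "x (w v)" "z (w v)"] by (simp add: Z(3))
    moreover have "B (z (w v)) (x (e (w v))) = B (e (x (w v))) (z (w v))"
      by (simp add: X(3) symmetric[of "z _"])
    ultimately show ?thesis by (simp add: br)
  qed
  show ?thesis unfolding \<alpha>_def 1 2 by (simp add: sum.distrib)
qed

definition form_coeff :: "('v \<Rightarrow> 'v) \<Rightarrow> nat \<Rightarrow> nat \<Rightarrow> nat \<Rightarrow> 'k" where
  "form_coeff x u v s = (if u < k \<and> v < k then B (x (w u)) ((e ^^ s) (w v)) else 0)"

definition A :: "nat \<Rightarrow> 'k" where
  "A q = \<kappa> (star q) * \<gamma> q"

definition C :: "nat \<Rightarrow> 'k" where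
  "C q = (if even q \<and> star q = Suc q then 2 * \<gamma> q else 0)"

text \<open>The test element of the chains \<open>p\<close> and \<open>q\<close> is nonzero only on
  the generators dual to them, so the sum over all generators reduces to two terms.\<close>

lemma stabiliser_coeff_eq:
  assumes x: "x \<in> stabiliser commutator centraliser \<alpha>" and pq: "p < k" "q < k" "d p \<le> N" "d q \<le> N"
  shows "(- 1) ^ d q * (A q * form_coeff x (mate (star q)) p (N - d q)
        + C q * form_coeff x (star q) p (Suc (N - d q)))
      = (- 1) ^ (N - d p) * (A p * form_coeff x (mate (star p)) q (N - d p)
        + C p * form_coeff x (star p) q (Suc (N - d p)))"
proof -
  have xc: "x \<in> centraliser" using x by (simp add: stabiliser_def)
  define z where "z = chain_map e (w p) (w q) N"
  have zc: "z \<in> centraliser"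
    unfolding z_def
    by (rule chain_map_centraliser[OF e_so])
      (use adapted_family_zero[OF e_so adapted, of _ "Suc N"] pq in auto)
  define \<Psi> where "\<Psi> v u = \<kappa> v * (if mate v < k then B (x (w (mate v))) u else 0)
      + (if swapped_end v then - 2 * B (e (x (w v))) u else 0)" for v u
  have \<Psi>: "\<Psi> v 0 = 0" "\<Psi> v (u - u') = \<Psi> v u - \<Psi> v u'" "\<Psi> v (scale c u) = c * \<Psi> v u" for v u u' c
    by (simp_all add: \<Psi>_def B_simps algebra_simps)
  have \<Psi>_node: "\<Psi> v ((e ^^ M) (w r)) = \<kappa> v * form_coeff x (mate v) r M
      + (if swapped_end v then 2 * form_coeff x v r (Suc M) else 0)" if "v < k" "r < k" for v r M
  proof -
    have "B (e (x (w v))) ((e ^^ M) (w r)) = - B (x (w v)) ((e ^^ Suc M) (w r))"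
      using so_skew[OF e_so] by simp
    then show ?thesis using that by (simp add: \<Psi>_def form_coeff_def)
  qed
  have ends: "swapped_end (star r) \<longleftrightarrow> even r \<and> star r = Suc r" if "r < k" for r
    using node(2)[OF that] unfolding swapped_end_def by (metis even_Suc)
  have "\<alpha> (commutator x z) = 0" using x zc by (simp add: stabiliser_def)
  then have "(\<Sum>v<k. \<Psi> v (z (w v))) = 0"
    unfolding \<alpha>_commutator[OF xc zc] \<Psi>_def .
  moreover have "(\<Sum>v<k. \<Psi> v (z (w v)))
      = (\<Sum>v<k. (if v = star q then (- 1) ^ d q * \<gamma> q * \<Psi> v ((e ^^ (N - d q)) (w p)) else 0)
        - (if v = star p then (- 1) ^ (N - d p) * \<gamma> p * \<Psi> v ((e ^^ (N - d p)) (w q)) else 0))"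
  proof (rule sum.cong[OF refl])
    fix v assume "v \<in> {..<k}"
    then show "\<Psi> v (z (w v)) = (if v = star q then (- 1) ^ d q * \<gamma> q * \<Psi> v ((e ^^ (N - d q)) (w p)) else 0)
        - (if v = star p then (- 1) ^ (N - d p) * \<gamma> p * \<Psi> v ((e ^^ (N - d p)) (w q)) else 0)"
      using pq by (simp add: z_def chain_map_node \<Psi>)
  qed
  moreover have "\<dots> = (- 1) ^ d q * \<gamma> q * \<Psi> (star q) ((e ^^ (N - d q)) (w p))
        - (- 1) ^ (N - d p) * \<gamma> p * \<Psi> (star p) ((e ^^ (N - d p)) (w q))"
    using node(1)[OF pq(1)] node(1)[OF pq(2)] by (simp add: sum_subtractf)
  ultimately have eq: "(- 1) ^ d q * \<gamma> q * \<Psi> (star q) ((e ^^ (N - d q)) (w p))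
        = (- 1) ^ (N - d p) * \<gamma> p * \<Psi> (star p) ((e ^^ (N - d p)) (w q))" by simp
  have half: "\<gamma> r * \<Psi> (star r) ((e ^^ M) (w t))
      = A r * form_coeff x (mate (star r)) t M + C r * form_coeff x (star r) t (Suc M)"
    if "r < k" "t < k" for r t M
    using that node(1)[OF that(1)] by (simp add: \<Psi>_node ends A_def C_def algebra_simps)
  show ?thesis using eq half[OF pq(2,1)] half[OF pq(1,2)] by (simp add: mult.assoc)
qed

lemma form_coeff_skew:
  assumes x: "x \<in> centraliser"
  shows "form_coeff x u v s = (- 1) ^ Suc s * form_coeff x v u s"
proof -
  have "B (x (w u)) ((e ^^ s) (w v)) = - B (w u) ((e ^^ s) (x (w v)))" 
    by (simp add: centraliserD[OF x])
  also have "\<dots> = - B ((e ^^ s) (x (w v))) (w u)" using symmetric by simp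
  also have "\<dots> = (- 1) ^ Suc s * B (x (w v)) ((e ^^ s) (w u))" by (simp add: so_skew_funpow[OF e_so])
  finally show ?thesis by (simp add: form_coeff_def)
qed

lemma form_coeff_high:
  assumes x: "x \<in> centraliser" and "u < k" "d u < s"
  shows "form_coeff x u v s = 0"
proof -
  have "B (x (w v)) ((e ^^ s) (w u)) = 0"
    using adapted_family_zero[OF e_so adapted assms(2,3)] by (simp add: B_simps)
  then have "form_coeff x v u s = 0" by (simp add: form_coeff_def)
  then show ?thesis using form_coeff_skew[OF x, of u v s] by simp
qed

theorem dim_stabiliser_le:
  assumes distinct: "\<And>i j. i < k \<Longrightarrow> j < k \<Longrightarrow> even i \<Longrightarrow> even j \<Longrightarrow> i \<noteq> j \<Longrightarrow>
      star i = Suc i \<Longrightarrow> star j = Suc j \<Longrightarrow> A i \<noteq> A j"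
    and distinct_fixed: "\<And>i j. Suc i < k \<Longrightarrow> Suc j < k \<Longrightarrow> even i \<Longrightarrow> even j \<Longrightarrow> i \<noteq> j \<Longrightarrow>
      star i = i \<Longrightarrow> star (Suc i) = Suc i \<Longrightarrow> star j = j \<Longrightarrow> star (Suc j) = Suc j \<Longrightarrow>
      A i * A (Suc i) \<noteq> A j * A (Suc j)"
  shows "F.dim (stabiliser commutator centraliser \<alpha>) \<le> dim UNIV div 2"
    and "\<alpha> \<in> dual_space (fun_scale scale) centraliser"
proof -
  interpret L: fin_dim_lie_algebra "fun_scale scale" commutator centraliser
    by (rule fin_dim_lie_algebra_centraliser[OF e_so])
  have \<alpha>: "\<alpha> (x + z) = \<alpha> x + \<alpha> z" "\<alpha> (fun_scale scale c x) = c * \<alpha> x" for x z c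
  proof -
    define G where "G u v = (if swapped_end v then B (u (w v)) (e (w v)) else 0)" for u :: "'v \<Rightarrow> 'v" and v
    have "G (x + z) v = G x v + G z v" "G (fun_scale scale c x) v = c * G x v" for v
      by (simp_all add: G_def fun_scale_def B_simps)
    then show "\<alpha> (x + z) = \<alpha> x + \<alpha> z" "\<alpha> (fun_scale scale c x) = c * \<alpha> x"
      unfolding \<alpha>_def G_def[symmetric]
      by (simp_all add: fun_scale_def B_simps algebra_simps sum.distrib sum_distrib_left)
  qed
  then show dual: "\<alpha> \<in> dual_space (fun_scale scale) centraliser" by (simp add: dual_space_def)
  let ?S = "stabiliser commutator centraliser \<alpha>"
  have \<alpha>0: "\<alpha> 0 = 0" using \<alpha>(2)[of 0 0] by simp
  have S: "F.subspace ?S"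
  proof (rule F.subspaceI)
    have "0 \<in> centraliser" by (rule F.subspace_0[OF L.subspace])
    moreover have "commutator 0 v = 0" if "v \<in> centraliser" for v
      using centraliserD(1)[OF that] by (simp add: commutator_def linD fun_eq_iff)
    ultimately show "0 \<in> ?S" using \<alpha>0 by (simp add: stabiliser_def)
  qed (auto simp: stabiliser_def L.add_left L.scale_left \<alpha> F.subspace_add[OF L.subspace]
      F.subspace_scale[OF L.subspace])
  \<comment> \<open>One set of exponents and one position for each index \<open>v\<close>, matching
    the three source assumptions: the diagonal for even \<open>v\<close>; for odd \<open>v\<close>
    the position \<open>(Suc v, v - 1)\<close> if \<open>v\<close> is dual to \<open>Suc v\<close>,
    and the mated pair \<open>(v - 1, v)\<close> otherwise.\<close>
  define X where "X v = {s. s \<le> d v \<and> (odd s \<longleftrightarrow> even v \<or> star v = Suc v)}" for v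
  define \<phi> where "\<phi> vs x = (case vs of (v, s) \<Rightarrow>
      if even v then B (x (w v)) ((e ^^ s) (w v))
      else if star v = Suc v then B (x (w (Suc v))) ((e ^^ s) (w (v - 1)))
      else B (x (w (v - 1))) ((e ^^ s) (w v)))" for vs :: "nat \<times> nat" and x
  have fin: "finite (X v)" for v by (rule finite_subset[of _ "{..d v}"]) (auto simp: X_def)
  have "F.dim ?S \<le> card (SIGMA v:{..<k}. X v)"
  proof (rule F.dim_le_separating_functionals(1)[where \<phi> = \<phi>, OF S])
    show "\<phi> vs (x + z) = \<phi> vs x + \<phi> vs z" for vs x z by (auto simp: \<phi>_def B_simps split: prod.split)
    show "\<phi> vs (fun_scale scale c x) = c * \<phi> vs x" for vs c x
      by (auto simp: \<phi>_def fun_scale_def B_simps split: prod.split)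
    fix x assume x: "x \<in> ?S" and src: "\<And>vs. vs \<in> (SIGMA v:{..<k}. X v) \<Longrightarrow> \<phi> vs x = 0"
    have xc: "x \<in> centraliser" using x by (simp add: stabiliser_def)
    interpret E: stabiliser_equations k d star A C "form_coeff x"
    proof
      show "(2::'k) \<noteq> 0" by (rule two_neq_zero)
      show "star i \<le> Suc i \<and> i \<le> Suc (star i)" if "i < k" for i using node[OF that] by blast
      show "A i \<noteq> 0" if "i < k" for i using \<kappa>_nonzero \<gamma>_nonzero node(1) that by (simp add: A_def)
      show "C i \<noteq> 0" if "i < k" "even i" "star i = Suc i" for i
        using \<gamma>_nonzero two_neq_zero that by (simp add: C_def)
      show "A (Suc i) = A i" if "i < k" "even i" "star i = Suc i" for i
        using \<gamma>_star[OF that(1)] node[OF that(1)] that by (auto simp: A_def \<kappa>_def)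
      show "form_coeff x u v s = (- 1) ^ Suc s * form_coeff x v u s" for u v s
        by (rule form_coeff_skew[OF xc])
      show "form_coeff x u u s = 0" if "u < k" "even u" "odd s" "s \<le> d u" for u s
        using src[of "(u, s)"] that by (simp add: \<phi>_def X_def form_coeff_def)
      show "form_coeff x (Suc (Suc u)) u s = 0"
        if "even u" "Suc u < k" "star (Suc u) = Suc (Suc u)" "odd s" "s \<le> d (Suc u)" for u s
        using src[of "(Suc u, s)"] that by (simp add: \<phi>_def X_def form_coeff_def)
      show "form_coeff x u (Suc u) s = 0"
        if "even u" "Suc u < k" "star (Suc u) \<noteq> Suc (Suc u)" "even s" "s \<le> d (Suc u)" for u s
        using src[of "(Suc u, s)"] that by (simp add: \<phi>_def X_def form_coeff_def)
      show "C i = 0" if "i < k" "\<not> (even i \<and> star i = Suc i)" for i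
        unfolding C_def using that(2) by (rule if_not_P)
      show "form_coeff x k v s = 0" for v s by (simp add: form_coeff_def)
      show "form_coeff x u v s = 0" if "u < k" "d u < s" for u v s
        using that by (rule form_coeff_high[OF xc])
      show "(- 1) ^ d q * (A q * form_coeff x (mate (star q)) p (N - d q)
          + C q * form_coeff x (star q) p (Suc (N - d q)))
        = (- 1) ^ (N - d p) * (A p * form_coeff x (mate (star p)) q (N - d p)
          + C p * form_coeff x (star p) q (Suc (N - d p)))"
        if "p < k" "q < k" "d p \<le> N" "d q \<le> N" for p q N
        using that by (rule stabiliser_coeff_eq[OF x])
      show "A i \<noteq> A j" if "i < k" "j < k" "even i" "even j" "i \<noteq> j" "star i = Suc i" "star j = Suc j" for i j
        using that by (rule distinct)
      show "A i * A (Suc i) \<noteq> A j * A (Suc j)"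
        if "Suc i < k" "Suc j < k" "even i" "even j" "i \<noteq> j" "star i = i" "star (Suc i) = Suc i"
          "star j = j" "star (Suc j) = Suc j" for i j
        using that by (rule distinct_fixed)
    qed (use node node_antimono in auto)
    show "x = 0"
    proof (rule centraliser_eq_zero[OF xc])
      fix u v s assume "u < k" "v < k"
      then show "B (x (w u)) ((e ^^ s) (w v)) = 0"
        using E.all_zero[of u v s] by (simp add: form_coeff_def)
    qed
  qed (use fin in simp)
  also have "card (SIGMA v:{..<k}. X v) = (\<Sum>v<k. card (X v))" by (rule card_SigmaI) (use fin in auto)
  finally have "2 * F.dim ?S \<le> 2 * (\<Sum>v<k. card (X v))" by simp
  also have "\<dots> \<le> (\<Sum>v<k. Suc (d v))"
    unfolding X_def by (rule source_count_le) (use node in \<open>auto\<close>)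
  also have "\<dots> \<le> dim UNIV" by (rule adapted_family_dim[OF e_so adapted])
  finally show "F.dim ?S \<le> dim UNIV div 2" by linarith
qed

end

context orthogonal_space
begin

theorem exists_small_stabiliser:
  assumes e: "e \<in> so scale B" and nil: "nilpotent_map e"
    and J: "nilpotent_jordan_blocks scale e k0"
    and card: "finite (UNIV :: 'k set) \<longrightarrow> k0 \<le> card (UNIV :: 'k set)"
  shows "\<exists>\<alpha>\<in>dual_space (fun_scale scale) (lie_centraliser commutator (so scale B) e).
    F.dim (stabiliser commutator (lie_centraliser commutator (so scale B) e) \<alpha>) \<le> dim UNIV div 2"
proof -
  obtain k w d star where a: "adapted_family e k w d star" and perp: "family_perp e k w = {0}"
    using adapted_family_exists[OF e nil] by blast
  have kk: "k \<le> k0" by (rule adapted_family_card_le_jordan_blocks[OF e a J])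
  define g where "g q = B (w (star q)) ((e ^^ d q) (w q))" for q
  note node = adapted_familyD[OF a]
  have g0: "g q \<noteq> 0" if "q < k" for q
    using adapted_family_gram[OF e a, of "star q" q 0 "d q"] node[OF that] that by (simp add: g_def)
  define P where "P j \<longleftrightarrow> Suc (2 * j) < k \<and> star (2 * j) = Suc (2 * j)" for j
  define O' where "O' j \<longleftrightarrow> Suc (2 * j) < k \<and> star (2 * j) = 2 * j \<and> star (Suc (2 * j)) = Suc (2 * j)" for j
  \<comment> \<open>Chosen so that \<open>c j * y j ^ m j\<close> is the value of \<open>A\<close>
    on a self-linked pair and the product of the two values of \<open>A\<close> on a mated pair of
    self-dual chains; the minus sign comes from \<open>\<kappa>\<close>. The value \<open>1\<close>
    for the other pairs is a filler.\<close>
  define c where "c j = (if P j then g (2 * j) else if O' j then - g (2 * j) * g (Suc (2 * j)) else 1)" for j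
  define m where "m j = (if O' j then 2 else 1 :: nat)" for j
  have c0: "c j \<noteq> 0" for j using g0 by (auto simp: c_def P_def O'_def)
  have "\<exists>y :: nat \<Rightarrow> 'k. \<forall>j<k div 2. y j \<noteq> 0 \<and> (\<forall>i<j. c i * y i ^ m i \<noteq> c j * y j ^ m j)"
    by (rule exists_distinct_scaled_powers) (use c0 card kk in \<open>auto simp: m_def\<close>)
  then obtain y0 :: "nat \<Rightarrow> 'k" where y0: "\<And>j. j < k div 2 \<Longrightarrow> y0 j \<noteq> 0"
    "\<And>i j. j < k div 2 \<Longrightarrow> i < j \<Longrightarrow> c i * y0 i ^ m i \<noteq> c j * y0 j ^ m j" by blast
  define y where "y j = (if j < k div 2 then y0 j else 1)" for j
  interpret adapted_space scale Basis B e k w d star y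
    by unfold_locales (use e a perp y0 in \<open>auto simp: y_def\<close>)
  have cy: "c i * y i ^ m i \<noteq> c j * y j ^ m j" if "i < k div 2" "j < k div 2" "i \<noteq> j" for i j
    using y0(2)[of i j] y0(2)[of j i] that by (cases i j rule: linorder_cases) (force simp: y_def)+
  have gg: "\<gamma> = g" by (simp add: fun_eq_iff \<gamma>_def g_def)
  have "A i \<noteq> A j" if ij: "i < k" "j < k" "even i" "even j" "i \<noteq> j" "star i = Suc i" "star j = Suc j" for i j
  proof -
    have *: "A i = c (i div 2) * y (i div 2) ^ m (i div 2) \<and> i div 2 < k div 2"
      if "i < k" "even i" "star i = Suc i" for i
    proof -
      have "P (i div 2)" "\<not> O' (i div 2)" "i div 2 < k div 2"
        using that node(1)[OF that(1)] by (auto simp: P_def O'_def elim!: evenE)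
      then show ?thesis using that by (simp add: A_def \<kappa>_def c_def m_def gg)
    qed
    have "i div 2 \<noteq> j div 2" using ij by (auto elim!: evenE)
    then show ?thesis using *[of i] *[of j] cy ij by metis
  qed
  moreover have "A i * A (Suc i) \<noteq> A j * A (Suc j)"
    if ij: "Suc i < k" "Suc j < k" "even i" "even j" "i \<noteq> j"
      "star i = i" "star (Suc i) = Suc i" "star j = j" "star (Suc j) = Suc j" for i j
  proof -
    have *: "A i * A (Suc i) = c (i div 2) * y (i div 2) ^ m (i div 2) \<and> i div 2 < k div 2"
      if "Suc i < k" "even i" "star i = i" "star (Suc i) = Suc i" for i
    proof -
      have "O' (i div 2)" "\<not> P (i div 2)" "i div 2 < k div 2"
        using that by (auto simp: P_def O'_def elim!: evenE)
      then show ?thesis using that by (simp add: A_def \<kappa>_def c_def m_def gg power2_eq_square)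
    qed
    have "i div 2 \<noteq> j div 2" using ij by (auto elim!: evenE)
    then show ?thesis using *[of i] *[of j] cy ij by metis
  qed
  ultimately show ?thesis using dim_stabiliser_le by blast
qed

end

subsection \<open>Lower bound for stabilisers\<close>

lemma (in subspace_dimension) functional_in_span_of_separating:
  assumes "finite \<Phi>" and R: "subspace R"
    and add: "\<And>f x y. f \<in> \<Phi> \<Longrightarrow> x \<in> R \<Longrightarrow> y \<in> R \<Longrightarrow> \<phi> f (x + y) = \<phi> f x + \<phi> f y"
    and sc: "\<And>f c x. f \<in> \<Phi> \<Longrightarrow> x \<in> R \<Longrightarrow> \<phi> f (scale c x) = c * \<phi> f x"
    and \<alpha>add: "\<And>x y. x \<in> R \<Longrightarrow> y \<in> R \<Longrightarrow> \<alpha> (x + y) = \<alpha> x + \<alpha> y"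
    and \<alpha>sc: "\<And>c x. x \<in> R \<Longrightarrow> \<alpha> (scale c x) = c * \<alpha> x"
    and sep: "\<And>x. x \<in> R \<Longrightarrow> (\<And>f. f \<in> \<Phi> \<Longrightarrow> \<phi> f x = 0) \<Longrightarrow> \<alpha> x = 0"
  shows "\<exists>c. \<forall>x\<in>R. \<alpha> x = (\<Sum>f\<in>\<Phi>. c f * \<phi> f x)"
  using assms
proof (induction \<Phi> arbitrary: R rule: finite_induct)
  case empty
  then show ?case by simp
next
  case (insert f \<Phi> R)
  define R' where "R' = {x \<in> R. \<phi> f x = 0}"
  have f0: "\<phi> f 0 = 0" using insert.prems(3)[of f 0 0] subspace_0[OF insert.prems(1)] by simp
  have R': "subspace R'"
    using insert.prems(1-3) f0 by (auto simp: R'_def subspace_def)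
  have "\<exists>c. \<forall>x\<in>R'. \<alpha> x = (\<Sum>f\<in>\<Phi>. c f * \<phi> f x)"
  proof (rule insert.IH[OF R'])
    fix x assume x: "x \<in> R'" and z: "\<And>g. g \<in> \<Phi> \<Longrightarrow> \<phi> g x = 0"
    then show "\<alpha> x = 0" by (intro insert.prems(6)) (auto simp: R'_def)
  qed (use insert.prems(2-5) in \<open>auto simp: R'_def\<close>)
  then obtain c where c: "\<And>x. x \<in> R' \<Longrightarrow> \<alpha> x = (\<Sum>g\<in>\<Phi>. c g * \<phi> g x)" by blast
  show ?case
  proof (cases "\<exists>x0\<in>R. \<phi> f x0 \<noteq> 0")
    case False
    then have "R' = R" by (auto simp: R'_def)
    then have "\<forall>x\<in>R. \<alpha> x = (\<Sum>g\<in>insert f \<Phi>. c g * \<phi> g x)"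
      using c False insert.hyps by simp
    then show ?thesis by blast
  next
    case True
    then obtain x0 where x0: "x0 \<in> R" "\<phi> f x0 \<noteq> 0" by blast
    define \<beta> where "\<beta> x = \<alpha> x - (\<Sum>g\<in>\<Phi>. c g * \<phi> g x)" for x
    define c' where "c' = c(f := \<beta> x0 / \<phi> f x0)"
    have "\<alpha> x = (\<Sum>g\<in>insert f \<Phi>. c' g * \<phi> g x)" if x: "x \<in> R" for x
    proof -
      define t where "t = - (\<phi> f x / \<phi> f x0)"
      have tx: "scale t x0 \<in> R" using subspace_scale[OF insert.prems(1) x0(1)] .
      have "\<phi> f (x + scale t x0) = \<phi> f x + t * \<phi> f x0"
        using x tx x0 insert.prems(2,3) by simp
      also have "\<dots> = 0" using x0(2) by (simp add: t_def)
      finally have "x + scale t x0 \<in> R'"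
        using subspace_add[OF insert.prems(1) x tx] by (simp add: R'_def)
      then have "\<beta> (x + scale t x0) = 0" using c by (simp add: \<beta>_def)
      moreover have "\<beta> (x + scale t x0) = \<beta> x + t * \<beta> x0"
        using x tx x0 insert.prems(2-5)
        by (simp add: \<beta>_def algebra_simps sum.distrib sum_distrib_left)
      ultimately have "\<beta> x = \<beta> x0 / \<phi> f x0 * \<phi> f x" by (simp add: t_def)
      moreover have "(\<Sum>g\<in>\<Phi>. c' g * \<phi> g x) = (\<Sum>g\<in>\<Phi>. c g * \<phi> g x)"
        by (rule sum.cong) (use insert.hyps in \<open>auto simp: c'_def\<close>)
      ultimately show ?thesis using insert.hyps by (simp add: \<beta>_def c'_def algebra_simps)
    qed
    then show ?thesis by blast
  qed
qed

section \<open>Orthogonal bases, the trace form and a tridiagonal skew map\<close>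

locale orthogonal_basis = orthogonal_space scale Basis B
  for scale :: "'k::field \<Rightarrow> 'v::ab_group_add \<Rightarrow> 'v" and Basis :: "'v set"
    and B :: "'v \<Rightarrow> 'v \<Rightarrow> 'k" +
  fixes u :: "nat \<Rightarrow> 'v" and n :: nat
  assumes orth: "i < n \<Longrightarrow> j < n \<Longrightarrow> B (u i) (u j) \<noteq> 0 \<longleftrightarrow> i = j"
    and complete: "(\<And>i. i < n \<Longrightarrow> B v (u i) = 0) \<Longrightarrow> v = 0"
    and n_dim: "n = dim UNIV"

text \<open>This is the adapted family of the zero endomorphism: all chains have length one and are
  therefore self-dual.\<close>

lemma (in orthogonal_space) orthogonal_basis_exists:
  "\<exists>u. orthogonal_basis scale Basis B u (dim UNIV)"
proof -
  define z where "z = (\<lambda>v::'v. 0::'v)"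
  have z: "z \<in> so scale B" "nilpotent_map z"
    by (auto simp: z_def so_iff lin_iff B_simps nilpotent_map_def intro!: exI[of _ 1])
  obtain k w d star where a: "adapted_family z k w d star" and p: "family_perp z k w = {0}"
    using adapted_family_exists[OF z] by blast
  note D = adapted_familyD[OF a]
  have pow: "(z ^^ s) v = (if s = 0 then v else 0)" for s v by (cases s) (auto simp: z_def)
  have d0: "d i = 0" if "i < k" for i
    using adapted_family_gram0[OF a that D(1)[OF that], of "d i"] by (auto simp: pow B_simps split: if_splits)
  have st: "star i = i" if "i < k" for i using D(6)[OF that] d0[OF that] by simp
  have orth: "B (w i) (w j) \<noteq> 0 \<longleftrightarrow> i = j" if "i < k" "j < k" for i j
    using adapted_family_gram0[OF a that, of 0] st[OF that(1)] d0[OF that(1)] by auto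
  have comp: "v = 0" if "\<And>i. i < k \<Longrightarrow> B v (w i) = 0" for v
  proof -
    have "v \<in> family_perp z k w" using that by (auto simp: family_perp_def pow B_simps)
    then show ?thesis using p by simp
  qed
  have "k \<le> dim UNIV" using adapted_family_dim[OF z(1) a] d0 by simp
  moreover have "dim UNIV \<le> card {..<k}"
    by (rule dim_le_separating_functionals(1)[where \<phi> = "\<lambda>i v. B v (w i)"])
      (use comp in \<open>auto simp: B_simps\<close>)
  ultimately have k: "k = dim UNIV" by simp
  have "orthogonal_basis scale Basis B w k"
    by unfold_locales (use orth comp k in auto)
  then show ?thesis using k by blast
qed

context orthogonal_basis
begin

definition g :: "nat \<Rightarrow> 'k" where "g i = B (u i) (u i)"

lemma B_u: "i < n \<Longrightarrow> j < n \<Longrightarrow> B (u i) (u j) = (if i = j then g i else 0)"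
  using orth by (auto simp: g_def)

lemma g_nonzero: "i < n \<Longrightarrow> g i \<noteq> 0"
  using orth[of i i] by (simp add: g_def)

lemma expansion: "v = (\<Sum>i<n. scale (B v (u i) / g i) (u i))"
proof -
  have "v - (\<Sum>i<n. scale (B v (u i) / g i) (u i)) = 0"
  proof (rule complete)
    fix j assume j: "j < n"
    have "B (\<Sum>i<n. scale (B v (u i) / g i) (u i)) (u j) = (\<Sum>i<n. if i = j then B v (u j) else 0)"
      unfolding B_sum B_simps
      by (rule sum.cong[OF refl]) (use j in \<open>auto simp: B_u g_nonzero\<close>)
    then show "B (v - (\<Sum>i<n. scale (B v (u i) / g i) (u i))) (u j) = 0" using j by (simp add: B_simps)
  qed
  then show ?thesis by simp
qed

lemma lin_eq_zero:
  assumes "lin x" "\<And>i. i < n \<Longrightarrow> x (u i) = 0"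
  shows "x = 0"
proof
  fix v
  have "x v = x (\<Sum>i<n. scale (B v (u i) / g i) (u i))" using expansion[of v] by simp
  also have "\<dots> = (\<Sum>i<n. scale (B v (u i) / g i) (x (u i)))" by (simp add: linD[OF assms(1)])
  also have "\<dots> = 0" using assms(2) by (auto intro: sum.neutral)
  finally show "x v = 0 v" by simp
qed

definition tr :: "('v \<Rightarrow> 'v) \<Rightarrow> 'k" where
  "tr x = (\<Sum>i<n. B (x (u i)) (u i) / g i)"

lemma tr_commute:
  assumes "lin x" "lin y"
  shows "tr (\<lambda>v. x (y v)) = tr (\<lambda>v. y (x v))"
proof -
  have *: "tr (\<lambda>v. x (y v)) = (\<Sum>i<n. \<Sum>j<n. B (y (u i)) (u j) * B (x (u j)) (u i) / (g i * g j))"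
    if "lin x" "lin y" for x y
    unfolding tr_def
  proof (rule sum.cong[OF refl])
    fix i
    have "x (y (u i)) = x (\<Sum>j<n. scale (B (y (u i)) (u j) / g j) (u j))"
      using expansion[of "y (u i)"] by simp
    also have "\<dots> = (\<Sum>j<n. scale (B (y (u i)) (u j) / g j) (x (u j)))" by (simp add: linD[OF that(1)])
    finally show "B (x (y (u i))) (u i) / g i
        = (\<Sum>j<n. B (y (u i)) (u j) * B (x (u j)) (u i) / (g i * g j))"
      by (simp add: B_sum B_simps sum_divide_distrib mult.commute[of "g i"])
  qed
  show ?thesis
    unfolding *[OF assms] *[OF assms(2,1)]
    by (subst sum.swap) (simp add: mult.commute)
qed

lemma tr_diff: "tr (\<lambda>v. x v - y v) = tr x - tr y"
  by (simp add: tr_def B_simps diff_divide_distrib sum_subtractf)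

text \<open>The functional is a combination of matrix entries \<open>B (x (u i)) (u j)\<close>. For
  skew \<open>x\<close> such an entry is half the trace against an elementary skew map, both of
  whose terms contribute equally.\<close>

lemma functional_eq_trace:
  assumes R: "F.subspace R" "R \<subseteq> so scale B" and \<alpha>: "\<alpha> \<in> dual_space (fun_scale scale) R"
  obtains a where "a \<in> so scale B" "\<And>x. x \<in> R \<Longrightarrow> \<alpha> x = tr (\<lambda>v. a (x v))"
proof -
  have \<alpha>0: "\<alpha> 0 = 0"
  proof -
    have "\<alpha> (fun_scale scale 0 0) = 0 * \<alpha> 0"
      using \<alpha> F.subspace_0[OF R(1)] unfolding dual_space_def by blast
    then show ?thesis by simp
  qed
  have "\<exists>c. \<forall>x\<in>R. \<alpha> x = (\<Sum>f\<in>{..<n} \<times> {..<n}. c f * (case f of (i, j) \<Rightarrow> \<lambda>x. B (x (u i)) (u j)) x)"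
  proof (rule F.functional_in_span_of_separating[OF _ R(1)])
    fix x assume x: "x \<in> R"
      and z: "\<And>f. f \<in> {..<n} \<times> {..<n} \<Longrightarrow> (case f of (i, j) \<Rightarrow> \<lambda>x. B (x (u i)) (u j)) x = 0"
    have "x = 0"
    proof (rule lin_eq_zero)
      show "lin x" using x R(2) so_lin by blast
      fix i assume "i < n"
      then show "x (u i) = 0" using z[of "(i, _)"] by (intro complete) simp
    qed
    then show "\<alpha> x = 0" using \<alpha>0 by simp
  qed (use \<alpha> in \<open>auto simp: B_simps fun_scale_def dual_space_def\<close>)
  then obtain c where c: "\<And>x. x \<in> R \<Longrightarrow>
      \<alpha> x = (\<Sum>f\<in>{..<n} \<times> {..<n}. c f * (case f of (i, j) \<Rightarrow> \<lambda>x. B (x (u i)) (u j)) x)" by blast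
  define a where "a v = (\<Sum>f\<in>{..<n} \<times> {..<n}. scale (c f / 2)
      (scale (B v (u (snd f))) (u (fst f)) - scale (B v (u (fst f))) (u (snd f))))" for v
  have "lin a" unfolding a_def by (intro lin_sum lin_scale_fun lin_diff_fun lin_B_scale)
  moreover have "B (a v) v' = - B v (a v')" for v v'
    unfolding a_def B_sum sum_negf[symmetric]
    by (rule sum.cong[OF refl]) (simp add: B_simps algebra_simps symmetric[of _ v'])
  ultimately have "a \<in> so scale B" by (simp add: so_iff)
  moreover have "\<alpha> x = tr (\<lambda>v. a (x v))" if x: "x \<in> R" for x
  proof -
    have xs: "x \<in> so scale B" using x R(2) by blast
    have one: "(\<Sum>l<n. (B (x (u l)) (u j) * B (u i) (u l)) / g l) = B (x (u i)) (u j)"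
      if "i < n" "j < n" for i j
    proof -
      have "(\<Sum>l<n. (B (x (u l)) (u j) * B (u i) (u l)) / g l) = (\<Sum>l<n. if i = l then B (x (u i)) (u j) else 0)"
        by (rule sum.cong[OF refl]) (use that in \<open>auto simp: B_u g_nonzero\<close>)
      then show ?thesis using that by simp
    qed
    have "tr (\<lambda>v. a (x v)) = (\<Sum>l<n. \<Sum>f\<in>{..<n} \<times> {..<n}. c f / 2 *
       ((B (x (u l)) (u (snd f)) * B (u (fst f)) (u l)) / g l
        - (B (x (u l)) (u (fst f)) * B (u (snd f)) (u l)) / g l))"
      by (simp add: tr_def a_def B_sum B_simps sum_divide_distrib diff_divide_distrib right_diff_distrib)
    also have "\<dots> = (\<Sum>f\<in>{..<n} \<times> {..<n}. \<Sum>l<n. c f / 2 *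
       ((B (x (u l)) (u (snd f)) * B (u (fst f)) (u l)) / g l
        - (B (x (u l)) (u (fst f)) * B (u (snd f)) (u l)) / g l))"
      by (rule sum.swap)
    also have "\<dots> = (\<Sum>f\<in>{..<n} \<times> {..<n}. c f / 2 *
       (B (x (u (fst f))) (u (snd f)) - B (x (u (snd f))) (u (fst f))))"
    proof (rule sum.cong[OF refl])
      fix f assume "f \<in> {..<n} \<times> {..<n}"
      then have f: "fst f < n" "snd f < n" by auto
      have "(\<Sum>l<n. c f / 2 * (P l - Q l)) = c f / 2 * ((\<Sum>l<n. P l) - (\<Sum>l<n. Q l))" for P Q :: "nat \<Rightarrow> 'k"
        by (simp only: sum_distrib_left sum_subtractf right_diff_distrib)
      then show "(\<Sum>l<n. c f / 2 *
         ((B (x (u l)) (u (snd f)) * B (u (fst f)) (u l)) / g l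
          - (B (x (u l)) (u (fst f)) * B (u (snd f)) (u l)) / g l))
        = c f / 2 * (B (x (u (fst f))) (u (snd f)) - B (x (u (snd f))) (u (fst f)))"
        by (simp only: one[OF f] one[OF f(2,1)])
    qed
    also have "\<dots> = (\<Sum>f\<in>{..<n} \<times> {..<n}. c f * B (x (u (fst f))) (u (snd f)))"
    proof (rule sum.cong[OF refl])
      fix f
      have "B (x (u (snd f))) (u (fst f)) = - B (x (u (fst f))) (u (snd f))"
        using so_skew[OF xs, of "u (snd f)" "u (fst f)"] symmetric[of "u (snd f)"] by simp
      then show "c f / 2 * (B (x (u (fst f))) (u (snd f)) - B (x (u (snd f))) (u (fst f)))
          = c f * B (x (u (fst f))) (u (snd f))"
        using two_neq_zero by (simp add: mult_2[symmetric])
    qed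
    also have "\<dots> = \<alpha> x" unfolding c[OF x] by (rule sum.cong) auto
    finally show ?thesis ..
  qed
  ultimately show thesis using that by blast
qed

text \<open>\<open>eq\<close> says that the bracket of \<open>e\<close> with \<open>y\<close> and
  that of \<open>a\<close> with \<open>x\<close> cancel. Cyclicity of the trace turns the functional
  on \<open>commutator x z\<close> into the trace of \<open>y\<close> against the bracket of
  \<open>e\<close> and \<open>z\<close>, and that bracket is zero.\<close>

lemma stabiliserI:
  assumes e: "e \<in> so scale B" and a: "a \<in> so scale B"
    and \<alpha>: "\<And>x. x \<in> lie_centraliser commutator (so scale B) e \<Longrightarrow> \<alpha> x = tr (\<lambda>v. a (x v))"
    and x: "x \<in> lie_centraliser commutator (so scale B) e" and y: "y \<in> so scale B"
    and eq: "\<And>v. e (y v) + a (x v) = y (e v) + x (a v)"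
  shows "x \<in> stabiliser commutator (lie_centraliser commutator (so scale B) e) \<alpha>"
proof -
  interpret L: fin_dim_lie_algebra "fun_scale scale" commutator
    "lie_centraliser commutator (so scale B) e"
    by (rule fin_dim_lie_algebra_centraliser[OF e])
  have "\<alpha> (commutator x z) = 0" if z: "z \<in> lie_centraliser commutator (so scale B) e" for z
  proof -
    have c: "commutator x z \<in> lie_centraliser commutator (so scale B) e"
      using L.closed x z by blast
    have "lin x" "lin z" and ze: "\<And>v. z (e v) = e (z v)"
      using x z so_lin by (auto simp: lie_centraliser_def commutator_def fun_eq_iff)
    note lins = \<open>lin x\<close> \<open>lin z\<close> so_lin[OF e] so_lin[OF a] so_lin[OF y]
    have "tr (\<lambda>v. a (commutator x z v)) = tr (\<lambda>v. a (x (z v)) - a (z (x v)))"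
      by (simp add: commutator_def linD[OF so_lin[OF a]])
    also have "\<dots> = tr (\<lambda>v. a (x (z v))) - tr (\<lambda>v. x (a (z v)))"
      using tr_commute[OF lin_compose[OF lins(4,2)] lins(1)] by (simp add: tr_diff)
    also have "\<dots> = tr (\<lambda>v. y (e (z v)) - e (y (z v)))"
    proof -
      have "a (x (z v)) - x (a (z v)) = y (e (z v)) - e (y (z v))" for v
        using eq[of "z v"] by (metis add_diff_cancel_left' add_diff_cancel_right' diff_add_eq diff_diff_eq2 add.commute)
      then show ?thesis by (simp flip: tr_diff)
    qed
    also have "\<dots> = tr (\<lambda>v. y (e (z v))) - tr (\<lambda>v. y (z (e v)))"
      using tr_commute[OF lins(3) lin_compose[OF lins(5,2)]] by (simp add: tr_diff)
    also have "\<dots> = 0" by (simp add: ze)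
    finally show ?thesis using \<alpha>[OF c] by simp
  qed
  then show ?thesis using x by (simp add: stabiliser_def)
qed

text \<open>Repeated application to \<open>u 0\<close> climbs one basis vector at a time, so the
  powers below \<open>n\<close> are independent; a skew map with this property is thus available
  over every field considered.\<close>

definition tridiagonal :: "'v \<Rightarrow> 'v" where
  "tridiagonal v = (\<Sum>i<n - 1. scale (B v (u i)) (u (Suc i)) - scale (B v (u (Suc i))) (u i))"

lemma tridiagonal_so: "tridiagonal \<in> so scale B"
proof -
  have "lin tridiagonal" unfolding tridiagonal_def by (intro lin_sum lin_diff_fun lin_B_scale)
  moreover have "B (tridiagonal v) v' = - B v (tridiagonal v')" for v v'
    unfolding tridiagonal_def B_sum sum_negf[symmetric]
    by (rule sum.cong[OF refl]) (simp add: B_simps algebra_simps symmetric[of _ v'])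
  ultimately show ?thesis by (simp add: so_iff)
qed

lemma tridiagonal_u:
  assumes j: "j < n"
  shows "tridiagonal (u j) = (if Suc j < n then scale (g j) (u (Suc j)) else 0)
    - (if 0 < j then scale (g j) (u (j - 1)) else 0)"
proof -
  have "(\<Sum>i<n - 1. scale (B (u j) (u i)) (u (Suc i)))
      = (\<Sum>i<n - 1. if i = j then scale (g j) (u (Suc j)) else 0)"
    by (rule sum.cong[OF refl]) (use j in \<open>auto simp: B_u\<close>)
  moreover have "(\<Sum>i<n - 1. scale (B (u j) (u (Suc i))) (u i))
      = (\<Sum>i<n - 1. if i = j - 1 \<and> 0 < j then scale (g j) (u (j - 1)) else 0)"
    by (rule sum.cong[OF refl]) (use j in \<open>auto simp: B_u\<close>)
  moreover have "\<dots> = (if 0 < j then scale (g j) (u (j - 1)) else 0)"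
    using j by (cases "0 < j") auto
  ultimately show ?thesis using j by (auto simp: tridiagonal_def sum_subtractf)
qed

lemma tridiagonal_power:
  assumes "0 < n"
  shows "i < n \<Longrightarrow> m < i \<Longrightarrow> B ((tridiagonal ^^ m) (u 0)) (u i) = 0"
    and "m < n \<Longrightarrow> B ((tridiagonal ^^ m) (u 0)) (u m) \<noteq> 0"
proof -
  have step: "B ((tridiagonal ^^ Suc m) (u 0)) (u i)
      = - ((if Suc i < n then g i * B ((tridiagonal ^^ m) (u 0)) (u (Suc i)) else 0)
        - (if 0 < i then g i * B ((tridiagonal ^^ m) (u 0)) (u (i - 1)) else 0))" if "i < n" for m i
    using that by (simp add: so_skew[OF tridiagonal_so] tridiagonal_u B_simps)
  have "(\<forall>i<n. m < i \<longrightarrow> B ((tridiagonal ^^ m) (u 0)) (u i) = 0) \<and>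
      (m < n \<longrightarrow> B ((tridiagonal ^^ m) (u 0)) (u m) \<noteq> 0)" for m
  proof (induction m)
    case 0
    then show ?case using assms by (simp add: B_u g_nonzero)
  next
    case (Suc m)
    show ?case
    proof (intro conjI allI impI)
      fix i assume i: "i < n" "Suc m < i"
      then have "m < Suc i" "m < i - 1" "i - 1 < n" by auto
      then show "B ((tridiagonal ^^ Suc m) (u 0)) (u i) = 0"
        unfolding step[OF i(1)] using Suc by simp
    next
      assume m: "Suc m < n"
      then show "B ((tridiagonal ^^ Suc m) (u 0)) (u (Suc m)) \<noteq> 0"
        unfolding step[OF m] using Suc g_nonzero[OF m] by simp
    qed
  qed
  then show "i < n \<Longrightarrow> m < i \<Longrightarrow> B ((tridiagonal ^^ m) (u 0)) (u i) = 0"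
    "m < n \<Longrightarrow> B ((tridiagonal ^^ m) (u 0)) (u m) \<noteq> 0" by blast+
qed

end

section \<open>Powers of polynomials with skew coefficients\<close>

lemma sum_convolution_swap:
  fixes F :: "nat \<Rightarrow> nat \<Rightarrow> 'x::comm_monoid_add"
  shows "(\<Sum>l\<le>i. \<Sum>r\<le>i - l. F l r) = (\<Sum>r\<le>i. \<Sum>l\<le>i - r. F l r)"
proof -
  have 1: "{..i - l} = {r \<in> {..i}. l + r \<le> i}" if "l \<le> i" for l using that by auto
  have 2: "{..i - r} = {l \<in> {..i}. l + r \<le> i}" if "r \<le> i" for r using that by auto
  have "(\<Sum>l\<le>i. \<Sum>r\<le>i - l. F l r) = (\<Sum>l\<le>i. \<Sum>r | r \<in> {..i} \<and> l + r \<le> i. F l r)"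
    by (rule sum.cong[OF refl]) (simp add: 1)
  also have "\<dots> = (\<Sum>r\<le>i. \<Sum>l | l \<in> {..i} \<and> l + r \<le> i. F l r)"
    by (rule sum.swap_restrict) auto
  also have "\<dots> = (\<Sum>r\<le>i. \<Sum>l\<le>i - r. F l r)"
    by (rule sum.cong[OF refl]) (simp add: 2)
  finally show ?thesis .
qed

text \<open>\<open>power_coeff x m i\<close> is the coefficient of \<open>t\<^sup>i\<close> in \<open>x(t)\<^sup>m\<close>, for \<open>x(t) = \<Sum>l. x l t\<^sup>l\<close>.\<close>

primrec power_coeff :: "(nat \<Rightarrow> 'v \<Rightarrow> 'v::ab_group_add) \<Rightarrow> nat \<Rightarrow> nat \<Rightarrow> 'v \<Rightarrow> 'v" where
  "power_coeff x 0 i = (\<lambda>v. if i = 0 then v else 0)"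
| "power_coeff x (Suc m) i = (\<lambda>v. \<Sum>l\<le>i. x l (power_coeff x m (i - l) v))"

context orthogonal_space
begin

context
  fixes x :: "nat \<Rightarrow> 'v \<Rightarrow> 'v"
  assumes x_so: "x l \<in> so scale B"
begin

lemma power_coeff_lin: "lin (power_coeff x m i)"
proof (induction m arbitrary: i)
  case 0
  then show ?case by (auto simp: lin_iff)
next
  case (Suc m)
  then show ?case by (auto intro!: lin_sum lin_compose[OF so_lin[OF x_so]])
qed

text \<open>Coefficientwise, \<open>x(t)\<close> commutes with its own powers.\<close>

lemma power_coeff_Suc_right:
  "power_coeff x (Suc m) i v = (\<Sum>l\<le>i. power_coeff x m (i - l) (x l v))"
proof (induction m arbitrary: i v)
  case 0
  have "(\<Sum>l\<le>i. x l (if i - l = 0 then v else 0)) = (\<Sum>l\<in>{i}. x l v)"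
    by (rule sum.mono_neutral_cong_right) (auto simp: linD[OF so_lin[OF x_so]])
  moreover have "(\<Sum>l\<le>i. if i - l = 0 then x l v else 0) = (\<Sum>l\<in>{i}. x l v)"
    by (rule sum.mono_neutral_cong_right) auto
  ultimately show ?case by simp
next
  case (Suc m)
  have "power_coeff x (Suc (Suc m)) i v = (\<Sum>l\<le>i. x l (power_coeff x (Suc m) (i - l) v))" by simp
  also have "\<dots> = (\<Sum>l\<le>i. \<Sum>r\<le>i - l. x l (power_coeff x m (i - l - r) (x r v)))"
    unfolding Suc by (simp add: linD[OF so_lin[OF x_so]])
  also have "\<dots> = (\<Sum>r\<le>i. \<Sum>l\<le>i - r. x l (power_coeff x m (i - l - r) (x r v)))"
    by (rule sum_convolution_swap)
  also have "\<dots> = (\<Sum>r\<le>i. power_coeff x (Suc m) (i - r) (x r v))"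
    by (simp add: add.commute)
  finally show ?case .
qed

text \<open>Odd powers of a skew polynomial are skew; hence the restriction to odd powers in the
  lower bound.\<close>

lemma power_coeff_adjoint: "B (power_coeff x m i v) v' = (- 1) ^ m * B v (power_coeff x m i v')"
proof (induction m arbitrary: i v')
  case 0
  then show ?case by (simp add: B_simps)
next
  case (Suc m)
  have "B (power_coeff x (Suc m) i v) v' = (\<Sum>l\<le>i. - B (power_coeff x m (i - l) v) (x l v'))"
    by (simp add: B_sum so_skew[OF x_so])
  also have "\<dots> = (\<Sum>l\<le>i. (- 1) ^ Suc m * B v (power_coeff x m (i - l) (x l v')))"
    by (simp add: Suc)
  also have "\<dots> = (- 1) ^ Suc m * B v (power_coeff x (Suc m) i v')"
    unfolding power_coeff_Suc_right by (simp add: B_sum sum_distrib_left sum_negf)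
  finally show ?case .
qed

lemma power_coeff_degree:
  assumes "\<And>l v. 2 < l \<Longrightarrow> x l v = 0"
  shows "2 * m < i \<Longrightarrow> power_coeff x m i v = 0" and "power_coeff x m (2 * m) v = (x 2 ^^ m) v"
proof -
  have "(\<forall>i>2 * m. power_coeff x m i v = 0) \<and> power_coeff x m (2 * m) v = (x 2 ^^ m) v" for m
  proof (induction m)
    case 0
    then show ?case by simp
  next
    case (Suc m)
    have "power_coeff x (Suc m) i v = 0" if "2 * Suc m < i" for i
    proof -
      have "x l (power_coeff x m (i - l) v) = 0" for l
        using Suc assms[of l] that by (cases "2 < l") (auto simp: linD[OF so_lin[OF x_so]])
      then show ?thesis by simp
    qed
    moreover have "power_coeff x (Suc m) (2 * Suc m) v = (x 2 ^^ Suc m) v"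
    proof -
      have "power_coeff x (Suc m) (2 * Suc m) v
          = (\<Sum>l\<in>{2}. x l (power_coeff x m (2 * Suc m - l) v))"
        unfolding power_coeff.simps
      proof (rule sum.mono_neutral_right)
        show "\<forall>l\<in>{..2 * Suc m} - {2}. x l (power_coeff x m (2 * Suc m - l) v) = 0"
        proof
          fix l assume "l \<in> {..2 * Suc m} - {2}"
          then show "x l (power_coeff x m (2 * Suc m - l) v) = 0"
            using Suc assms[of l] by (cases "2 < l") (auto simp: linD[OF so_lin[OF x_so]])
        qed
      qed auto
      then show ?thesis using Suc by simp
    qed
    ultimately show ?case by simp
  qed
  then show "2 * m < i \<Longrightarrow> power_coeff x m i v = 0" "power_coeff x m (2 * m) v = (x 2 ^^ m) v"
    by blast+
qed

end

end

context orthogonal_basis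
begin

text \<open>Vinberg's inequality. If \<open>\<alpha>\<close> is the trace form against \<open>a\<close>, then every lowest
  coefficient of a polynomial commuting with \<open>x(t) = e + t a + t\<^sup>2 b\<close> lies in the stabiliser of \<open>\<alpha>\<close>.
  For the tridiagonal \<open>b\<close> the odd powers of \<open>x(t)\<close> are linearly independent over the polynomial ring,
  so counting the combinations with coefficients of degree \<open>< N\<close> bounds the stabiliser from below
  as \<open>N\<close> grows.\<close>

theorem dim_stabiliser_ge:
  assumes e: "e \<in> so scale B"
    and \<alpha>: "\<alpha> \<in> dual_space (fun_scale scale) (lie_centraliser commutator (so scale B) e)"
  shows "n div 2 \<le> F.dim (stabiliser commutator (lie_centraliser commutator (so scale B) e) \<alpha>)"
proof (rule ccontr)
  let ?Z = "lie_centraliser commutator (so scale B) e"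
  let ?S = "stabiliser commutator ?Z \<alpha>"
  interpret L: fin_dim_lie_algebra "fun_scale scale" commutator ?Z
    by (rule fin_dim_lie_algebra_centraliser[OF e])
  have Zso: "?Z \<subseteq> so scale B" by (auto simp: lie_centraliser_def)
  obtain a where a: "a \<in> so scale B" and tr: "\<And>x. x \<in> ?Z \<Longrightarrow> \<alpha> x = tr (\<lambda>v. a (x v))"
    using functional_eq_trace[OF L.subspace Zso \<alpha>] by blast
  define r where "r = n div 2"
  define \<delta> where "\<delta> = F.dim ?S"
  assume "\<not> ?thesis"
  then have \<delta>r: "\<delta> < r" by (simp add: r_def \<delta>_def)
  have n0: "0 < n" using \<delta>r by (auto simp: r_def)
  have \<alpha>0: "\<alpha> 0 = 0"
  proof -
    have "\<alpha> (fun_scale scale 0 0) = 0 * \<alpha> 0"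
      using \<alpha> F.subspace_0[OF L.subspace] unfolding dual_space_def by blast
    then show ?thesis by simp
  qed
  have "F.subspace ?S"
  proof (rule F.subspaceI)
    have "commutator 0 v = 0" if "v \<in> ?Z" for v
      using so_lin Zso that by (auto simp: commutator_def linD fun_eq_iff)
    then show "0 \<in> ?S" using \<alpha>0 F.subspace_0[OF L.subspace] by (simp add: stabiliser_def)
  qed (use \<alpha> L.closed in \<open>auto simp: stabiliser_def L.add_left L.scale_left dual_space_def
      F.subspace_add[OF L.subspace] F.subspace_scale[OF L.subspace]\<close>)
  then have S: "F.fin_dim_subspace ?S"
    by (rule fin_dim_fun_subspace) (use Zso so_lin in \<open>auto simp: stabiliser_def\<close>)
  obtain \<phi> :: "nat \<Rightarrow> ('v \<Rightarrow> 'v) \<Rightarrow> 'k" where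
    \<phi>lin: "\<And>i. Vector_Spaces.linear (fun_scale scale) (*) (\<phi> i)" and
    \<phi>sep: "\<And>x. x \<in> ?S \<Longrightarrow> (\<And>i. i < \<delta> \<Longrightarrow> \<phi> i x = 0) \<Longrightarrow> x = 0"
    using F.fin_dim_subspace_functionals[OF S] unfolding \<delta>_def by blast
  define x where "x l = (if l = 0 then e else if l = 1 then a else if l = 2 then tridiagonal else (\<lambda>_. 0))"
    for l :: nat
  have zero_so: "(\<lambda>_. 0) \<in> so scale B" by (simp add: so_iff lin_iff B_simps)
  have x_so: "x l \<in> so scale B" for l
    using e a tridiagonal_so zero_so by (simp add: x_def)
  note xlin = linD[OF so_lin[OF x_so]]
  have x2: "x l v = 0" if "2 < l" for l v using that by (simp add: x_def)
  \<comment> \<open>The \<open>r * N\<close> unknowns have to outnumber at most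
    \<open>(r - 1) * (N + 4 * r)\<close> conditions, which means \<open>4 * r * (r - 1) < N\<close>.
    \<open>D\<close> exceeds the degree of every \<open>t ^ i * x(t) ^ (2 * j + 1)\<close> in play,
    at most \<open>N - 1 + 2 * (2 * r - 1)\<close>.\<close>
  define N where "N = 4 * r * r + 1"
  define D where "D = N + 4 * r"
  let ?I = "{..<r} \<times> {..<N}"
  \<comment> \<open>\<open>p (j, i) l\<close> is the coefficient of \<open>t ^ l\<close> in
    \<open>t ^ i * x(t) ^ (2 * j + 1)\<close>; \<open>Y l\<close> is the same coefficient of the
    combination given by \<open>c\<close>.\<close>
  define p where "p ji l = (if snd ji \<le> l then power_coeff x (Suc (2 * fst ji)) (l - snd ji) else (\<lambda>_. 0))"
    for ji :: "nat \<times> nat" and l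
  have "\<exists>c. (\<exists>i\<in>?I. c i \<noteq> 0) \<and>
    (\<forall>f\<in>{..<\<delta>} \<times> {..<D}. (\<Sum>i\<in>?I. \<phi> (fst f) (p i (snd f)) * c i) = 0)"
  proof (rule homogeneous_system_nontrivial_solution)
    have "\<delta> * D \<le> (r - 1) * (N + 4 * r)" using \<delta>r by (simp add: D_def)
    also have "\<dots> < r * N"
    proof -
      obtain r' where "r = Suc r'" using \<delta>r by (cases r) auto
      then show ?thesis by (simp add: N_def algebra_simps)
    qed
    finally show "card ({..<\<delta>} \<times> {..<D}) < card ?I" by (simp add: card_cartesian_product)
  qed auto
  then obtain c where c: "\<exists>i\<in>?I. c i \<noteq> 0"
    "\<And>t l. t < \<delta> \<Longrightarrow> l < D \<Longrightarrow> (\<Sum>i\<in>?I. \<phi> t (p i l) * c i) = 0" by fastforce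
  define Y where "Y l v = (\<Sum>i\<in>?I. scale (c i) (p i l v))" for l v
  have p_lin: "lin (p i l)" for i l
    using power_coeff_lin[of x, OF x_so] zero_so
    by (auto simp: p_def so_iff simp del: power_coeff.simps)
  have p_skew: "B (p i l v) v' = - B v (p i l v')" for i l v v'
    by (simp add: p_def power_coeff_adjoint[OF x_so] B_simps del: power_coeff.simps)
  have Y_so: "Y l \<in> so scale B" for l
  proof -
    have "lin (Y l)" unfolding Y_def by (intro lin_sum lin_scale_fun p_lin)
    moreover have "B (Y l v) v' = - B v (Y l v')" for v v'
      by (simp add: Y_def B_sum B_simps p_skew sum_negf)
    ultimately show ?thesis by (simp add: so_iff)
  qed
  have p_comm: "(\<Sum>t\<le>l. x t (p i (l - t) v)) = (\<Sum>t\<le>l. p i (l - t) (x t v))" for i l v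
  proof (cases "snd i \<le> l")
    case False
    then have "p i (l - t) = (\<lambda>_. 0)" for t by (simp add: p_def)
    then show ?thesis by (simp add: xlin)
  next
    case True
    let ?m = "Suc (2 * fst i)"
    have "(\<Sum>t\<le>l. x t (p i (l - t) v)) = (\<Sum>t\<le>l - snd i. x t (power_coeff x ?m (l - snd i - t) v))"
      by (rule sum.mono_neutral_cong_right)
        (use True in \<open>auto simp: p_def xlin add.commute simp del: power_coeff.simps\<close>)
    also have "\<dots> = power_coeff x (Suc ?m) (l - snd i) v" by simp
    also have "\<dots> = (\<Sum>t\<le>l - snd i. power_coeff x ?m (l - snd i - t) (x t v))"
      by (rule power_coeff_Suc_right[OF x_so])
    also have "\<dots> = (\<Sum>t\<le>l. p i (l - t) (x t v))"
      by (rule sum.mono_neutral_cong_left)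
        (use True in \<open>auto simp: p_def add.commute simp del: power_coeff.simps\<close>)
    finally show ?thesis .
  qed
  have Y_comm: "(\<Sum>t\<le>l. x t (Y (l - t) v)) = (\<Sum>t\<le>l. Y (l - t) (x t v))" for l v
  proof -
    have "(\<Sum>t\<le>l. x t (Y (l - t) v)) = (\<Sum>i\<in>?I. scale (c i) (\<Sum>t\<le>l. x t (p i (l - t) v)))"
      unfolding Y_def scale_sum_right by (subst sum.swap) (simp add: xlin)
    also have "\<dots> = (\<Sum>t\<le>l. Y (l - t) (x t v))"
      unfolding p_comm Y_def scale_sum_right by (rule sum.swap)
    finally show ?thesis .
  qed
  have Y_zero: "Y l = 0" if "D \<le> l" for l
  proof -
    have "p i l v = 0" if "i \<in> ?I" for i v
      using that \<open>D \<le> l\<close> power_coeff_degree(1)[of x, OF x_so x2, of "Suc (2 * fst i)" "l - snd i"]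
      by (auto simp: p_def D_def simp del: power_coeff.simps)
    then show ?thesis by (simp add: Y_def fun_eq_iff)
  qed
  have \<phi>Y: "\<phi> t (Y l) = 0" if "t < \<delta>" "l < D" for t l
  proof -
    interpret \<phi>: Vector_Spaces.linear "fun_scale scale" "(*)" "\<phi> t" by (rule \<phi>lin)
    have "Y l = (\<Sum>i\<in>?I. fun_scale scale (c i) (p i l))"
      by (simp add: fun_eq_iff Y_def fun_scale_def sum_fun_apply)
    then have "\<phi> t (Y l) = (\<Sum>i\<in>?I. c i * \<phi> t (p i l))" by (simp only: \<phi>.sum \<phi>.scale)
    then show ?thesis using c(2)[OF that] by (simp add: mult.commute)
  qed
  \<comment> \<open>If all lower coefficients vanish, degree \<open>l\<close> says that
    \<open>Y l\<close> commutes with \<open>e\<close>, and degree \<open>Suc l\<close> makes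
    \<open>Y (Suc l)\<close> the witness \<open>y\<close> of \<open>stabiliserI\<close>;
    \<open>tridiagonal\<close> appears only in the degree after that. The conditions imposed on
    \<open>c\<close> then leave \<open>Y l = 0\<close>.\<close>
  have Y0: "Y l = 0" for l
  proof (induction l rule: less_induct)
    case (less l)
    show ?case
    proof (cases "l < D")
      case False
      then show ?thesis using Y_zero by simp
    next
      case True
      have "(\<Sum>t\<le>l. x t (Y (l - t) v)) = (\<Sum>t\<in>{0}. x t (Y (l - t) v))" for v
        by (rule sum.mono_neutral_right) (use less in \<open>auto simp: xlin\<close>)
      moreover have "(\<Sum>t\<le>l. Y (l - t) (x t v)) = (\<Sum>t\<in>{0}. Y (l - t) (x t v))" for v
        by (rule sum.mono_neutral_right) (use less in auto)
      ultimately have c0: "e (Y l v) = Y l (e v)" for v using Y_comm[of l v] by (simp add: x_def)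
      have low: "Y (Suc l - t) = 0" if "t \<in> {..Suc l} - {0, 1}" for t
        by (rule less) (use that in auto)
      have "(\<Sum>t\<le>Suc l. x t (Y (Suc l - t) v)) = (\<Sum>t\<in>{0, 1}. x t (Y (Suc l - t) v))" for v
        by (rule sum.mono_neutral_right) (use low in \<open>simp_all add: xlin\<close>)
      moreover have "(\<Sum>t\<le>Suc l. Y (Suc l - t) (x t v)) = (\<Sum>t\<in>{0, 1}. Y (Suc l - t) (x t v))" for v
        by (rule sum.mono_neutral_right) (use low in simp_all)
      ultimately have c1: "e (Y (Suc l) v) + a (Y l v) = Y (Suc l) (e v) + Y l (a v)" for v
        using Y_comm[of "Suc l" v] by (simp add: x_def)
      have "Y l \<in> ?Z" using Y_so c0 by (simp add: lie_centraliser_def commutator_def fun_eq_iff)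
      from stabiliserI[OF e a tr this Y_so c1] have "Y l \<in> ?S" .
      then show ?thesis using \<phi>sep \<phi>Y True by blast
    qed
  qed
  \<comment> \<open>The highest degree reached by a term with nonzero \<open>c\<close>. In it only
    powers of \<open>tridiagonal\<close> survive, and at most one term for each
    \<open>fst i\<close>, because \<open>snd i\<close> is then determined.\<close>
  define M where "M = Max ((\<lambda>i. snd i + 4 * fst i + 2) ` {i \<in> ?I. c i \<noteq> 0})"
  define J where "J = {i \<in> ?I. c i \<noteq> 0 \<and> snd i + 4 * fst i + 2 = M}"
  have fin: "finite {i \<in> ?I. c i \<noteq> 0}" by simp
  have "M \<in> (\<lambda>i. snd i + 4 * fst i + 2) ` {i \<in> ?I. c i \<noteq> 0}"
    unfolding M_def by (rule Max_in) (use c(1) fin in auto)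
  then have Jne: "J \<noteq> {}" by (auto simp: J_def)
  have finJ: "finite J" by (simp add: J_def)
  have top: "Y M v = (\<Sum>i\<in>J. scale (c i) ((tridiagonal ^^ Suc (2 * fst i)) v))" for v
    unfolding Y_def
  proof (rule sum.mono_neutral_cong_right)
    show "\<forall>i\<in>?I - J. scale (c i) (p i M v) = 0"
    proof
      fix i assume i: "i \<in> ?I - J"
      show "scale (c i) (p i M v) = 0"
      proof (cases "c i = 0")
        case False
        then have "snd i + 4 * fst i + 2 \<le> M" unfolding M_def using i fin by (intro Max_ge) auto
        then have "snd i + 4 * fst i + 2 < M" using i False by (auto simp: J_def)
        then show ?thesis using power_coeff_degree(1)[of x, OF x_so x2, of "Suc (2 * fst i)" "M - snd i" v]
          by (simp add: p_def del: power_coeff.simps)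
      qed simp
    qed
    fix i assume "i \<in> J"
    then have "snd i \<le> M" "M - snd i = 2 * Suc (2 * fst i)" by (auto simp: J_def)
    then show "scale (c i) (p i M v) = scale (c i) ((tridiagonal ^^ Suc (2 * fst i)) v)"
      using power_coeff_degree(2)[of x, OF x_so x2, of "Suc (2 * fst i)" v]
      by (simp add: p_def x_def del: power_coeff.simps funpow.simps)
  qed (auto simp: J_def)
  define q where "q = Max (fst ` J)"
  have "q \<in> fst ` J" unfolding q_def by (rule Max_in) (use Jne finJ in auto)
  then obtain i0 where i0: "i0 \<in> J" "fst i0 = q" by auto
  have qn: "Suc (2 * q) < n" using i0 by (auto simp: J_def r_def)
  have "B (Y M (u 0)) (u (Suc (2 * q)))
      = (\<Sum>i\<in>J. c i * B ((tridiagonal ^^ Suc (2 * fst i)) (u 0)) (u (Suc (2 * q))))"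
    unfolding top by (simp add: B_sum B_simps del: funpow.simps)
  also have "\<dots> = (\<Sum>i\<in>{i0}. c i * B ((tridiagonal ^^ Suc (2 * fst i)) (u 0)) (u (Suc (2 * q))))"
  proof (rule sum.mono_neutral_right)
    show "\<forall>i\<in>J - {i0}. c i * B ((tridiagonal ^^ Suc (2 * fst i)) (u 0)) (u (Suc (2 * q))) = 0"
    proof
      fix i assume i: "i \<in> J - {i0}"
      then have "fst i \<le> q" unfolding q_def using finJ by (intro Max_ge) auto
      moreover have "fst i \<noteq> q"
        using i i0 by (auto simp: J_def prod_eq_iff)
      ultimately have "Suc (2 * fst i) < Suc (2 * q)" by simp
      then show "c i * B ((tridiagonal ^^ Suc (2 * fst i)) (u 0)) (u (Suc (2 * q))) = 0"
        using tridiagonal_power(1)[OF n0 qn] by (simp del: funpow.simps)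
    qed
  qed (use finJ i0 in auto)
  also have "\<dots> \<noteq> 0"
    using tridiagonal_power(2)[OF n0 qn] i0 by (simp add: J_def del: funpow.simps)
  finally show False using Y0 by (simp add: B_simps)
qed

end

subsection \<open>Cartan subalgebras\<close>

context subspace_dimension
begin

lemma dim_strict_mono:
  assumes "fin_dim_subspace R" "subspace K" "K \<subseteq> R" "x \<in> R" "x \<notin> K"
  shows "dim K < dim R"
proof -
  have "dim K + card {()} \<le> dim R"
  proof (rule dim_plus_card_le[OF assms(1-3), where x = "\<lambda>_. x"])
    fix c :: "unit \<Rightarrow> 'k" and j assume s: "(\<Sum>j\<in>{()}. scale (c j) x) \<in> K"
    show "c j = 0"
    proof (rule ccontr)
      assume "c j \<noteq> 0"
      then have "scale (inverse (c ())) (scale (c ()) x) = x" by simp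
      moreover have "scale (c ()) x \<in> K" using s by simp
      then have "scale (inverse (c ())) (scale (c ()) x) \<in> K" by (rule subspace_scale[OF assms(2)])
      ultimately show False using assms(5) by simp
    qed
  qed (use assms in auto)
  then show ?thesis by simp
qed

context
  fixes T :: "'a \<Rightarrow> 'a"
  assumes T: "Vector_Spaces.linear scale scale T"
begin

lemma T_simps: "T (x + y) = T x + T y" "T (x - y) = T x - T y" "T (scale c x) = scale c (T x)" "T 0 = 0"
proof -
  interpret Vector_Spaces.linear scale scale T by fact
  show "T (x + y) = T x + T y" "T (x - y) = T x - T y" "T (scale c x) = scale c (T x)" "T 0 = 0"
    by (simp_all add: add diff scale zero)
qed

lemma funpow_simps:
  "(T ^^ m) (x + y) = (T ^^ m) x + (T ^^ m) y" "(T ^^ m) (x - y) = (T ^^ m) x - (T ^^ m) y"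
  "(T ^^ m) (scale c x) = scale c ((T ^^ m) x)" "(T ^^ m) 0 = 0"
  by (induction m) (simp_all add: T_simps)

lemma funpow_vanish_mono: "(T ^^ i) x = 0 \<Longrightarrow> i \<le> j \<Longrightarrow> (T ^^ j) x = 0"
proof -
  assume "(T ^^ i) x = 0" "i \<le> j"
  moreover have "(T ^^ j) x = (T ^^ (j - i)) ((T ^^ i) x)"
    using \<open>i \<le> j\<close> funpow_add[of "j - i" i T] by simp
  ultimately show ?thesis by (simp add: funpow_simps)
qed

lemma subspace_funpow_image: "subspace Y \<Longrightarrow> subspace ((T ^^ m) ` Y)"
proof (rule subspaceI)
  assume Y: "subspace Y"
  show "0 \<in> (T ^^ m) ` Y" by (rule image_eqI[of _ _ 0]) (simp_all add: funpow_simps subspace_0[OF Y])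
  show "a + b \<in> (T ^^ m) ` Y" if "a \<in> (T ^^ m) ` Y" "b \<in> (T ^^ m) ` Y" for a b
    using that subspace_add[OF Y] by (auto simp flip: funpow_simps(1))
  show "scale c a \<in> (T ^^ m) ` Y" if "a \<in> (T ^^ m) ` Y" for c a
    using that subspace_scale[OF Y] by (auto simp flip: funpow_simps(3))
qed

lemma image_stabilises:
  assumes Y: "fin_dim_subspace Y" and st: "\<And>y. y \<in> Y \<Longrightarrow> T y \<in> Y"
  obtains N where "\<And>m. (T ^^ (N + m)) ` Y = (T ^^ N) ` Y"
proof -
  have sY: "subspace Y" using Y by (simp add: fin_dim_subspace_def)
  have stp: "(T ^^ m) y \<in> Y" if "y \<in> Y" for m y using that st by (induction m) auto
  define N where "N = (ARG_MIN (\<lambda>m. dim ((T ^^ m) ` Y)) m. True)"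
  have min: "dim ((T ^^ N) ` Y) \<le> dim ((T ^^ m) ` Y)" for m
    unfolding N_def by (rule arg_min_nat_le) simp
  have "(T ^^ (N + m)) ` Y = (T ^^ N) ` Y" for m
  proof (rule ccontr)
    assume ne: "(T ^^ (N + m)) ` Y \<noteq> (T ^^ N) ` Y"
    have sub: "(T ^^ (N + m)) ` Y \<subseteq> (T ^^ N) ` Y" using stp by (auto simp: funpow_add)
    then obtain x where x: "x \<in> (T ^^ N) ` Y" "x \<notin> (T ^^ (N + m)) ` Y" using ne by blast
    have "fin_dim_subspace ((T ^^ N) ` Y)"
      by (rule fin_dim_subspace_mono[OF Y subspace_funpow_image[OF sY]]) (use stp in auto)
    from dim_strict_mono[OF this subspace_funpow_image[OF sY] sub x] min[of "N + m"] show False by simp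
  qed
  then show thesis using that by blast
qed

end

text \<open>Exactness of the joint generalised null space of a family of operators: an element that is
  nilpotent modulo \<open>Y\<close> lifts to a nilpotent one. If some \<open>T\<close> is not nilpotent on \<open>X\<close>, the Fitting
  decomposition of \<open>Y\<close> for \<open>T\<close> moves the element into the generalised null space of \<open>T\<close> in \<open>X\<close>.\<close>

lemma nilpotent_lift:
  assumes lin: "\<And>T. T \<in> \<T> \<Longrightarrow> Vector_Spaces.linear scale scale T"
    and X: "fin_dim_subspace X" "\<And>T z. T \<in> \<T> \<Longrightarrow> z \<in> X \<Longrightarrow> T z \<in> X"
    and Y: "subspace Y" "Y \<subseteq> X" "\<And>T z. T \<in> \<T> \<Longrightarrow> z \<in> Y \<Longrightarrow> T z \<in> Y"
    and null: "\<And>T T' z. T \<in> \<T> \<Longrightarrow> T' \<in> \<T> \<Longrightarrow> z \<in> X \<Longrightarrow> \<exists>m. (T ^^ m) z = 0 \<Longrightarrow> \<exists>m. (T ^^ m) (T' z) = 0"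
    and x: "x \<in> X" "\<And>T. T \<in> \<T> \<Longrightarrow> \<exists>m. (T ^^ m) x \<in> Y"
  shows "\<exists>x0\<in>X. (\<forall>T\<in>\<T>. \<exists>m. (T ^^ m) x0 = 0) \<and> x - x0 \<in> Y"
  using X Y null x
proof (induction "dim X" arbitrary: X Y x rule: less_induct)
  case (less X Y x)
  note X = less.prems(1,2) and Y = less.prems(3-5) and null = less.prems(6) and x = less.prems(7,8)
  have sX: "subspace X" using X(1) by (simp add: fin_dim_subspace_def)
  show ?case
  proof (cases "\<forall>T\<in>\<T>. \<forall>z\<in>X. \<exists>m. (T ^^ m) z = 0")
    case True
    then show ?thesis using x(1) subspace_0[OF Y(1)] by (intro bexI[of _ x]) auto
  next
    case False
    then obtain T z where T: "T \<in> \<T>" and z: "z \<in> X" "\<And>m. (T ^^ m) z \<noteq> 0" by blast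
    note Ts = funpow_simps[OF lin[OF T]] and Tv = funpow_vanish_mono[OF lin[OF T]]
    define X0 where "X0 = {z \<in> X. \<exists>m. (T ^^ m) z = 0}"
    have sX0: "subspace X0"
    proof (rule subspaceI)
      show "0 \<in> X0" using subspace_0[OF sX] by (auto simp: X0_def intro: exI[of _ 0])
      fix y y' assume "y \<in> X0" "y' \<in> X0"
      then obtain i j where "y \<in> X" "y' \<in> X" "(T ^^ i) y = 0" "(T ^^ j) y' = 0" by (auto simp: X0_def)
      then have "(T ^^ (i + j)) (y + y') = 0" using Tv[of i y "i + j"] Tv[of j y' "i + j"] by (simp add: Ts)
      then show "y + y' \<in> X0" using \<open>y \<in> X\<close> \<open>y' \<in> X\<close> subspace_add[OF sX] by (auto simp: X0_def)
    next
      fix c y assume "y \<in> X0"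
      then show "scale c y \<in> X0" using subspace_scale[OF sX] by (auto simp: X0_def Ts)
    qed
    have X0X: "X0 \<subseteq> X" by (auto simp: X0_def)
    have fX0: "fin_dim_subspace X0" by (rule fin_dim_subspace_mono[OF X(1) sX0 X0X])
    have less_dim: "dim X0 < dim X"
      by (rule dim_strict_mono[OF X(1) sX0 X0X z(1)]) (use z in \<open>auto simp: X0_def\<close>)
    obtain m where m: "(T ^^ m) x \<in> Y" using x(2)[OF T] by blast
    have fY: "fin_dim_subspace Y" by (rule fin_dim_subspace_mono[OF X(1) Y(1,2)])
    obtain N where N: "\<And>m. (T ^^ (N + m)) ` Y = (T ^^ N) ` Y"
      using image_stabilises[OF lin[OF T] fY Y(3)[OF T]] by blast
    have "(T ^^ (N + m)) x \<in> (T ^^ N) ` Y" using m by (simp add: funpow_add)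
    \<comment> \<open>On \<open>Y\<close> the maps \<open>T ^^ (N + m)\<close> and
      \<open>T ^^ N\<close> have the same image, so subtracting some \<open>y\<close> from
      \<open>x\<close> makes it nilpotent for \<open>T\<close> without changing its class modulo
      \<open>Y\<close>. The induction continues in \<open>X0\<close>, which is proper because of
      \<open>z\<close>.\<close>
    then obtain y where y: "y \<in> Y" "(T ^^ (N + m)) x = (T ^^ (N + m)) y" using N[of m] by auto
    define a where "a = x - y"
    have aX: "a \<in> X" using x(1) y(1) Y(2) subspace_diff[OF sX] by (auto simp: a_def)
    have "(T ^^ (N + m)) a = 0" using y(2) by (simp add: a_def Ts)
    then have aX0: "a \<in> X0" using aX by (auto simp: X0_def)
    have stX0: "T' y \<in> X0" if "T' \<in> \<T>" "y \<in> X0" for T' y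
      using that X(2) null[OF T that(1)] by (auto simp: X0_def)
    have "\<exists>x0\<in>X0. (\<forall>T\<in>\<T>. \<exists>m. (T ^^ m) x0 = 0) \<and> a - x0 \<in> Y \<inter> X0"
    proof (rule less.hyps[OF less_dim fX0])
      show "subspace (Y \<inter> X0)" using Y(1) sX0 by (simp add: subspace_inter)
      show "\<exists>m. (T1 ^^ m) a \<in> Y \<inter> X0" if T1: "T1 \<in> \<T>" for T1
      proof -
        obtain j where "(T1 ^^ j) x \<in> Y" using x(2)[OF T1] by blast
        moreover have "(T1 ^^ j) y \<in> Y" using y(1) Y(3)[OF T1] by (induction j) auto
        ultimately have "(T1 ^^ j) a \<in> Y"
          using subspace_diff[OF Y(1)] by (simp add: a_def funpow_simps[OF lin[OF T1]])
        moreover have "(T1 ^^ j) a \<in> X0" using aX0 stX0[OF T1] by (induction j) auto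
        ultimately show ?thesis by blast
      qed
      show "\<exists>m. (T1 ^^ m) (T2 z) = 0" if "T1 \<in> \<T>" "T2 \<in> \<T>" "z \<in> X0" "\<exists>m. (T1 ^^ m) z = 0" for T1 T2 z
        using null[OF that(1,2) _ that(4)] that(3) X0X by blast
    qed (use Y stX0 aX0 in auto)
    then obtain x0 where x0: "x0 \<in> X0" "\<forall>T\<in>\<T>. \<exists>m. (T ^^ m) x0 = 0" "a - x0 \<in> Y" by blast
    have "x - x0 = (a - x0) + y" by (simp add: a_def)
    then have "x - x0 \<in> Y" using subspace_add[OF Y(1) x0(3) y(1)] by (simp only:)
    then show ?thesis using x0 X0X by blast
  qed
qed

end

section \<open>Nilpotency of inner derivations\<close>

context orthogonal_space
begin

lemma commutator_linear:
  assumes "lin h"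
  shows "Vector_Spaces.linear (fun_scale scale) (fun_scale scale) (commutator h)"
  unfolding Vector_Spaces.linear_iff
  using F.vector_space_axioms
  by (simp add: commutator_def fun_scale_def fun_eq_iff linD[OF assms] scale_right_diff_distrib)

lemma commutator_lin: "lin h \<Longrightarrow> lin x \<Longrightarrow> lin (commutator h x)"
  by (rule linear_comm)

lemma commutator_funpow_lin: "lin h \<Longrightarrow> lin x \<Longrightarrow> lin ((commutator h ^^ m) x)"
  by (induction m) (auto intro: commutator_lin)

lemmas ad_funpow_simps = F.funpow_simps[OF commutator_linear]
lemmas ad_vanish_mono = F.funpow_vanish_mono[OF commutator_linear]

lemma commutator_compose:
  assumes "lin x"
  shows "commutator h (\<lambda>v. x (y v)) = (\<lambda>v. commutator h x (y v)) + (\<lambda>v. x (commutator h y v))"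
  by (simp add: commutator_def fun_eq_iff linD[OF assms])

text \<open>Leibniz rule for the derivation \<open>commutator h\<close>: at order
  \<open>i + j\<close> one factor of each term has been differentiated often enough to vanish.
  Induction on \<open>i + j\<close> dispenses with binomial coefficients.\<close>

lemma ad_nilpotent_compose:
  assumes h: "lin h" and x: "lin x" and "(commutator h ^^ i) x = 0" "(commutator h ^^ j) y = 0"
  shows "(commutator h ^^ (i + j)) (\<lambda>v. x (y v)) = 0"
  using assms
proof (induction "i + j" arbitrary: i j x y)
  case 0
  then show ?case by (simp add: fun_eq_iff)
next
  case (Suc l)
  show ?case
  proof (cases "i = 0 \<or> j = 0")
    case True
    have "(\<lambda>v. x (y v)) = 0" using True Suc.prems by (auto simp: fun_eq_iff linD)
    then show ?thesis using h by (simp add: ad_funpow_simps)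
  next
    case False
    then obtain i' j' where ij: "i = Suc i'" "j = Suc j'" by (meson not0_implies_Suc)
    have l: "l = i' + j" "l = i + j'" using Suc.hyps(2) ij by auto
    have "(commutator h ^^ (i' + j)) (\<lambda>v. commutator h x (y v)) = 0"
      using Suc.prems ij by (intro Suc.hyps(1)[OF l(1)]) (auto intro: commutator_lin simp: funpow_swap1)
    moreover have "(commutator h ^^ (i + j')) (\<lambda>v. x (commutator h y v)) = 0"
      using Suc.prems ij by (intro Suc.hyps(1)[OF l(2)]) (auto simp: funpow_swap1)
    ultimately have "(commutator h ^^ l) (commutator h (\<lambda>v. x (y v))) = 0"
      using l by (simp add: commutator_compose[OF x] Suc.prems(2) commutator_compose ad_funpow_simps[OF h])
    then show ?thesis by (simp add: Suc.hyps(2)[symmetric] funpow_swap1)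
  qed
qed

lemma ad_nilpotent_apply:
  assumes h: "lin h" and x: "lin x" and "(commutator h ^^ i) x = 0" "(h ^^ j) v = 0"
  shows "(h ^^ (i + j)) (x v) = 0"
  using assms
proof (induction "i + j" arbitrary: i j x v)
  case 0
  then show ?case by simp
next
  case (Suc l)
  show ?case
  proof (cases "i = 0 \<or> j = 0")
    case True
    then have "x v = 0" using Suc.prems by (auto simp: linD)
    then show ?thesis using linD(4)[OF lin_funpow[OF h]] by simp
  next
    case False
    then obtain i' j' where ij: "i = Suc i'" "j = Suc j'" by (meson not0_implies_Suc)
    have l: "l = i' + j" "l = i + j'" using Suc.hyps(2) ij by auto
    have "(h ^^ (i' + j)) (commutator h x v) = 0"
      using Suc.prems ij by (intro Suc.hyps(1)[OF l(1)]) (auto intro: commutator_lin simp: funpow_swap1)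
    moreover have "(h ^^ (i + j')) (x (h v)) = 0"
      using Suc.prems ij by (intro Suc.hyps(1)[OF l(2)]) (auto simp: funpow_swap1)
    ultimately have "(h ^^ l) (commutator h x v + x (h v)) = 0"
      using l linD(1)[OF lin_funpow[OF h]] by simp
    then show ?thesis by (simp add: commutator_def Suc.hyps(2)[symmetric] funpow_swap1)
  qed
qed

definition wedge :: "'v \<Rightarrow> 'v \<Rightarrow> 'v \<Rightarrow> 'v" where
  "wedge p q v = scale (B v p) q - scale (B v q) p"

lemma wedge_so: "wedge p q \<in> so scale B"
  unfolding so_iff
proof (intro conjI allI)
  show "lin (wedge p q)" unfolding wedge_def by (intro lin_diff_fun lin_B_scale)
  show "B (wedge p q u) v = - B u (wedge p q v)" for u v
    by (simp add: wedge_def B_simps symmetric[of _ v] algebra_simps)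
qed

lemma commutator_wedge:
  assumes "h \<in> so scale B"
  shows "commutator h (wedge p q) = wedge (h p) q + wedge p (h q)"
  by (simp add: commutator_def fun_eq_iff wedge_def linD[OF so_lin[OF assms]] so_skew[OF assms] scale_left_diff_distrib)

lemma ad_nilpotent_wedge:
  assumes h: "h \<in> so scale B" and "(h ^^ i) p = 0" "(h ^^ j) q = 0"
  shows "(commutator h ^^ (i + j)) (wedge p q) = 0"
  using assms(2,3)
proof (induction "i + j" arbitrary: i j p q)
  case 0
  then show ?case by (simp add: fun_eq_iff wedge_def B_simps)
next
  case (Suc l)
  show ?case
  proof (cases "i = 0 \<or> j = 0")
    case True
    then have "wedge p q = 0" using Suc.prems by (auto simp: fun_eq_iff wedge_def B_simps)
    then show ?thesis using so_lin[OF h] by (simp add: ad_funpow_simps)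
  next
    case False
    then obtain i' j' where ij: "i = Suc i'" "j = Suc j'" by (meson not0_implies_Suc)
    have l: "l = i' + j" "l = i + j'" using Suc.hyps(2) ij by auto
    have "(commutator h ^^ (i' + j)) (wedge (h p) q) = 0"
      using Suc.prems ij by (intro Suc.hyps(1)[OF l(1)]) (auto simp: funpow_swap1)
    moreover have "(commutator h ^^ (i + j')) (wedge p (h q)) = 0"
      using Suc.prems ij by (intro Suc.hyps(1)[OF l(2)]) (auto simp: funpow_swap1)
    ultimately have "(commutator h ^^ l) (commutator h (wedge p q)) = 0"
      using l by (simp add: commutator_wedge[OF h] ad_funpow_simps[OF so_lin[OF h]])
    then show ?thesis by (simp add: Suc.hyps(2)[symmetric] funpow_swap1)
  qed
qed

end

section \<open>A Cartan subalgebra of plane rotations\<close>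

context orthogonal_basis
begin

definition plane_rotation :: "(nat \<Rightarrow> 'k) \<Rightarrow> 'v \<Rightarrow> 'v" where
  "plane_rotation c v = (\<Sum>i<n div 2. scale (c i) (wedge (u (2 * i)) (u (Suc (2 * i))) v))"

lemma plane_rotation_so: "plane_rotation c \<in> so scale B"
  unfolding so_iff
proof (intro conjI allI)
  show "lin (plane_rotation c)"
    unfolding plane_rotation_def by (intro lin_sum lin_scale_fun so_lin wedge_so)
  show "B (plane_rotation c v) v' = - B v (plane_rotation c v')" for v v'
    by (simp add: plane_rotation_def B_sum B_simps so_skew[OF wedge_so] sum_negf)
qed

lemma plane_rotation_u:
  "i < n div 2 \<Longrightarrow> plane_rotation c (u (2 * i)) = scale (c i * g (2 * i)) (u (Suc (2 * i)))"
  "i < n div 2 \<Longrightarrow> plane_rotation c (u (Suc (2 * i))) = scale (- (c i * g (Suc (2 * i)))) (u (2 * i))"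
  "odd n \<Longrightarrow> plane_rotation c (u (n - 1)) = 0"
proof -
  have lt: "2 * j < n" "Suc (2 * j) < n" if "j < n div 2" for j using that by auto
  show "plane_rotation c (u (2 * i)) = scale (c i * g (2 * i)) (u (Suc (2 * i)))" if i: "i < n div 2"
  proof -
    have "plane_rotation c (u (2 * i))
        = (\<Sum>j<n div 2. if j = i then scale (c i * g (2 * i)) (u (Suc (2 * i))) else 0)"
      unfolding plane_rotation_def
    proof (rule sum.cong[OF refl])
      fix j assume "j \<in> {..<n div 2}"
      moreover have "2 * i \<noteq> Suc (2 * j)" by presburger
      ultimately show "scale (c j) (wedge (u (2 * j)) (u (Suc (2 * j))) (u (2 * i)))
          = (if j = i then scale (c i * g (2 * i)) (u (Suc (2 * i))) else 0)"
        using lt[of j] lt[OF i] by (simp add: wedge_def B_u)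
    qed
    then show ?thesis using i by simp
  qed
  show "plane_rotation c (u (Suc (2 * i))) = scale (- (c i * g (Suc (2 * i)))) (u (2 * i))" if i: "i < n div 2"
  proof -
    have "plane_rotation c (u (Suc (2 * i)))
        = (\<Sum>j<n div 2. if j = i then scale (- (c i * g (Suc (2 * i)))) (u (2 * i)) else 0)"
      unfolding plane_rotation_def
    proof (rule sum.cong[OF refl])
      fix j assume "j \<in> {..<n div 2}"
      moreover have "Suc (2 * i) \<noteq> 2 * j" by presburger
      ultimately show "scale (c j) (wedge (u (2 * j)) (u (Suc (2 * j))) (u (Suc (2 * i))))
          = (if j = i then scale (- (c i * g (Suc (2 * i)))) (u (2 * i)) else 0)"
        using lt[of j] lt[OF i] by (simp add: wedge_def B_u)
    qed
    then show ?thesis using i by simp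
  qed
  show "plane_rotation c (u (n - 1)) = 0" if "odd n"
    unfolding plane_rotation_def
  proof (rule sum.neutral, rule ballI)
    fix j assume "j \<in> {..<n div 2}"
    then have "Suc (2 * j) < n - 1 \<and> n - 1 < n" using that by auto presburger
    then show "scale (c j) (wedge (u (2 * j)) (u (Suc (2 * j))) (u (n - 1))) = 0"
      by (simp add: wedge_def B_u)
  qed
qed

lemma eq_on_planes:
  assumes "lin x" "lin y" "\<And>i. i < n div 2 \<Longrightarrow> x (u (2 * i)) = y (u (2 * i))"
    "\<And>i. i < n div 2 \<Longrightarrow> x (u (Suc (2 * i))) = y (u (Suc (2 * i)))"
    "odd n \<Longrightarrow> x (u (n - 1)) = y (u (n - 1))"
  shows "x = y"
proof -
  have "(\<lambda>v. x v - y v) = 0"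
  proof (rule lin_eq_zero)
    show "lin (\<lambda>v. x v - y v)" by (rule lin_diff_fun[OF assms(1,2)])
    fix a assume a: "a < n"
    have "(a = 2 * (a div 2) \<or> a = Suc (2 * (a div 2))) \<and> a div 2 < n div 2 \<or> (odd n \<and> a = n - 1)"
      using a by presburger
    then have "(\<exists>i<n div 2. a = 2 * i \<or> a = Suc (2 * i)) \<or> (odd n \<and> a = n - 1)" by blast
    then show "x (u a) - y (u a) = 0" using assms(3-5) by auto
  qed
  then show ?thesis by (simp add: fun_eq_iff)
qed

definition standard_cartan :: "('v \<Rightarrow> 'v) set" where
  "standard_cartan = range plane_rotation"

lemma standard_cartan_commute:
  assumes "x \<in> standard_cartan" "y \<in> standard_cartan"
  shows "commutator x y = 0"
proof -
  obtain c c' where xy: "x = plane_rotation c" "y = plane_rotation c'"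
    using assms by (auto simp: standard_cartan_def)
  note lins = so_lin[OF plane_rotation_so]
  have "(\<lambda>v. plane_rotation c (plane_rotation c' v)) = (\<lambda>v. plane_rotation c' (plane_rotation c v))"
  proof (rule eq_on_planes)
    show "plane_rotation c (plane_rotation c' (u (2 * i))) = plane_rotation c' (plane_rotation c (u (2 * i)))"
      if "i < n div 2" for i
      by (simp add: that plane_rotation_u linD[OF lins]; simp add: mult_ac)
    show "plane_rotation c (plane_rotation c' (u (Suc (2 * i))))
        = plane_rotation c' (plane_rotation c (u (Suc (2 * i))))" if "i < n div 2" for i
      by (simp add: that plane_rotation_u linD[OF lins]; simp add: mult_ac)
    show "plane_rotation c (plane_rotation c' (u (n - 1))) = plane_rotation c' (plane_rotation c (u (n - 1)))"
      if "odd n"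
      unfolding plane_rotation_u(3)[OF that] linD(4)[OF lins] ..
  qed (rule lin_compose[OF lins lins])+
  then show ?thesis using xy by (simp add: commutator_def fun_eq_iff)
qed

lemma standard_cartan_subspace: "F.subspace standard_cartan"
proof (rule F.subspaceI)
  show "0 \<in> standard_cartan"
    unfolding standard_cartan_def by (rule image_eqI[of _ _ "\<lambda>_. 0"]) (auto simp: plane_rotation_def fun_eq_iff)
next
  fix x y assume "x \<in> standard_cartan" "y \<in> standard_cartan"
  then obtain c c' where "x = plane_rotation c" "y = plane_rotation c'" by (auto simp: standard_cartan_def)
  then have "x + y = plane_rotation (\<lambda>i. c i + c' i)"
    by (simp add: plane_rotation_def fun_eq_iff scale_left_distrib sum.distrib)
  then show "x + y \<in> standard_cartan" by (auto simp: standard_cartan_def)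
next
  fix a x assume "x \<in> standard_cartan"
  then obtain c where "x = plane_rotation c" by (auto simp: standard_cartan_def)
  then have "fun_scale scale a x = plane_rotation (\<lambda>i. a * c i)"
    by (simp add: plane_rotation_def fun_eq_iff fun_scale_def scale_sum_right)
  then show "fun_scale scale a x \<in> standard_cartan" by (auto simp: standard_cartan_def)
qed

text \<open>The bracket of \<open>x\<close> with an elementary rotation \<open>J\<close> stays
  within the planes. As \<open>J\<close> takes its values in its own plane, \<open>x\<close> cannot
  mix that plane with the other basis vectors; what is left of \<open>x\<close> is a rotation in
  each plane.\<close>

lemma standard_cartan_normaliser:
  assumes x: "x \<in> so scale B" and norm: "\<And>y. y \<in> standard_cartan \<Longrightarrow> commutator x y \<in> standard_cartan"
  shows "x \<in> standard_cartan"
proof -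
  note lx = linD[OF so_lin[OF x]]
  define X where "X a b = B (x (u a)) (u b)" for a b
  have Xskew: "X a b = - X b a" for a b
    using so_skew[OF x, of "u a" "u b"] symmetric[of "u a"] by (simp add: X_def)
  have Xdiag: "X a a = 0" for a using Xskew[of a a] eq_uminus_self_iff by blast
  have off: "X (2 * i) b = 0 \<and> X (Suc (2 * i)) b = 0"
    if i: "i < n div 2" and b: "b < n" "b \<noteq> 2 * i" "b \<noteq> Suc (2 * i)" for i b
  proof -
    define J where "J = wedge (u (2 * i)) (u (Suc (2 * i)))"
    have lt: "2 * i < n" "Suc (2 * i) < n" using i by auto
    have "J = plane_rotation (\<lambda>j. if j = i then 1 else 0)"
    proof
      fix v
      have "plane_rotation (\<lambda>j. if j = i then 1 else 0) v = (\<Sum>j<n div 2. if j = i then J v else 0)"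
        unfolding plane_rotation_def by (rule sum.cong) (auto simp: J_def)
      then show "J v = plane_rotation (\<lambda>j. if j = i then 1 else 0) v" using i by simp
    qed
    then have "J \<in> standard_cartan" by (simp add: standard_cartan_def)
    then obtain c where c: "commutator x J = plane_rotation c"
      using norm by (auto simp: standard_cartan_def)
    have "B (commutator x J (u (2 * i))) (u b) = 0" "B (commutator x J (u (Suc (2 * i)))) (u b) = 0"
      unfolding c using i lt b by (simp_all add: plane_rotation_u B_simps B_uminus B_u)
    moreover have "commutator x J (u (2 * i))
        = scale (g (2 * i)) (x (u (Suc (2 * i)))) - J (x (u (2 * i)))"
      "commutator x J (u (Suc (2 * i)))
        = - scale (g (Suc (2 * i))) (x (u (2 * i))) - J (x (u (Suc (2 * i))))"
      using lt by (simp_all add: commutator_def J_def wedge_def B_u lx)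
    moreover have "B (J v) (u b) = 0" for v using lt b by (simp add: J_def wedge_def B_simps B_u)
    ultimately show ?thesis using g_nonzero[OF lt(1)] g_nonzero[OF lt(2)]
      by (simp add: B_simps B_uminus X_def)
  qed
  define c where "c i = X (2 * i) (Suc (2 * i)) / (g (2 * i) * g (Suc (2 * i)))" for i
  have "x = plane_rotation c"
  proof (rule eq_on_planes[OF so_lin[OF x] so_lin[OF plane_rotation_so]])
    fix i assume i: "i < n div 2"
    have lt: "2 * i < n" "Suc (2 * i) < n" using i by auto
    have "x (u (2 * i)) - plane_rotation c (u (2 * i)) = 0"
    proof (rule complete)
      fix b assume b: "b < n"
      show "B (x (u (2 * i)) - plane_rotation c (u (2 * i))) (u b) = 0"
        using off[OF i b] Xdiag[of "2 * i"] g_nonzero[OF lt(1)] g_nonzero[OF lt(2)] lt b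
        by (cases "b = 2 * i"; cases "b = Suc (2 * i)")
          (auto simp: plane_rotation_u(1,2)[OF i] B_simps B_uminus B_u X_def c_def)
    qed
    then show "x (u (2 * i)) = plane_rotation c (u (2 * i))" by simp
    have "x (u (Suc (2 * i))) - plane_rotation c (u (Suc (2 * i))) = 0"
    proof (rule complete)
      fix b assume b: "b < n"
      show "B (x (u (Suc (2 * i))) - plane_rotation c (u (Suc (2 * i)))) (u b) = 0"
        using off[OF i b] Xdiag[of "Suc (2 * i)"] Xskew[of "Suc (2 * i)" "2 * i"]
          g_nonzero[OF lt(1)] g_nonzero[OF lt(2)] lt b
        by (cases "b = 2 * i"; cases "b = Suc (2 * i)")
          (auto simp: plane_rotation_u(1,2)[OF i] B_simps B_uminus B_u X_def c_def)
    qed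
    then show "x (u (Suc (2 * i))) = plane_rotation c (u (Suc (2 * i)))" by simp
  next
    assume odd: "odd n"
    have "x (u (n - 1)) = 0"
    proof (rule complete)
      fix b assume b: "b < n"
      have "(b = 2 * (b div 2) \<or> b = Suc (2 * (b div 2))) \<and> b div 2 < n div 2 \<or> b = n - 1"
        using b odd by presburger
      then have "(\<exists>i<n div 2. b = 2 * i \<or> b = Suc (2 * i)) \<or> b = n - 1" by blast
      moreover have "X (2 * i) (n - 1) = 0 \<and> X (Suc (2 * i)) (n - 1) = 0" if "i < n div 2" for i
      proof -
        have "2 * i < n - 1" "Suc (2 * i) < n - 1" "n - 1 < n" using that odd by presburger+
        then show ?thesis by (intro off[OF that]) auto
      qed
      ultimately have "X b (n - 1) = 0" using Xdiag by auto
      then have "X (n - 1) b = 0" using Xskew[of "n - 1" b] by simp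
      then show "B (x (u (n - 1))) (u b) = 0" by (simp add: X_def)
    qed
    then show "x (u (n - 1)) = plane_rotation c (u (n - 1))" using plane_rotation_u(3)[OF odd] by simp
  qed
  then show ?thesis by (simp add: standard_cartan_def)
qed

theorem standard_cartan:
  "cartan_subalgebra (fun_scale scale) commutator (so scale B) standard_cartan"
  "F.dim standard_cartan \<le> n div 2"
proof -
  have sub: "standard_cartan \<subseteq> so scale B" using plane_rotation_so by (auto simp: standard_cartan_def)
  have z: "0 \<in> standard_cartan" by (rule F.subspace_0[OF standard_cartan_subspace])
  have "{commutator x y |x y. x \<in> standard_cartan \<and> y \<in> standard_cartan} = {0}"
    using z standard_cartan_commute by fastforce
  then have "lower_central_series (fun_scale scale) commutator standard_cartan 1 = {0}"
    by simp
  then have "nilpotent_lie_algebra (fun_scale scale) commutator standard_cartan"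
    unfolding nilpotent_lie_algebra_def by blast
  moreover have "lie_normaliser commutator (so scale B) standard_cartan = standard_cartan"
  proof
    show "lie_normaliser commutator (so scale B) standard_cartan \<subseteq> standard_cartan"
      using standard_cartan_normaliser by (auto simp: lie_normaliser_def)
    show "standard_cartan \<subseteq> lie_normaliser commutator (so scale B) standard_cartan"
      using sub z standard_cartan_commute by (auto simp: lie_normaliser_def)
  qed
  ultimately show "cartan_subalgebra (fun_scale scale) commutator (so scale B) standard_cartan"
    using sub standard_cartan_subspace z standard_cartan_commute by (simp add: cartan_subalgebra_def)
  have "F.dim standard_cartan \<le> card {..<n div 2}"
  proof (rule F.dim_le_separating_functionals(1)[OF standard_cartan_subspace,
        where \<phi> = "\<lambda>i x. B (x (u (2 * i))) (u (Suc (2 * i)))"])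
    fix x assume x: "x \<in> standard_cartan"
      and zero: "\<And>i. i \<in> {..<n div 2} \<Longrightarrow> B (x (u (2 * i))) (u (Suc (2 * i))) = 0"
    then obtain c where c: "x = plane_rotation c" by (auto simp: standard_cartan_def)
    have "c i = 0" if "i < n div 2" for i
    proof -
      have "2 * i < n" "Suc (2 * i) < n" using that by auto
      then show ?thesis using zero[of i] that g_nonzero
        by (simp add: c plane_rotation_u B_simps B_u)
    qed
    then show "x = 0" by (simp add: c fun_eq_iff plane_rotation_def)
  qed (auto simp: B_simps fun_scale_def)
  then show "F.dim standard_cartan \<le> n div 2" by simp
qed

end

section \<open>An arbitrary Cartan subalgebra and its joint generalised null space\<close>

locale cartan_in_so = orthogonal_basis scale Basis B u n
  for scale :: "'k::field \<Rightarrow> 'v::ab_group_add \<Rightarrow> 'v" and Basis :: "'v set"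
    and B :: "'v \<Rightarrow> 'v \<Rightarrow> 'k" and u :: "nat \<Rightarrow> 'v" and n :: nat +
  fixes H :: "('v \<Rightarrow> 'v) set"
  assumes cartan: "cartan_subalgebra (fun_scale scale) commutator (so scale B) H"
begin

lemma H_so: "x \<in> H \<Longrightarrow> x \<in> so scale B"
  and H_subspace: "F.subspace H"
  and H_closed: "x \<in> H \<Longrightarrow> y \<in> H \<Longrightarrow> commutator x y \<in> H"
  and H_normaliser: "x \<in> so scale B \<Longrightarrow> (\<And>y. y \<in> H \<Longrightarrow> commutator x y \<in> H) \<Longrightarrow> x \<in> H"
  using cartan by (auto simp: cartan_subalgebra_def lie_normaliser_def)

lemma H_lin: "x \<in> H \<Longrightarrow> lin x"
  by (rule so_lin[OF H_so])

abbreviation lcs :: "nat \<Rightarrow> ('v \<Rightarrow> 'v) set" where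
  "lcs \<equiv> lower_central_series (fun_scale scale) commutator H"

lemma lcs_Suc_mem: "x \<in> H \<Longrightarrow> y \<in> lcs i \<Longrightarrow> commutator x y \<in> lcs (Suc i)"
  by (auto intro!: F.span_base)

lemma lcs_subspace: "F.subspace (lcs i)"
  using H_subspace by (cases i) auto

lemma lcs_decreasing: "lcs (Suc i) \<subseteq> lcs i"
proof (induction i)
  case 0
  show ?case
    unfolding lower_central_series.simps by (rule F.span_minimal) (use H_closed H_subspace in auto)
next
  case (Suc i)
  have "{commutator x y |x y. x \<in> H \<and> y \<in> lcs (Suc i)} \<subseteq> {commutator x y |x y. x \<in> H \<and> y \<in> lcs i}"
    using Suc by blast
  from F.span_mono[OF this] show ?case by (simp only: lower_central_series.simps)
qed

lemma lcs_subset: "lcs i \<subseteq> H"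
  using lcs_decreasing by (induction i) (simp, blast)

lemma lcs_zero: "\<exists>m. lcs m = {0}"
  using cartan by (simp add: cartan_subalgebra_def nilpotent_lie_algebra_def)

lemma ad_nilpotent_H:
  assumes "h \<in> H" "x \<in> H"
  shows "\<exists>m. (commutator h ^^ m) x = 0"
proof -
  have "(commutator h ^^ m) x \<in> lcs m" for m
    using assms lcs_Suc_mem by (induction m) (simp_all del: lower_central_series.simps(2))
  then show ?thesis using lcs_zero by blast
qed

text \<open>By the Leibniz rule this is an associative algebra. Passing to it from \<open>H\<close>
  makes products, projections and adjoints available; skew elements return to \<open>H\<close> in
  the end.\<close>

definition E0 :: "('v \<Rightarrow> 'v) set" where
  "E0 = {x. lin x \<and> (\<forall>h\<in>H. \<exists>m. (commutator h ^^ m) x = 0)}"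

lemma E0_lin: "x \<in> E0 \<Longrightarrow> lin x"
  by (simp add: E0_def)

lemma H_E0: "h \<in> H \<Longrightarrow> h \<in> E0"
  using ad_nilpotent_H H_lin by (simp add: E0_def)

lemma E0_compose: "x \<in> E0 \<Longrightarrow> y \<in> E0 \<Longrightarrow> (\<lambda>v. x (y v)) \<in> E0"
  unfolding E0_def using ad_nilpotent_compose[OF H_lin] lin_compose by blast

lemma E0_subspace: "F.subspace E0"
proof (rule F.subspaceI)
  show "0 \<in> E0" by (auto simp: E0_def lin_iff intro!: exI[of _ 0])
  fix x y assume x: "x \<in> E0" and y: "y \<in> E0"
  have "\<exists>m. (commutator h ^^ m) (x + y) = 0" if h: "h \<in> H" for h
  proof -
    obtain i where "(commutator h ^^ i) x = 0" using x h unfolding E0_def by blast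
    moreover obtain j where "(commutator h ^^ j) y = 0" using y h unfolding E0_def by blast
    ultimately have "(commutator h ^^ (i + j)) (x + y) = 0"
      using ad_vanish_mono[OF H_lin[OF h], of i x "i + j"] ad_vanish_mono[OF H_lin[OF h], of j y "i + j"]
      by (simp add: ad_funpow_simps[OF H_lin[OF h]])
    then show ?thesis by blast
  qed
  moreover have "lin (x + y)" using lin_add_fun[OF E0_lin[OF x] E0_lin[OF y]] by (simp add: plus_fun_def)
  ultimately show "x + y \<in> E0" by (simp add: E0_def)
next
  fix c x assume x: "x \<in> E0"
  have "(commutator h ^^ m) (fun_scale scale c x) = 0" if "h \<in> H" "(commutator h ^^ m) x = 0" for h m
    using that by (simp add: ad_funpow_simps[OF H_lin])
  moreover have "lin (fun_scale scale c x)"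
    unfolding fun_scale_def by (rule lin_scale_fun[OF E0_lin[OF x]])
  ultimately show "fun_scale scale c x \<in> E0" using x unfolding E0_def by blast
qed

lemma E0_commutator: "x \<in> E0 \<Longrightarrow> y \<in> E0 \<Longrightarrow> commutator x y \<in> E0"
  using F.subspace_diff[OF E0_subspace E0_compose E0_compose, of x y y x]
  by (simp add: commutator_def fun_diff_def)

lemma E0_commuting: "lin x \<Longrightarrow> (\<And>h v. h \<in> H \<Longrightarrow> h (x v) = x (h v)) \<Longrightarrow> x \<in> E0"
  unfolding E0_def by (auto simp: commutator_def fun_eq_iff intro!: exI[of _ 1])

text \<open>The argument of Engel's theorem, along the lower central series of \<open>H\<close>: the operators
  \<open>commutator h\<close> for \<open>h\<close> in one step commute modulo the next one.\<close>

theorem E0_so_subset: "E0 \<inter> so scale B \<subseteq> H"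
proof (rule ccontr)
  define L where "L = E0 \<inter> so scale B"
  assume "\<not> E0 \<inter> so scale B \<subseteq> H"
  then obtain x0 where x0: "x0 \<in> L" "x0 \<notin> H" by (auto simp: L_def)
  have Lcl: "commutator h x \<in> L" if "h \<in> H" "x \<in> L" for h x
    using that E0_commutator[OF H_E0] closed_so[OF H_so] by (auto simp: L_def)
  have Llin: "lin x" if "x \<in> L" for x using that by (auto simp: L_def E0_def)
  \<comment> \<open>The elements of \<open>L\<close> that \<open>lcs i\<close> brackets into
    \<open>H\<close>. At the end of the series this is all of \<open>L\<close>; at step
    \<open>0\<close> it consists of normalising elements. An element outside \<open>H\<close> is
    carried from the one to the other.\<close>
  define M where "M i = {x \<in> L. \<forall>h\<in>lcs i. commutator h x \<in> H}" for i
  have jac: "commutator h (commutator h' x) = commutator (commutator h h') x + commutator h' (commutator h x)"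
    if "lin h" "lin h'" "lin x" for h h' x
    by (simp add: commutator_def fun_eq_iff linD[OF that(1)] linD[OF that(2)] linD[OF that(3)])
  have step: "\<exists>x\<in>M i. x \<notin> H" if ex: "\<exists>x\<in>M (Suc i). x \<notin> H" for i
  proof -
    have fin: "F.fin_dim_subspace (lcs i)"
      by (rule fin_dim_fun_subspace[OF lcs_subspace]) (use lcs_subset H_lin in blast)
    obtain b where b: "finite b" "b \<subseteq> lcs i" "F.span b = lcs i"
      using F.fin_dim_subspace_basis[OF fin] by metis
    have Mst: "commutator h x \<in> M (Suc i)" if h: "h \<in> lcs i" and x: "x \<in> M (Suc i)" for h x
    proof -
      have hH: "h \<in> H" using h lcs_subset by blast
      have xL: "x \<in> L" using x by (simp add: M_def)
      have "commutator h' (commutator h x) \<in> H" if h': "h' \<in> lcs (Suc i)" for h'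
      proof -
        have h'H: "h' \<in> H" using h' lcs_subset by blast
        have "commutator h' h \<in> lcs (Suc i)" using lcs_Suc_mem[OF h'H h] .
        then have "commutator (commutator h' h) x \<in> H" using x by (simp add: M_def)
        moreover have "commutator h' x \<in> H" using x h' by (simp add: M_def)
        then have "commutator h (commutator h' x) \<in> H" using H_closed hH by blast
        ultimately show ?thesis
          unfolding jac[OF H_lin[OF h'H] H_lin[OF hH] Llin[OF xL]]
          using F.subspace_add[OF H_subspace] by blast
      qed
      then show ?thesis using Lcl[OF hH xL] by (simp add: M_def)
    qed
    have "\<exists>x\<in>M (Suc i). x \<notin> H \<and> (\<forall>h\<in>S. commutator h x \<in> H)" if "S \<subseteq> lcs i" "finite S" for S
      using that(2,1)
    proof (induction S rule: finite_induct)
      case empty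
      then show ?case using ex by simp
    next
      case (insert h S)
      then obtain x where x: "x \<in> M (Suc i)" "x \<notin> H" "\<And>h'. h' \<in> S \<Longrightarrow> commutator h' x \<in> H" by auto
      have h: "h \<in> lcs i" "h \<in> H" using insert.prems lcs_subset by auto
      let ?x = "\<lambda>j. (commutator h ^^ j) x"
      obtain m where "?x m = 0" using x(1) h(2) by (auto simp: M_def L_def E0_def)
      then have "\<exists>j. ?x j \<in> H" using F.subspace_0[OF H_subspace] by metis
      \<comment> \<open>Just before the powers of \<open>commutator h\<close> first enter
        \<open>H\<close> there is an element outside \<open>H\<close> that \<open>h\<close> brackets
        into \<open>H\<close>.\<close>
      define j where "j = (LEAST j. ?x j \<in> H)"
      have j: "?x j \<in> H" unfolding j_def by (rule LeastI_ex) fact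
      have "j \<noteq> 0" using j x(2) by (metis funpow_0)
      then obtain l where l: "j = Suc l" by (cases j) auto
      have nl: "?x l \<notin> H" using not_less_Least[of l "\<lambda>j. ?x j \<in> H"] l by (simp add: j_def)
      have xM: "?x t \<in> M (Suc i)" for t by (induction t) (use x(1) Mst[OF h(1)] in auto)
      have xS: "commutator h' (?x t) \<in> H" if h': "h' \<in> S" for h' t
      proof (induction t)
        case 0
        then show ?case using x(3)[OF h'] by simp
      next
        case (Suc t)
        have h'i: "h' \<in> lcs i" "h' \<in> H" using h' insert.prems lcs_subset by auto
        have "commutator h' h \<in> lcs (Suc i)" using lcs_Suc_mem[OF h'i(2) h(1)] .
        then have "commutator (commutator h' h) (?x t) \<in> H" using xM[of t] by (simp add: M_def)
        moreover have "commutator h (commutator h' (?x t)) \<in> H" using H_closed h Suc by blast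
        ultimately have "commutator (commutator h' h) (?x t) + commutator h (commutator h' (?x t)) \<in> H"
          by (rule F.subspace_add[OF H_subspace])
        moreover have "lin (?x t)" using xM[of t] Llin by (simp add: M_def)
        ultimately show ?case
          using jac[OF H_lin[OF h'i(2)] H_lin[OF h(2)], of "?x t"] unfolding funpow.simps comp_apply by (simp only:)
      qed
      have "commutator h (?x l) \<in> H" using j l by simp
      then show ?case using nl xM[of l] xS by blast
    qed
    from this[OF b(2,1)] obtain x where x: "x \<in> M (Suc i)" "x \<notin> H" "\<And>h. h \<in> b \<Longrightarrow> commutator h x \<in> H"
      by blast
    have xlin: "lin x" using x(1) Llin by (simp add: M_def)
    have "F.subspace {h. commutator h x \<in> H}"
    proof (rule F.subspaceI)
      show "0 \<in> {h. commutator h x \<in> H}"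
        using F.subspace_0[OF H_subspace] linD(4)[OF xlin]
        by (simp add: commutator_def zero_fun_def)
      fix h h' assume "h \<in> {h. commutator h x \<in> H}" "h' \<in> {h. commutator h x \<in> H}"
      then have "commutator h x + commutator h' x \<in> H" using F.subspace_add[OF H_subspace] by blast
      moreover have "commutator h x + commutator h' x = commutator (h + h') x"
        by (simp add: commutator_def fun_eq_iff linD[OF xlin])
      ultimately show "h + h' \<in> {h. commutator h x \<in> H}" by simp
    next
      fix c h assume "h \<in> {h. commutator h x \<in> H}"
      then have "fun_scale scale c (commutator h x) \<in> H" using F.subspace_scale[OF H_subspace] by blast
      moreover have "fun_scale scale c (commutator h x) = commutator (fun_scale scale c h) x"
        by (simp add: commutator_def fun_scale_def fun_eq_iff linD[OF xlin] scale_right_diff_distrib)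
      ultimately show "fun_scale scale c h \<in> {h. commutator h x \<in> H}" by simp
    qed
    then have "F.span b \<subseteq> {h. commutator h x \<in> H}" by (intro F.span_minimal) (use x in auto)
    then have "x \<in> M i" using x(1) b(3) by (auto simp: M_def)
    then show ?thesis using x(2) by blast
  qed
  obtain m where m: "lcs m = {0}" using lcs_zero by blast
  have "x0 \<in> M m"
    using x0(1) F.subspace_0[OF H_subspace] linD(4)[OF Llin[OF x0(1)]]
    by (simp add: M_def m commutator_def zero_fun_def)
  then have "\<exists>x\<in>M m. x \<notin> H" using x0 by blast
  then have "\<exists>x\<in>M 0. x \<notin> H" by (induction m) (use step in blast)+
  then obtain x where x: "x \<in> L" "x \<notin> H" "\<And>h. h \<in> H \<Longrightarrow> commutator h x \<in> H" by (auto simp: M_def)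
  have norm: "commutator x h \<in> H" if "h \<in> H" for h
  proof -
    have "commutator x h = - commutator h x" by (simp add: commutator_def fun_eq_iff)
    then show ?thesis using x(3)[OF that] F.subspace_neg[OF H_subspace] by simp
  qed
  have "x \<in> so scale B" using x(1) by (simp add: L_def)
  from H_normaliser[OF this norm] x(2) show False by blast
qed

definition adjoint :: "('v \<Rightarrow> 'v) \<Rightarrow> 'v \<Rightarrow> 'v" where
  "adjoint x v = (\<Sum>i<n. scale (B v (x (u i)) / g i) (u i))"

lemma adjoint_lin: "lin (adjoint x)"
  unfolding adjoint_def
  by (simp add: lin_iff B_simps sum.distrib add_divide_distrib scale_left_distrib scale_sum_right)

lemma B_adjoint:
  assumes "lin x"
  shows "B (adjoint x v) v' = B v (x v')" and "B v' (adjoint x v) = B (x v') v"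
proof -
  have "B v (x v') = B v (x (\<Sum>i<n. scale (B v' (u i) / g i) (u i)))" using expansion[of v'] by simp
  also have "\<dots> = (\<Sum>i<n. B v' (u i) / g i * B v (x (u i)))" by (simp add: linD[OF assms] B_sum B_simps)
  also have "\<dots> = (\<Sum>i<n. B v (x (u i)) / g i * B (u i) v')"
    by (rule sum.cong[OF refl]) (simp add: symmetric[of v'] mult.commute)
  also have "\<dots> = B (adjoint x v) v'" by (simp add: adjoint_def B_sum B_simps)
  finally show *: "B (adjoint x v) v' = B v (x v')" ..
  show "B v' (adjoint x v) = B (x v') v"
    using * symmetric[of v'] symmetric[of v] by simp
qed

lemma eq_if_B_eq: "(\<And>w. B v w = B v' w) \<Longrightarrow> v = v'"
  using nondegenerate[of "v - v'"] by (simp add: B_simps)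

lemma commutator_adjoint:
  assumes h: "h \<in> so scale B" and x: "lin x"
  shows "commutator h (adjoint x) = adjoint (commutator h x)"
proof
  fix v
  show "commutator h (adjoint x) v = adjoint (commutator h x) v"
  proof (rule eq_if_B_eq)
    fix w
    have "B (commutator h (adjoint x) v) w = B v (commutator h x w)"
      by (simp add: commutator_def B_simps so_skew[OF h] B_adjoint[OF x])
    then show "B (commutator h (adjoint x) v) w = B (adjoint (commutator h x) v) w"
      by (simp add: B_adjoint commutator_lin so_lin[OF h] x)
  qed
qed

lemma E0_adjoint:
  assumes "x \<in> E0" shows "adjoint x \<in> E0"
proof -
  have pow: "(commutator h ^^ m) (adjoint x) = adjoint ((commutator h ^^ m) x)" if "h \<in> H" for h m
    by (induction m)
      (simp_all add: commutator_adjoint[OF H_so[OF that]] commutator_funpow_lin H_lin[OF that] E0_lin[OF assms])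
  have zero: "adjoint 0 = 0" by (simp add: adjoint_def fun_eq_iff B_simps)
  have "\<exists>m. (commutator h ^^ m) (adjoint x) = 0" if h: "h \<in> H" for h
  proof -
    obtain m where "(commutator h ^^ m) x = 0" using assms h unfolding E0_def by blast
    then have "(commutator h ^^ m) (adjoint x) = 0" unfolding pow[OF h] by (simp only: zero)
    then show ?thesis by blast
  qed
  then show ?thesis using adjoint_lin by (simp add: E0_def)
qed

definition null_part :: "('v \<Rightarrow> 'v) \<Rightarrow> 'v set" where
  "null_part h = {v. \<exists>m. (h ^^ m) v = 0}"

lemma null_part_subspace:
  assumes "lin h" shows "subspace (null_part h)"
proof (rule subspaceI)
  note l = linD[OF lin_funpow[OF assms]]
  show "0 \<in> null_part h" by (auto simp: null_part_def intro: exI[of _ 0])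
  fix v w assume "v \<in> null_part h" "w \<in> null_part h"
  then obtain i j where "(h ^^ i) v = 0" "(h ^^ j) w = 0" by (auto simp: null_part_def)
  then have "(h ^^ (i + j)) (v + w) = 0"
    using funpow_zero_above[OF assms, of i v "i + j"] funpow_zero_above[OF assms, of j w "i + j"]
    by (simp add: l)
  then show "v + w \<in> null_part h" by (auto simp: null_part_def)
next
  fix c v assume "v \<in> null_part h"
  then show "scale c v \<in> null_part h" using linD(3)[OF lin_funpow[OF assms]] by (auto simp: null_part_def)
qed

lemma null_part_stable:
  assumes "h \<in> H" "x \<in> E0" "v \<in> null_part h"
  shows "x v \<in> null_part h"
  using assms ad_nilpotent_apply[OF H_lin[OF assms(1)] E0_lin[OF assms(2)]]
  unfolding null_part_def E0_def by blast

text \<open>\<open>V\<close> is the sum of the kernel and the image of a high power of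
  \<open>h\<close>; as \<open>h\<close> is skew, this image is orthogonal to the generalised null
  space.\<close>

lemma fitting:
  assumes h: "h \<in> so scale B"
  obtains a where "a \<in> null_part h" "\<And>w. w \<in> null_part h \<Longrightarrow> B (v - a) w = 0"
proof -
  note lh = so_lin[OF h]
  obtain N where N: "\<And>m. (h ^^ (N + m)) ` UNIV = (h ^^ N) ` UNIV"
    using image_stabilises[OF lh fin_dim_UNIV] by blast
  have "(h ^^ N) v \<in> (h ^^ (N + N)) ` UNIV" using N[of N] by auto
  then obtain z where z: "(h ^^ N) v = (h ^^ (N + N)) z" by blast
  define a where "a = v - (h ^^ N) z"
  have "(h ^^ N) a = 0" using z by (simp add: a_def linD[OF lin_funpow[OF lh]] funpow_funpow)
  then have "a \<in> null_part h" by (auto simp: null_part_def)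
  moreover have "B (v - a) w = 0" if "w \<in> null_part h" for w
  proof -
    obtain m where m: "(h ^^ m) w = 0" using \<open>w \<in> null_part h\<close> by (auto simp: null_part_def)
    have "(h ^^ N) z \<in> (h ^^ (N + m)) ` UNIV" using N[of m] by auto
    then obtain z' where "(h ^^ N) z = (h ^^ (N + m)) z'" by blast
    moreover have "(h ^^ (N + m)) w = 0" by (rule funpow_zero_above[OF lh m]) simp
    ultimately show ?thesis by (simp add: a_def so_skew_funpow[OF h] B_simps)
  qed
  ultimately show thesis using that by blast
qed

end

lemma (in subspace_dimension) complement_family:
  assumes R: "fin_dim_subspace R" and K: "subspace K" "K \<subseteq> R"
  obtains J where "finite J" "J \<subseteq> R" "dim K + card J = dim R"
    "\<And>c j. (\<Sum>j\<in>J. scale (c j) j) \<in> K \<Longrightarrow> j \<in> J \<Longrightarrow> c j = 0"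
proof -
  have sR: "subspace R" using R by (simp add: fin_dim_subspace_def)
  obtain b' where b': "finite b'" "b' \<subseteq> K" "independent b'" "span b' = K" "card b' = dim K"
    using fin_dim_subspace_basis[OF fin_dim_subspace_mono[OF R K]] by blast
  obtain b where b: "b' \<subseteq> b" "b \<subseteq> R" "independent b" "R \<subseteq> span b"
    using maximal_independent_subset_extend[of b' R] b' K by blast
  obtain S where S: "finite S" "R \<subseteq> span S" using R by (auto simp: fin_dim_subspace_def)
  have fb: "finite b" using independent_span_bound[OF S(1) b(3)] b(2) S(2) by auto
  have cb: "card b = dim R" by (rule basis_card_eq_dim[OF b(2,4,3)])
  show thesis
  proof
    show "finite (b - b')" "b - b' \<subseteq> R" using fb b by auto
    show "dim K + card (b - b') = dim R"
      using card_mono[OF fb b(1)] card_Diff_subset[OF b'(1) b(1)] b'(5) cb by simp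
    fix c j assume s: "(\<Sum>j\<in>b - b'. scale (c j) j) \<in> K" and j: "j \<in> b - b'"
    let ?z = "\<Sum>j\<in>b - b'. scale (c j) j"
    have "?z \<in> span b'" using s b'(4) by simp
    then have "(\<Sum>v\<in>b'. scale (representation b' ?z v) v) = ?z"
      by (intro sum_representation_eq[OF b'(3)]) (use b'(1) in auto)
    then have "(\<Sum>v\<in>b. scale (if v \<in> b' then - representation b' ?z v else c v) v) = 0"
      unfolding sum.subset_diff[OF b(1) fb] by (simp add: sum_negf)
    from sum_scale_eq_zero_independent[OF b(3) fb this, of j] j show "c j = 0" by simp
  qed
qed

section \<open>The Fitting decomposition for one element of the Cartan subalgebra\<close>

locale cartan_element = cartan_in_so scale Basis B u n H
  for scale :: "'k::field \<Rightarrow> 'v::ab_group_add \<Rightarrow> 'v" and Basis :: "'v set"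
    and B :: "'v \<Rightarrow> 'v \<Rightarrow> 'k" and u :: "nat \<Rightarrow> 'v" and n :: nat and H :: "('v \<Rightarrow> 'v) set" +
  fixes h :: "'v \<Rightarrow> 'v"
  assumes h_H: "h \<in> H"
begin

abbreviation "V0 \<equiv> null_part h"

text \<open>The Fitting one-component of \<open>h\<close>, introduced as an orthogonal complement so
  that its stability under \<open>H\<close> follows from that of \<open>V0\<close> by
  skewness.\<close>

definition V1 :: "'v set" where
  "V1 = {v. \<forall>w\<in>V0. B v w = 0}"

lemma V0_subspace: "subspace V0"
  by (rule null_part_subspace[OF H_lin[OF h_H]])

lemma V1_subspace: "subspace V1"
  by (rule subspaceI) (auto simp: V1_def B_simps)

lemma V0_stable: "x \<in> E0 \<Longrightarrow> v \<in> V0 \<Longrightarrow> x v \<in> V0"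
  by (rule null_part_stable[OF h_H])

lemma V1_stable: "x \<in> H \<Longrightarrow> v \<in> V1 \<Longrightarrow> x v \<in> V1"
  using V0_stable[OF H_E0] by (simp add: V1_def so_skew[OF H_so])

lemma V0_V1_decomposition: "\<exists>a\<in>V0. v - a \<in> V1"
proof -
  obtain a where "a \<in> V0" "\<And>w. w \<in> V0 \<Longrightarrow> B (v - a) w = 0"
    using fitting[OF H_so[OF h_H], of v] by blast
  then show ?thesis by (auto simp: V1_def)
qed

lemma V0_V1_zero: "x \<in> V0 \<Longrightarrow> x \<in> V1 \<Longrightarrow> x = 0"
proof (rule nondegenerate)
  fix v assume x: "x \<in> V0" "x \<in> V1"
  obtain a where a: "a \<in> V0" "v - a \<in> V1" using V0_V1_decomposition by blast
  have "B x a = 0" "B (v - a) x = 0" using x a by (auto simp: V1_def)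
  then show "B x v = 0" using symmetric[of x] by (simp add: B_simps)
qed

definition \<pi>0 :: "'v \<Rightarrow> 'v" where "\<pi>0 v = (SOME a. a \<in> V0 \<and> v - a \<in> V1)"

definition \<pi>1 :: "'v \<Rightarrow> 'v" where "\<pi>1 v = v - \<pi>0 v"

lemma \<pi>0_V0: "\<pi>0 v \<in> V0" and \<pi>1_V1: "\<pi>1 v \<in> V1"
proof -
  have "\<exists>a. a \<in> V0 \<and> v - a \<in> V1" using V0_V1_decomposition by blast
  from someI_ex[OF this] show "\<pi>0 v \<in> V0" "\<pi>1 v \<in> V1" by (auto simp: \<pi>0_def \<pi>1_def)
qed

lemma \<pi>0_eqI: "a \<in> V0 \<Longrightarrow> v - a \<in> V1 \<Longrightarrow> \<pi>0 v = a"
proof -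
  assume a: "a \<in> V0" "v - a \<in> V1"
  have "\<pi>0 v - a \<in> V0" using \<pi>0_V0 a subspace_diff[OF V0_subspace] by blast
  moreover have "(v - a) - \<pi>1 v \<in> V1" using \<pi>1_V1 a subspace_diff[OF V1_subspace] by blast
  then have "\<pi>0 v - a \<in> V1" by (simp add: \<pi>1_def)
  ultimately show ?thesis using V0_V1_zero by fastforce
qed

lemma \<pi>0_on: "v \<in> V0 \<Longrightarrow> \<pi>0 v = v" "v \<in> V1 \<Longrightarrow> \<pi>0 v = 0"
  by (rule \<pi>0_eqI; simp add: subspace_0[OF V0_subspace] subspace_0[OF V1_subspace])+

lemma \<pi>1_on: "v \<in> V0 \<Longrightarrow> \<pi>1 v = 0" "v \<in> V1 \<Longrightarrow> \<pi>1 v = v"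
  by (simp_all add: \<pi>1_def \<pi>0_on)

lemma \<pi>0_lin: "lin \<pi>0"
  unfolding lin_iff
proof (intro conjI allI)
  show "\<pi>0 (x + y) = \<pi>0 x + \<pi>0 y" for x y
  proof (rule \<pi>0_eqI)
    show "\<pi>0 x + \<pi>0 y \<in> V0" using \<pi>0_V0 subspace_add[OF V0_subspace] by blast
    have "\<pi>1 x + \<pi>1 y \<in> V1" using \<pi>1_V1 subspace_add[OF V1_subspace] by blast
    then show "x + y - (\<pi>0 x + \<pi>0 y) \<in> V1" by (simp add: \<pi>1_def algebra_simps)
  qed
  show "\<pi>0 (scale c x) = scale c (\<pi>0 x)" for c x
  proof (rule \<pi>0_eqI)
    show "scale c (\<pi>0 x) \<in> V0" using \<pi>0_V0 subspace_scale[OF V0_subspace] by blast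
    have "scale c (\<pi>1 x) \<in> V1" using \<pi>1_V1 subspace_scale[OF V1_subspace] by blast
    then show "scale c x - scale c (\<pi>0 x) \<in> V1" by (simp add: \<pi>1_def scale_right_diff_distrib)
  qed
qed

lemma \<pi>1_lin: "lin \<pi>1"
  using lin_diff_fun[OF _ \<pi>0_lin, of "\<lambda>v. v"] by (simp add: \<pi>1_def lin_iff)

lemma \<pi>0_H: "x \<in> H \<Longrightarrow> x (\<pi>0 v) = \<pi>0 (x v)"
proof (rule \<pi>0_eqI[symmetric])
  assume x: "x \<in> H"
  show "x (\<pi>0 v) \<in> V0" by (rule V0_stable[OF H_E0[OF x] \<pi>0_V0])
  have "x (\<pi>1 v) \<in> V1" by (rule V1_stable[OF x \<pi>1_V1])
  then show "x v - x (\<pi>0 v) \<in> V1" by (simp add: \<pi>1_def linD[OF H_lin[OF x]])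
qed

lemma \<pi>1_H: "x \<in> H \<Longrightarrow> x (\<pi>1 v) = \<pi>1 (x v)"
  by (simp add: \<pi>1_def linD[OF H_lin] \<pi>0_H)

lemma \<pi>0_E0: "\<pi>0 \<in> E0" and \<pi>1_E0: "\<pi>1 \<in> E0"
  by (rule E0_commuting[OF \<pi>0_lin \<pi>0_H], assumption) (rule E0_commuting[OF \<pi>1_lin \<pi>1_H], assumption)

lemma B_V0_V1: "a \<in> V0 \<Longrightarrow> b \<in> V1 \<Longrightarrow> B a b = 0" "a \<in> V0 \<Longrightarrow> b \<in> V1 \<Longrightarrow> B b a = 0"
  using symmetric[of a] by (auto simp: V1_def)

lemma B_\<pi>0: "B (\<pi>0 v) w = B v (\<pi>0 w)"
proof -
  have "B (\<pi>0 v) (\<pi>1 w) = 0" "B (\<pi>1 v) (\<pi>0 w) = 0" using \<pi>0_V0 \<pi>1_V1 B_V0_V1 by blast+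
  then show ?thesis by (simp add: \<pi>1_def B_simps)
qed

lemma B_\<pi>1: "B (\<pi>1 v) w = B v (\<pi>1 w)"
  by (simp add: \<pi>1_def B_simps B_\<pi>0)

text \<open>The map equal to \<open>h\<close> on \<open>V1\<close> and to \<open>h'\<close> on
  \<open>V0\<close> lies in \<open>E0\<close>, since \<open>E0\<close> contains the projections, and
  it is skew, so it belongs to \<open>H\<close>. Its generalised null space is contained in
  \<open>V0\<close> and misses \<open>v\<close>.\<close>

lemma regularise:
  assumes h': "h' \<in> H" and v: "v \<in> V0" "\<And>m. (h' ^^ m) v \<noteq> 0"
  shows "\<exists>y\<in>H. dim (null_part y) < dim V0"
proof -
  define y where "y x = h (\<pi>1 x) + h' (\<pi>0 x)" for x
  have "(\<lambda>x. h (\<pi>1 x)) + (\<lambda>x. h' (\<pi>0 x)) \<in> E0"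
    by (rule F.subspace_add[OF E0_subspace E0_compose[OF H_E0[OF h_H] \<pi>1_E0]
          E0_compose[OF H_E0[OF h'] \<pi>0_E0]])
  moreover have "(\<lambda>x. h (\<pi>1 x)) + (\<lambda>x. h' (\<pi>0 x)) = y" by (simp add: y_def fun_eq_iff)
  ultimately have yE: "y \<in> E0" by simp
  have "B (y x) z = - B x (y z)" for x z
    by (simp add: y_def B_simps so_skew[OF H_so[OF h_H]] so_skew[OF H_so[OF h']] B_\<pi>0 B_\<pi>1
        \<pi>0_H[OF h'] \<pi>1_H[OF h_H])
  then have yH: "y \<in> H" using E0_so_subset yE E0_lin[OF yE] by (auto simp: so_iff)
  have y0: "(y ^^ m) x = (h' ^^ m) x \<and> (h' ^^ m) x \<in> V0" if "x \<in> V0" for m x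
    by (induction m) (use that V0_stable[OF H_E0[OF h']] in \<open>auto simp: y_def \<pi>0_on \<pi>1_on linD[OF H_lin[OF h_H]]\<close>)
  have y1: "(y ^^ m) x = (h ^^ m) x \<and> (h ^^ m) x \<in> V1" if "x \<in> V1" for m x
    by (induction m) (use that V1_stable[OF h_H] in \<open>auto simp: y_def \<pi>0_on \<pi>1_on linD[OF H_lin[OF h']]\<close>)
  have "null_part y \<subseteq> V0"
  proof
    fix x assume "x \<in> null_part y"
    then obtain m where m: "(y ^^ m) x = 0" by (auto simp: null_part_def)
    have "(y ^^ m) (\<pi>0 x + \<pi>1 x) = 0" using m by (simp add: \<pi>1_def)
    then have "(h' ^^ m) (\<pi>0 x) + (h ^^ m) (\<pi>1 x) = 0"
      using y0[OF \<pi>0_V0] y1[OF \<pi>1_V1] linD(1)[OF lin_funpow[OF E0_lin[OF yE]]] by simp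
    then have "(h ^^ m) (\<pi>1 x) = - (h' ^^ m) (\<pi>0 x)" by (metis add_eq_0_iff)
    then have "(h ^^ m) (\<pi>1 x) \<in> V0" using y0[OF \<pi>0_V0] subspace_neg[OF V0_subspace] by simp
    then have "(h ^^ m) (\<pi>1 x) = 0" using V0_V1_zero y1[OF \<pi>1_V1] by blast
    then have "\<pi>1 x \<in> V0" by (auto simp: null_part_def)
    then have "\<pi>1 x = 0" using V0_V1_zero \<pi>1_V1 by blast
    then show "x \<in> V0" using \<pi>0_V0[of x] by (simp add: \<pi>1_def)
  qed
  moreover have "v \<notin> null_part y" using v y0[OF v(1)] by (simp add: null_part_def)
  moreover have "fin_dim_subspace V0" by (rule fin_dim_subspace_mono[OF fin_dim_UNIV V0_subspace]) simp
  ultimately have "dim (null_part y) < dim V0"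
    using dim_strict_mono[OF _ null_part_subspace[OF E0_lin[OF yE]] _ v(1)] by blast
  then show ?thesis using yH by blast
qed

text \<open>Maps in \<open>E0\<close> from \<open>V1\<close> into \<open>W\<close>, extended by zero
  on \<open>V0\<close>.\<close>

definition M :: "'v set \<Rightarrow> ('v \<Rightarrow> 'v) set" where
  "M W = {x \<in> E0. (\<forall>v\<in>V0. x v = 0) \<and> (\<forall>v. x v \<in> W)}"

lemma M_subspace: "subspace W \<Longrightarrow> F.subspace (M W)"
  by (rule F.subspaceI)
    (auto simp: M_def F.subspace_0[OF E0_subspace] F.subspace_add[OF E0_subspace]
      F.subspace_scale[OF E0_subspace] subspace_0 subspace_add subspace_scale fun_scale_def[symmetric],
     auto simp: fun_scale_def subspace_scale)

lemma M_fin_dim: "subspace W \<Longrightarrow> F.fin_dim_subspace (M W)"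
  by (rule fin_dim_fun_subspace[OF M_subspace]) (auto simp: M_def E0_lin)

text \<open>Composing \<open>y\<close> with an arbitrary projection onto \<open>W\<close> gives a
  map \<open>x\<close> that is right on \<open>W\<close> but may lie outside \<open>E0\<close>. It
  is nilpotent modulo the maps vanishing on \<open>W\<close>, hence can be corrected by one of
  them.\<close>

lemma M_lift:
  assumes W: "subspace W" "W \<subseteq> V1" "\<And>x v. x \<in> H \<Longrightarrow> v \<in> W \<Longrightarrow> x v \<in> W"
    and y: "y \<in> E0" "\<And>v. v \<in> W \<Longrightarrow> y v \<in> W"
  shows "\<exists>x\<in>M W. \<forall>w\<in>W. x w = y w"
proof -
  interpret vp: vector_space_pair scale scale by unfold_locales
  have "lin (\<lambda>v. v)" by (simp add: lin_iff)
  from vp.linear_exists_left_inverse_on[OF this W(1)] obtain p where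
    p: "range p \<subseteq> W" "lin p" "\<And>w. w \<in> W \<Longrightarrow> p w = w" by auto
  define X where "X = {x. lin x \<and> (\<forall>v\<in>V0. x v = 0) \<and> (\<forall>v. x v \<in> W)}"
  define Y where "Y = {x \<in> X. \<forall>w\<in>W. x w = 0}"
  define x where "x v = y (p (\<pi>1 v))" for v
  have sX: "F.subspace X"
    by (rule F.subspaceI)
      (auto simp: X_def lin_iff fun_scale_def subspace_0[OF W(1)] subspace_add[OF W(1)]
        subspace_scale[OF W(1)] scale_right_distrib algebra_simps)
  have fX: "F.fin_dim_subspace X"
    by (rule fin_dim_fun_subspace[OF sX]) (simp add: X_def)
  have sY: "F.subspace Y"
    by (rule F.subspaceI)
      (auto simp: Y_def F.subspace_0[OF sX] F.subspace_add[OF sX] F.subspace_scale[OF sX], auto simp: fun_scale_def)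
  have Xst: "commutator a z \<in> X" if a: "a \<in> H" and z: "z \<in> X" for a z
  proof -
    have "lin (commutator a z)" using commutator_lin[OF H_lin[OF a]] z by (simp add: X_def)
    moreover have "commutator a z v = 0" if "v \<in> V0" for v
      using z that V0_stable[OF H_E0[OF a] that] by (simp add: X_def commutator_def linD[OF H_lin[OF a]])
    moreover have "commutator a z v \<in> W" for v
      using z W(3)[OF a] subspace_diff[OF W(1)] by (simp add: X_def commutator_def)
    ultimately show ?thesis by (simp add: X_def)
  qed
  have Yst: "commutator a z \<in> Y" if a: "a \<in> H" and z: "z \<in> Y" for a z
    using Xst[OF a] z W(3)[OF a] by (simp add: Y_def commutator_def linD[OF H_lin[OF a]])
  have xX: "x \<in> X"
    unfolding X_def x_def
    using lin_compose[OF E0_lin[OF y(1)] lin_compose[OF p(2) \<pi>1_lin]] p(1) y(2) linD(4)[OF p(2)]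
      linD(4)[OF E0_lin[OF y(1)]]
    by (auto simp: \<pi>1_on)
  have xW: "x w = y w" if "w \<in> W" for w using that W(2) p(3) by (auto simp: x_def \<pi>1_on)
  have L1: "Vector_Spaces.linear (fun_scale scale) (fun_scale scale) T" if "T \<in> commutator ` H" for T
    using that commutator_linear[OF H_lin] by blast
  have L2: "T z \<in> X" if "T \<in> commutator ` H" "z \<in> X" for T z using that Xst by blast
  have L3: "T z \<in> Y" if "T \<in> commutator ` H" "z \<in> Y" for T z using that Yst by blast
  have L4: "Y \<subseteq> X" by (auto simp: Y_def)
  \<comment> \<open>The generalised null space of \<open>commutator a\<close> is stable under
    \<open>commutator a'\<close> because \<open>a'\<close> is itself killed by a power of
    \<open>commutator a\<close>.\<close>
  have L5: "\<exists>m. (T ^^ m) (T' z) = 0"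
    if T: "T \<in> commutator ` H" "T' \<in> commutator ` H" and z: "z \<in> X" "\<exists>m. (T ^^ m) z = 0" for T T' z
  proof -
    obtain a a' where a: "a \<in> H" "a' \<in> H" "T = commutator a" "T' = commutator a'" using T by blast
    obtain m where m: "(commutator a ^^ m) z = 0" using z a by blast
    obtain i where i: "(commutator a ^^ i) a' = 0" using ad_nilpotent_H[OF a(1,2)] by blast
    have "lin z" using z by (simp add: X_def)
    have "(commutator a ^^ (i + m)) (\<lambda>v. a' (z v)) = 0"
      by (rule ad_nilpotent_compose[OF H_lin[OF a(1)] H_lin[OF a(2)] i m])
    moreover have "(commutator a ^^ (m + i)) (\<lambda>v. z (a' v)) = 0"
      by (rule ad_nilpotent_compose[OF H_lin[OF a(1)] \<open>lin z\<close> m i])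
    ultimately have "(commutator a ^^ (i + m)) ((\<lambda>v. a' (z v)) - (\<lambda>v. z (a' v))) = 0"
      by (simp only: ad_funpow_simps[OF H_lin[OF a(1)]] add.commute[of m] diff_self)
    moreover have "(\<lambda>v. a' (z v)) - (\<lambda>v. z (a' v)) = T' z" using a by (simp add: commutator_def fun_eq_iff)
    ultimately show ?thesis using a by auto
  qed
  have L6: "\<exists>m. (T ^^ m) x \<in> Y" if T: "T \<in> commutator ` H" for T
  proof -
    obtain a where a: "a \<in> H" "T = commutator a" using T by blast
    obtain m where m: "(commutator a ^^ m) y = 0" using y(1) a by (auto simp: E0_def)
    have "\<forall>w\<in>W. (commutator a ^^ m) x w = (commutator a ^^ m) y w" for m
      by (induction m) (use xW W(3)[OF a(1)] in \<open>auto simp: commutator_def\<close>)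
    then have "\<forall>w\<in>W. (commutator a ^^ m) x w = 0" using m by simp
    moreover have "(commutator a ^^ m) x \<in> X" by (induction m) (use xX Xst[OF a(1)] in auto)
    ultimately show ?thesis using a by (auto simp: Y_def)
  qed
  have "\<exists>x0\<in>X. (\<forall>T\<in>commutator ` H. \<exists>m. (T ^^ m) x0 = 0) \<and> x - x0 \<in> Y"
    by (rule F.nilpotent_lift[where \<T> = "commutator ` H" and X = X and Y = Y and x = x])
      (fact L1 fX L2 sY L3 L4 L5 xX L6)+
  then obtain x0 where x0: "x0 \<in> X" "\<And>a. a \<in> H \<Longrightarrow> \<exists>m. (commutator a ^^ m) x0 = 0" "x - x0 \<in> Y" by blast
  have "x0 \<in> M W" using x0(1,2) by (auto simp: X_def M_def E0_def)
  moreover have "x0 w = y w" if "w \<in> W" for w using x0(3) xW[OF that] that by (simp add: Y_def)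
  ultimately show ?thesis by blast
qed

text \<open>Induction along a maximal proper \<open>H\<close>-stable subspace \<open>W'\<close>. The
  quotient is simple, so a vector \<open>v\<close> outside \<open>W'\<close> generates
  \<open>W\<close> modulo \<open>W'\<close>, and evaluation at \<open>v\<close> shows that
  \<open>M W\<close> exceeds \<open>M W'\<close> by at least the dimension of the quotient.\<close>

lemma dim_M_ge:
  assumes "subspace W" "W \<subseteq> V1" "\<And>x v. x \<in> H \<Longrightarrow> v \<in> W \<Longrightarrow> x v \<in> W"
  shows "dim W \<le> F.dim (M W)"
  using assms
proof (induction "dim W" arbitrary: W rule: less_induct)
  case (less W)
  note W = less.prems
  have fW: "fin_dim_subspace W" by (rule fin_dim_subspace_mono[OF fin_dim_UNIV W(1)]) simp
  show ?case
  proof (cases "W \<subseteq> {0}")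
    case False
    define Q where "Q W' \<longleftrightarrow> subspace W' \<and> W' \<subseteq> W \<and> W' \<noteq> W \<and> (\<forall>x\<in>H. \<forall>v\<in>W'. x v \<in> W')" for W'
    have "Q {0}" using False subspace_0[OF W(1)] linD(4)[OF H_lin] by (auto simp: Q_def)
    moreover have "dim W' \<le> dim W" if "Q W'" for W'
      using that by (auto simp: Q_def intro: dim_subset)
    ultimately have "\<exists>m. (\<exists>U. Q U \<and> dim U = m) \<and> (\<forall>m'. (\<exists>U. Q U \<and> dim U = m') \<longrightarrow> m' \<le> m)"
      by (intro Nat.ex_has_greatest_nat[of _ "dim {0}" "dim W"]) blast+
    then obtain W' where W': "Q W'" "\<And>U. Q U \<Longrightarrow> dim U \<le> dim W'" by blast
    obtain v where v: "v \<in> W" "v \<notin> W'" using W'(1) by (auto simp: Q_def)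
    have sW': "subspace W'" "W' \<subseteq> W" and W'st: "\<And>x z. x \<in> H \<Longrightarrow> z \<in> W' \<Longrightarrow> x z \<in> W'"
      using W'(1) by (auto simp: Q_def)
    have dl: "dim W' < dim W" by (rule dim_strict_mono[OF fW sW' v])
    \<comment> \<open>A substitute for the unital associative algebra generated by \<open>H\<close>:
      it contains the identity, is closed under composition with \<open>H\<close> from the left, and
      preserves \<open>W\<close> by definition.\<close>
    define \<A> where "\<A> = {y \<in> E0. \<forall>U. subspace U \<longrightarrow> (\<forall>x\<in>H. \<forall>z\<in>U. x z \<in> U) \<longrightarrow> (\<forall>z\<in>U. y z \<in> U)}"
    have \<A>W: "y z \<in> W" if "y \<in> \<A>" "z \<in> W" for y z using that W by (auto simp: \<A>_def)
    have \<A>0: "0 \<in> \<A>" using F.subspace_0[OF E0_subspace] by (auto simp: \<A>_def subspace_0)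
    have \<A>add: "x + y \<in> \<A>" if "x \<in> \<A>" "y \<in> \<A>" for x y
      using that F.subspace_add[OF E0_subspace] by (auto simp: \<A>_def subspace_add)
    have \<A>scale: "fun_scale scale c y \<in> \<A>" if "y \<in> \<A>" for c y
      using that F.subspace_scale[OF E0_subspace] by (auto simp: \<A>_def) (auto simp: fun_scale_def subspace_scale)
    have \<A>id: "(\<lambda>v. v) \<in> \<A>"
      using E0_commuting[of "\<lambda>v. v"] by (simp add: \<A>_def lin_iff)
    have \<A>H: "(\<lambda>v. x (y v)) \<in> \<A>" if "x \<in> H" "y \<in> \<A>" for x y
      using that E0_compose[OF H_E0] by (auto simp: \<A>_def)
    define U where "U = {y v + z | y z. y \<in> \<A> \<and> z \<in> W'}"
    have UI: "y v + z \<in> U" if "y \<in> \<A>" "z \<in> W'" for y z using that by (auto simp: U_def)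
    have sU: "subspace U"
    proof (rule subspaceI)
      show "0 \<in> U" using UI[OF \<A>0 subspace_0[OF sW'(1)]] by simp
      fix a b assume "a \<in> U" "b \<in> U"
      then obtain y z y' z' where ab: "a = y v + z" "b = y' v + z'" "y \<in> \<A>" "y' \<in> \<A>" "z \<in> W'" "z' \<in> W'"
        by (auto simp: U_def)
      have "(y + y') v + (z + z') \<in> U" by (rule UI[OF \<A>add[OF ab(3,4)] subspace_add[OF sW'(1) ab(5,6)]])
      then show "a + b \<in> U" using ab by (simp add: algebra_simps)
    next
      fix c a assume "a \<in> U"
      then obtain y z where a: "a = y v + z" "y \<in> \<A>" "z \<in> W'" by (auto simp: U_def)
      have "fun_scale scale c y v + scale c z \<in> U"
        by (rule UI[OF \<A>scale[OF a(2)] subspace_scale[OF sW'(1) a(3)]])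
      then show "scale c a \<in> U" using a by (simp add: fun_scale_def scale_right_distrib)
    qed
    have Ust: "x a \<in> U" if x: "x \<in> H" and "a \<in> U" for x a
    proof -
      obtain y z where a: "a = y v + z" "y \<in> \<A>" "z \<in> W'" using \<open>a \<in> U\<close> by (auto simp: U_def)
      have "x (y v) + x z \<in> U" using UI[OF \<A>H[OF x a(2)] W'st[OF x a(3)]] .
      then show ?thesis using a by (simp add: linD[OF H_lin[OF x]])
    qed
    have UW: "U \<subseteq> W" using \<A>W v(1) sW'(2) subspace_add[OF W(1)] by (auto simp: U_def)
    have W'U: "W' \<subseteq> U" using UI[OF \<A>0] by auto
    have vU: "v \<in> U" using UI[OF \<A>id subspace_0[OF sW'(1)]] by simp
    have "U = W"
    proof (rule ccontr)
      assume "U \<noteq> W"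
      then have "Q U" using sU UW Ust by (auto simp: Q_def)
      moreover have "dim W' < dim U"
        by (rule dim_strict_mono[OF fin_dim_subspace_mono[OF fin_dim_UNIV sU] sW'(1) W'U vU v(2)]) simp
      ultimately show False using W'(2)[of U] by simp
    qed
    obtain J where J: "finite J" "J \<subseteq> W" "dim W' + card J = dim W"
      "\<And>c j. (\<Sum>j\<in>J. scale (c j) j) \<in> W' \<Longrightarrow> j \<in> J \<Longrightarrow> c j = 0"
      using complement_family[OF fW sW'] by blast
    have "\<forall>j\<in>J. \<exists>x. x \<in> M W \<and> j - x v \<in> W'"
    proof
      fix j assume "j \<in> J"
      then obtain y z where y: "j = y v + z" "y \<in> \<A>" "z \<in> W'" using J(2) \<open>U = W\<close> by (auto simp: U_def)
      have "y \<in> E0" using y(2) by (simp add: \<A>_def)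
      have "\<exists>x\<in>M W. \<forall>w\<in>W. x w = y w"
        by (rule M_lift) (fact W \<open>y \<in> E0\<close> \<A>W[OF y(2)])+
      then obtain x where "x \<in> M W" "\<forall>w\<in>W. x w = y w" by blast
      then show "\<exists>x. x \<in> M W \<and> j - x v \<in> W'" using y v(1) by (intro exI[of _ x]) simp
    qed
    then obtain X where X: "\<And>j. j \<in> J \<Longrightarrow> X j \<in> M W" "\<And>j. j \<in> J \<Longrightarrow> j - X j v \<in> W'" by metis
    have sV: "W' \<subseteq> V1" using sW'(2) W(2) by blast
    have "F.dim (M W') + card J \<le> F.dim (M W)"
    proof (rule F.dim_plus_card_le[OF M_fin_dim[OF W(1)] M_subspace[OF sW'(1)] _ J(1) X(1)])
      show "M W' \<subseteq> M W" using sW'(2) by (auto simp: M_def)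
      fix c j assume s: "(\<Sum>j\<in>J. fun_scale scale (c j) (X j)) \<in> M W'" and j: "j \<in> J"
      have "(\<Sum>j\<in>J. fun_scale scale (c j) (X j)) v \<in> W'" using s by (simp add: M_def)
      then have "(\<Sum>j\<in>J. scale (c j) (X j v)) \<in> W'" by (simp add: sum_fun_apply fun_scale_def)
      moreover have "(\<Sum>j\<in>J. scale (c j) (j - X j v)) \<in> W'"
        by (intro subspace_sum[OF sW'(1)] subspace_scale[OF sW'(1)] X(2))
      ultimately have "(\<Sum>j\<in>J. scale (c j) (X j v)) + (\<Sum>j\<in>J. scale (c j) (j - X j v)) \<in> W'"
        by (rule subspace_add[OF sW'(1)])
      then have "(\<Sum>j\<in>J. scale (c j) j) \<in> W'"
        by (simp add: scale_right_diff_distrib sum_subtractf)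
      from J(4)[OF this j] show "c j = 0" .
    qed
    moreover have "dim W' \<le> F.dim (M W')"
      by (rule less.hyps) (fact dl sW'(1) sV W'st)+
    ultimately show ?thesis using J(3) by linarith
  next
    case True
    then have "dim W \<le> card ({} :: 'v set)" by (intro dim_le_card) auto
    also have "\<dots> \<le> F.dim (M W)" by simp
    finally show ?thesis .
  qed
qed

end

lemma (in cartan_in_so) regular_element_exists:
  "\<exists>h\<in>H. \<forall>h'\<in>H. \<forall>v\<in>null_part h. \<exists>m. (h' ^^ m) v = 0"
proof -
  have "0 \<in> H" by (rule F.subspace_0[OF H_subspace])
  from ex_has_least_nat[of "\<lambda>h. h \<in> H" 0 "\<lambda>h. dim (null_part h)", OF this]
  obtain h where h: "h \<in> H" "\<And>y. y \<in> H \<Longrightarrow> dim (null_part h) \<le> dim (null_part y)" by blast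
  interpret cartan_element scale Basis B u n H h by unfold_locales (rule h)
  show ?thesis using h regularise by (metis not_le)
qed

section \<open>Regular elements and the dimension count\<close>

locale regular_cartan_element = cartan_element scale Basis B u n H h
  for scale :: "'k::field \<Rightarrow> 'v::ab_group_add \<Rightarrow> 'v" and Basis :: "'v set"
    and B :: "'v \<Rightarrow> 'v \<Rightarrow> 'k" and u :: "nat \<Rightarrow> 'v" and n :: nat and H :: "('v \<Rightarrow> 'v) set"
    and h :: "'v \<Rightarrow> 'v" +
  assumes regular: "x \<in> H \<Longrightarrow> v \<in> null_part h \<Longrightarrow> \<exists>m. (x ^^ m) v = 0"
begin

text \<open>Elements of \<open>H\<close> are nilpotent on \<open>V0\<close>, so by the Leibniz rule
  their commutators act nilpotently on the wedge of two vectors of \<open>V0\<close>.\<close>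

lemma wedge_H:
  assumes "p \<in> V0" "q \<in> V0" shows "wedge p q \<in> H"
proof -
  have "\<exists>m. (commutator x ^^ m) (wedge p q) = 0" if x: "x \<in> H" for x
  proof -
    obtain i where i: "(x ^^ i) p = 0" using regular[OF x assms(1)] by blast
    obtain j where j: "(x ^^ j) q = 0" using regular[OF x assms(2)] by blast
    show ?thesis using ad_nilpotent_wedge[OF H_so[OF x] i j] by blast
  qed
  then have "wedge p q \<in> E0" using so_lin[OF wedge_so] by (simp add: E0_def)
  then show ?thesis using E0_so_subset wedge_so by blast
qed

definition Skew :: "('v \<Rightarrow> 'v) set" where
  "Skew = {x \<in> M V1. \<forall>v w. B (x v) w = - B v (x w)}"

definition Sym :: "('v \<Rightarrow> 'v) set" where
  "Sym = {x \<in> M V1. \<forall>v w. B (x v) w = B v (x w)}"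

lemma Skew_subspace: "F.subspace Skew"
proof (rule F.subspaceI)
  note sM = M_subspace[OF V1_subspace]
  show "0 \<in> Skew" using F.subspace_0[OF sM] by (simp add: Skew_def B_simps)
  show "x + y \<in> Skew" if "x \<in> Skew" "y \<in> Skew" for x y
    using that F.subspace_add[OF sM, of x y] unfolding Skew_def by (auto simp: B_simps)
  show "fun_scale scale c x \<in> Skew" if "x \<in> Skew" for c x
    using that F.subspace_scale[OF sM, of x c] unfolding Skew_def by (auto simp: fun_scale_def B_simps)
qed

lemma Sym_subspace: "F.subspace Sym"
proof (rule F.subspaceI)
  note sM = M_subspace[OF V1_subspace]
  show "0 \<in> Sym" using F.subspace_0[OF sM] by (simp add: Sym_def B_simps)
  show "x + y \<in> Sym" if "x \<in> Sym" "y \<in> Sym" for x y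
    using that F.subspace_add[OF sM, of x y] unfolding Sym_def by (auto simp: B_simps)
  show "fun_scale scale c x \<in> Sym" if "x \<in> Sym" for c x
    using that F.subspace_scale[OF sM, of x c] unfolding Sym_def by (auto simp: fun_scale_def B_simps)
qed

lemma Skew_H: "Skew \<subseteq> H"
  using E0_so_subset by (auto simp: Skew_def M_def so_iff E0_lin)

lemma Skew_fin_dim: "F.fin_dim_subspace Skew" and Sym_fin_dim: "F.fin_dim_subspace Sym"
  by (rule fin_dim_fun_subspace[OF Skew_subspace], simp add: Skew_def M_def E0_lin)
    (rule fin_dim_fun_subspace[OF Sym_subspace], simp add: Sym_def M_def E0_lin)

lemma adjoint_M:
  assumes x: "x \<in> M V1" shows "adjoint x \<in> M V1"
proof -
  have xE: "x \<in> E0" and x0: "\<And>v. v \<in> V0 \<Longrightarrow> x v = 0" and x1: "\<And>v. x v \<in> V1"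
    using x by (auto simp: M_def)
  have "adjoint x v = 0" if "v \<in> V0" for v
    by (rule nondegenerate) (simp add: B_adjoint[OF E0_lin[OF xE]] B_V0_V1(1)[OF that x1])
  moreover have "adjoint x v \<in> V1" for v
    by (simp add: V1_def B_adjoint[OF E0_lin[OF xE]] x0 B_simps)
  ultimately show ?thesis using E0_adjoint[OF xE] by (simp add: M_def)
qed

text \<open>On a map that anticommutes with \<open>h\<close>, the operator
  \<open>commutator h\<close> is left multiplication by twice \<open>h\<close>. Its nilpotency on
  \<open>x\<close> forces a power of \<open>h\<close> to kill the image of \<open>x\<close>, which
  lies in \<open>V1\<close>, where \<open>h\<close> is injective.\<close>

lemma anticommuting_zero:
  assumes x: "x \<in> M V1" and anti: "\<And>v. h (x v) + x (h v) = 0"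
  shows "x = 0"
proof
  fix v
  note lh = H_lin[OF h_H]
  have xh: "x (h v) = - h (x v)" for v using anti[of v] by (metis add_eq_0_iff)
  have "(commutator h ^^ m) x = (\<lambda>v. scale (2 ^ m) ((h ^^ m) (x v)))" for m
  proof (induction m)
    case (Suc m)
    show ?case
    proof
      fix v
      have "(commutator h ^^ Suc m) x v = scale (2 ^ m) (h ((h ^^ m) (x v))) + scale (2 ^ m) (h ((h ^^ m) (x v)))"
      proof -
        have "(h ^^ m) (x (h v)) = - h ((h ^^ m) (x v))"
          unfolding xh linD(5)[OF lin_funpow[OF lh]] by (simp only: funpow_swap1[of h m])
        moreover have "(commutator h ^^ Suc m) x = commutator h (\<lambda>v. scale (2 ^ m) ((h ^^ m) (x v)))"
          unfolding funpow.simps comp_apply by (simp only: Suc)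
        ultimately show ?thesis by (simp add: commutator_def linD(3)[OF lh] del: funpow.simps)
      qed
      also have "\<dots> = scale (2 ^ Suc m) ((h ^^ Suc m) (x v))"
        unfolding power_Suc mult_2 scale_left_distrib funpow.simps comp_apply ..
      finally show "(commutator h ^^ Suc m) x v = scale (2 ^ Suc m) ((h ^^ Suc m) (x v))" .
    qed
  qed simp
  moreover obtain m where "(commutator h ^^ m) x = 0" using x h_H by (auto simp: M_def E0_def)
  ultimately have "scale (2 ^ m) ((h ^^ m) (x v)) = 0" by (metis zero_fun_apply)
  then have "(h ^^ m) (x v) = 0" using two_neq_zero by simp
  then have "x v \<in> V0" by (auto simp: null_part_def)
  moreover have "x v \<in> V1" using x by (simp add: M_def)
  ultimately show "x v = 0 v" using V0_V1_zero by simp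
qed

lemma dim_Sym_le: "F.dim Sym \<le> F.dim Skew"
proof -
  obtain b where b: "finite b" "b \<subseteq> Sym" "F.independent b" "F.span b = Sym" "card b = F.dim Sym"
    using F.fin_dim_subspace_basis[OF Sym_fin_dim] by blast
  define \<psi> where "\<psi> x v = h (x v) + x (h v)" for x v
  note lh = H_lin[OF h_H]
  have P1: "\<psi> x \<in> Skew" if "x \<in> b" for x
  proof -
    have x: "x \<in> M V1" and sym: "\<And>v w. B (x v) w = B v (x w)" using that b(2) by (auto simp: Sym_def)
    have xE: "x \<in> E0" and x0: "\<And>v. v \<in> V0 \<Longrightarrow> x v = 0" and x1: "\<And>v. x v \<in> V1"
      using x by (auto simp: M_def)
    have "(\<lambda>v. h (x v)) + (\<lambda>v. x (h v)) \<in> E0"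
      by (rule F.subspace_add[OF E0_subspace E0_compose[OF H_E0[OF h_H] xE] E0_compose[OF xE H_E0[OF h_H]]])
    moreover have "(\<lambda>v. h (x v)) + (\<lambda>v. x (h v)) = \<psi> x" by (simp add: \<psi>_def fun_eq_iff)
    ultimately have "\<psi> x \<in> E0" by simp
    moreover have "\<psi> x v = 0" if "v \<in> V0" for v
      using x0 that V0_stable[OF H_E0[OF h_H] that] by (simp add: \<psi>_def linD[OF lh])
    moreover have "\<psi> x v \<in> V1" for v
      unfolding \<psi>_def by (rule subspace_add[OF V1_subspace V1_stable[OF h_H x1] x1])
    moreover have "B (\<psi> x v) w = - B v (\<psi> x w)" for v w
      by (simp add: \<psi>_def B_simps so_skew[OF H_so[OF h_H]] sym)
    ultimately show ?thesis by (simp add: Skew_def M_def)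
  qed
  have P2: "c x = 0" if s: "(\<Sum>x\<in>b. fun_scale scale (c x) (\<psi> x)) = 0" and x: "x \<in> b" for c x
  proof -
    define y where "y = (\<Sum>x\<in>b. fun_scale scale (c x) x)"
    have y: "y \<in> Sym"
      unfolding y_def by (intro F.subspace_sum[OF Sym_subspace] F.subspace_scale[OF Sym_subspace]) (use b in auto)
    have "h (y v) + y (h v) = (\<Sum>x\<in>b. fun_scale scale (c x) (\<psi> x)) v" for v
      by (simp add: y_def sum_fun_apply fun_scale_def \<psi>_def linD[OF lh] scale_right_distrib sum.distrib)
    then have "h (y v) + y (h v) = 0" for v using s by simp
    then have "y = 0" using y by (intro anticommuting_zero) (auto simp: Sym_def)
    then show ?thesis using F.sum_scale_eq_zero_independent[OF b(3,1) _ x] by (simp add: y_def)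
  qed
  have "card b \<le> F.dim Skew"
    by (rule F.card_le_dim_independent_family[where x = \<psi>]) (fact Skew_fin_dim b(1) P1 P2)+
  then show ?thesis using b(5) by simp
qed

text \<open>Under the adjoint \<open>M V1\<close> splits into symmetric and skew maps, and the
  symmetric half is not the larger one.\<close>

lemma dim_V1_le: "dim V1 \<le> 2 * F.dim Skew"
proof -
  obtain b where b: "finite b" "b \<subseteq> Sym" "F.span b = Sym" "card b = F.dim Sym"
    using F.fin_dim_subspace_basis[OF Sym_fin_dim] by metis
  obtain b' where b': "finite b'" "b' \<subseteq> Skew" "F.span b' = Skew" "card b' = F.dim Skew"
    using F.fin_dim_subspace_basis[OF Skew_fin_dim] by metis
  have "M V1 \<subseteq> F.span (b \<union> b')"
  proof
    fix x assume x: "x \<in> M V1"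
    note sM = M_subspace[OF V1_subspace]
    note adj = B_adjoint[OF E0_lin, of x]
    have xE: "x \<in> E0" using x by (simp add: M_def)
    have "x + adjoint x \<in> Sym"
      using F.subspace_add[OF sM x adjoint_M[OF x]] by (simp add: Sym_def B_simps adj xE)
    moreover have "x - adjoint x \<in> Skew"
      using F.subspace_diff[OF sM x adjoint_M[OF x]] by (simp add: Skew_def B_simps adj xE)
    ultimately have sp: "x + adjoint x \<in> F.span (b \<union> b')" "x - adjoint x \<in> F.span (b \<union> b')"
      using b(3) b'(3) F.span_mono[of b "b \<union> b'"] F.span_mono[of b' "b \<union> b'"] by auto
    have "fun_scale scale (1 / 2) ((x + adjoint x) + (x - adjoint x)) \<in> F.span (b \<union> b')"
      by (rule F.span_scale[OF F.span_add[OF sp]])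
    moreover have "fun_scale scale (1 / 2) ((x + adjoint x) + (x - adjoint x)) = x"
    proof
      fix v
      have "scale (1 / 2) (x v + x v) = scale (1 / 2 + 1 / 2) (x v)"
        by (simp only: scale_right_distrib scale_left_distrib)
      also have "(1 / 2 + 1 / 2 :: 'k) = 1" using two_neq_zero by (simp add: field_simps)
      finally show "fun_scale scale (1 / 2) ((x + adjoint x) + (x - adjoint x)) v = x v"
        by (simp add: fun_scale_def)
    qed
    ultimately show "x \<in> F.span (b \<union> b')" by simp
  qed
  then have "F.dim (M V1) \<le> card (b \<union> b')" by (rule F.dim_le_card) (use b b' in simp)
  also have "\<dots> \<le> F.dim Sym + F.dim Skew" using card_Un_le[of b b'] b b' by simp
  finally have "F.dim (M V1) \<le> 2 * F.dim Skew" using dim_Sym_le by simp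
  moreover have "dim V1 \<le> F.dim (M V1)"
    by (rule dim_M_ge) (fact V1_subspace subset_refl V1_stable)+
  ultimately show ?thesis by simp
qed

text \<open>Besides \<open>Skew\<close>, \<open>H\<close> contains the maps \<open>wedge p j\<close>
  for a fixed \<open>p\<close> in \<open>V0\<close>, which add at least \<open>dim V0 - 1\<close>
  dimensions. For nonzero \<open>V0\<close> this is no less than \<open>dim V0\<close> halved and
  rounded down.\<close>

lemma dim_H_ge: "n div 2 \<le> F.dim H"
proof -
  have fV: "fin_dim_subspace W" if "subspace W" for W
    by (rule fin_dim_subspace_mono[OF fin_dim_UNIV that]) simp
  have fH: "F.fin_dim_subspace H" by (rule fin_dim_fun_subspace[OF H_subspace H_lin])
  obtain b where b: "finite b" "span b = V0" "card b = dim V0"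
    using fin_dim_subspace_basis[OF fV[OF V0_subspace]] by metis
  obtain b' where b': "finite b'" "span b' = V1" "card b' = dim V1"
    using fin_dim_subspace_basis[OF fV[OF V1_subspace]] by metis
  have "UNIV \<subseteq> span (b \<union> b')"
  proof
    fix v
    have "\<pi>0 v \<in> span (b \<union> b')" "\<pi>1 v \<in> span (b \<union> b')"
      using \<pi>0_V0 \<pi>1_V1 b(2) b'(2) span_mono[of b "b \<union> b'"] span_mono[of b' "b \<union> b'"] by auto
    then have "\<pi>0 v + \<pi>1 v \<in> span (b \<union> b')" by (rule span_add)
    then show "v \<in> span (b \<union> b')" by (simp add: \<pi>1_def)
  qed
  then have "dim UNIV \<le> card (b \<union> b')" by (rule dim_le_card) (use b b' in simp)
  then have "n \<le> dim V0 + dim V1" using card_Un_le[of b b'] b b' n_dim by simp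
  then have n: "n \<le> dim V0 + 2 * F.dim Skew" using dim_V1_le by simp
  show ?thesis
  proof (cases "V0 \<subseteq> {0}")
    case True
    then have "dim V0 \<le> card ({} :: 'v set)" by (intro dim_le_card) auto
    moreover have "F.dim Skew + card ({} :: nat set) \<le> F.dim H"
      by (rule F.dim_plus_card_le[OF fH Skew_subspace Skew_H]) auto
    ultimately show ?thesis using n card.empty[where ?'a = 'v] card.empty[where ?'a = nat] by linarith
  next
    case False
    then obtain p where p: "p \<in> V0" "p \<noteq> 0" by blast
    have K: "subspace (span {p})" "span {p} \<subseteq> V0"
      using p V0_subspace by (auto intro: span_minimal[THEN subsetD])
    obtain J where J: "finite J" "J \<subseteq> V0" "dim (span {p}) + card J = dim V0"
      "\<And>c j. (\<Sum>j\<in>J. scale (c j) j) \<in> span {p} \<Longrightarrow> j \<in> J \<Longrightarrow> c j = 0"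
      using complement_family[OF fV[OF V0_subspace] K] by blast
    have "dim (span {p}) \<le> card {p}" by (rule dim_le_card) auto
    then have dp: "dim V0 \<le> card J + 1" using J(3) by simp
    have "F.dim Skew + card J \<le> F.dim H"
    proof (rule F.dim_plus_card_le[OF fH Skew_subspace Skew_H J(1), where x = "wedge p"])
      show "wedge p j \<in> H" if "j \<in> J" for j using wedge_H p J(2) that by blast
      fix c j assume s: "(\<Sum>j\<in>J. fun_scale scale (c j) (wedge p j)) \<in> Skew" and j: "j \<in> J"
      define z where "z = (\<Sum>j\<in>J. scale (c j) j)"
      \<comment> \<open>Elements of \<open>Skew\<close> vanish on \<open>V0\<close>, so a
        combination of wedges lying in \<open>Skew\<close> is tested on a vector of
        \<open>V0\<close> that is not orthogonal to \<open>p\<close>.\<close>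
      have "p \<notin> V1" using V0_V1_zero p by blast
      then obtain v where v: "v \<in> V0" "B p v \<noteq> 0" by (auto simp: V1_def)
      have "(\<Sum>j\<in>J. fun_scale scale (c j) (wedge p j)) v = 0" using s v by (simp add: Skew_def M_def)
      moreover have "(\<Sum>j\<in>J. fun_scale scale (c j) (wedge p j)) v = wedge p z v"
        by (simp add: sum_fun_apply fun_scale_def wedge_def z_def B_sum B_simps scale_right_diff_distrib
            sum_subtractf scale_sum_right scale_sum_left mult.commute)
      ultimately have "scale (B v p) z = scale (B v z) p" by (simp add: wedge_def)
      then have "scale (inverse (B v p)) (scale (B v p) z) = scale (inverse (B v p)) (scale (B v z) p)" by simp
      then have "z = scale (inverse (B v p) * B v z) p" using v symmetric[of p] by simp
      then have "z \<in> span {p}" by (metis span_base span_scale singletonI)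
      then show "c j = 0" using J(4) j by (simp add: z_def)
    qed
    then show ?thesis using n dp by linarith
  qed
qed

end

theorem (in orthogonal_basis) cartan_subalgebra_dim_ge:
  assumes "cartan_subalgebra (fun_scale scale) commutator (so scale B) H"
  shows "n div 2 \<le> F.dim H"
proof -
  interpret cartan_in_so scale Basis B u n H by unfold_locales (rule assms)
  obtain h where h: "h \<in> H" "\<forall>h'\<in>H. \<forall>v\<in>null_part h. \<exists>m. (h' ^^ m) v = 0"
    using regular_element_exists by blast
  interpret regular_cartan_element scale Basis B u n H h
    by unfold_locales (use h in auto)
  show ?thesis by (rule dim_H_ge)
qed

subsection \<open>Index and rank\<close>

theorem theorem3:
  fixes scale :: "'k::field \<Rightarrow> 'v::ab_group_add \<Rightarrow> 'v"
    and Basis :: "'v set"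
    and B :: "'v \<Rightarrow> 'v \<Rightarrow> 'k"
    and e :: "'v \<Rightarrow> 'v"
    and n k :: nat
  assumes "CHAR('k) \<noteq> 2"
    and "nondegenerate_symmetric_form scale Basis B"
    and "vector_space.dim scale (UNIV :: 'v set) = n"
    and "e \<in> so scale B"
    and "nilpotent_map e"
    and "nilpotent_jordan_blocks scale e k"
    and "finite (UNIV :: 'k set) \<longrightarrow> k \<le> card (UNIV :: 'k set)"
  shows "lie_index (fun_scale scale) commutator (lie_centraliser commutator (so scale B) e)
           = lie_rank (fun_scale scale) commutator (so scale B) \<and>
         lie_rank (fun_scale scale) commutator (so scale B) = n div 2"
proof -
  have two: "(2::'k) \<noteq> 0"
  proof
    assume "(2::'k) = 0"
    then have dvd: "CHAR('k) dvd 2" using of_nat_eq_0_iff_char_dvd[of 2, where ?'a = 'k] by simp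
    then have "CHAR('k) \<le> 2" by (rule dvd_imp_le) simp
    moreover have "CHAR('k) \<noteq> 0" using dvd by (metis dvd_0_left_iff zero_neq_numeral)
    moreover have "CHAR('k) \<noteq> 1" using CHAR_not_1[where ?'a = 'k] by simp
    ultimately show False using assms(1) by linarith
  qed
  interpret nondegenerate_symmetric_form scale Basis B by (rule assms(2))
  interpret orthogonal_space scale Basis B by unfold_locales (rule two)
  obtain u where "orthogonal_basis scale Basis B u (dim UNIV)"
    using orthogonal_basis_exists by blast
  then interpret orthogonal_basis scale Basis B u n using assms(3) by simp
  let ?Z = "lie_centraliser commutator (so scale B) e"
  have rank: "lie_rank (fun_scale scale) commutator (so scale B) = n div 2"
    unfolding lie_rank_def
  proof (rule antisym)
    have "(INF H\<in>Collect (cartan_subalgebra (fun_scale scale) commutator (so scale B)). F.dim H)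
        \<le> F.dim standard_cartan"
      by (rule cINF_lower) (use standard_cartan(1) in auto)
    also have "\<dots> \<le> n div 2" by (rule standard_cartan(2))
    finally show "(INF H\<in>Collect (cartan_subalgebra (fun_scale scale) commutator (so scale B)). F.dim H)
        \<le> n div 2" .
    show "n div 2 \<le> (INF H\<in>Collect (cartan_subalgebra (fun_scale scale) commutator (so scale B)). F.dim H)"
      by (rule cINF_greatest) (use standard_cartan(1) cartan_subalgebra_dim_ge in auto)
  qed
  have "lie_index (fun_scale scale) commutator ?Z = n div 2"
    unfolding lie_index_def
  proof (rule antisym)
    obtain \<alpha> where \<alpha>: "\<alpha> \<in> dual_space (fun_scale scale) ?Z"
      "F.dim (stabiliser commutator ?Z \<alpha>) \<le> n div 2"
      using exists_small_stabiliser[OF assms(4-7)] assms(3) by auto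
    have "(INF \<alpha>\<in>dual_space (fun_scale scale) ?Z. F.dim (stabiliser commutator ?Z \<alpha>))
        \<le> F.dim (stabiliser commutator ?Z \<alpha>)"
      by (rule cINF_lower) (use \<alpha> in auto)
    with \<alpha>(2) show "(INF \<alpha>\<in>dual_space (fun_scale scale) ?Z. F.dim (stabiliser commutator ?Z \<alpha>)) \<le> n div 2"
      by simp
    show "n div 2 \<le> (INF \<alpha>\<in>dual_space (fun_scale scale) ?Z. F.dim (stabiliser commutator ?Z \<alpha>))"
      by (rule cINF_greatest) (use \<alpha>(1) dim_stabiliser_ge[OF assms(4)] in auto)
  qed
  with rank show ?thesis by simp
qed

end
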